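(* Let $c_1,c_2,c_3>0$. Consider the closed symmetric operator $(\mathcal M,D(\mathcal M))$, densely defined on $L^2(\mathcal Y)$, given by $$\mathcal M=\left(\left(-c_j^2\frac{d^2}{dx^2}\right)\delta_{j,k}\right)_{1\le j,k\le3},\quad\text{i.e. } \mathcal M\mathbf v=\left(-c_j^2v_j''\right)_{j=1}^3,$$ $$D(\mathcal M)=\Big\{(v_j)_{j=1}^3\in H^2(\mathcal Y):v_1(0-)=v_2(0+)=v_3(0+)=0,\ \sum_{j=2}^3c_j^2v_j'(0+)-c_1^2v_1'(0-)=0\Big\}.$$ Then the deficiency indices are $n_\pm(\mathcal M)=1$. Therefore, all the self-adjoint extensions of $(\mathcal M,D(\mathcal M))$, namely $(\mathcal J_Z,D(\mathcal J_Z))$, $Z\in\mathbb R$, are defined by $\mathcal J_Z\equiv\mathcal M$ (the same differential expression, $\mathcal J_Z\mathbf v=(-c_j^2v_j'')_{j=1}^3$) on $$D(\mathcal J_Z)=\Big\{\mathbf v=(v_j)_{j=1}^3\in H^2(\mathcal Y):v_1(0-)=v_2(0+)=v_3(0+),\ \sum_{j=2}^3c_j^2v_j'(0+)-c_1^2v_1'(0-)=Zv_1(0-)\Big\}.$$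
   Context: $\mathcal Y$ is the metric graph with edges $E_1=(-\infty,0)$, $E_2=E_3=(0,\infty)$ joined at the vertex $\nu=0$. $L^2(\mathcal Y)$ and $H^2(\mathcal Y)$ (complex-valued functions) are the direct sums of the corresponding spaces on the edges. $\delta_{j,k}$ is the Kronecker symbol. The deficiency indices of a closed densely defined symmetric operator $A$ are $n_\pm(A)=\dim\ker(A^*\mp iI)$.
   Formalization: The J_Z with Z real do not exhaust the self-adjoint extensions: the Dirichlet operator with v_1(0-)=v_2(0+)=v_3(0+)=0 and no flux condition (Z=∞) is another one; the formal statement lists the J_Z plus this single extra operator and shows that it is none of the J_Z. *)

theory Defs
  imports "HOL-Analysis.Analysis"
begin

section \<open>Lebesgue and Sobolev spaces on an interval\<close>

definition L2 :: "real set \<Rightarrow> (real \<Rightarrow> complex) set" where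
  "L2 I = {f \<in> borel_measurable (lebesgue_on I). integrable (lebesgue_on I) (\<lambda>x. (cmod (f x))\<^sup>2)}"

definition C1_compact :: "real set \<Rightarrow> (real \<Rightarrow> real) set" where
  "C1_compact I = {\<phi>. (\<forall>x. \<phi> differentiable (at x)) \<and> continuous_on UNIV (deriv \<phi>) \<and>
     (\<exists>K. compact K \<and> K \<subseteq> I \<and> (\<forall>x. x \<notin> K \<longrightarrow> \<phi> x = 0))}"

text \<open>Weak derivatives are tested, as is usual in one dimension, against compactly supported
  \<open>C\<^sup>1\<close> functions (Brezis, Functional Analysis, Sobolev Spaces and PDE, Chapter 8); real-valued
  test functions suffice by linearity.\<close>

definition has_weak_deriv :: "real set \<Rightarrow> (real \<Rightarrow> complex) \<Rightarrow> (real \<Rightarrow> complex) \<Rightarrow> bool" where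
  "has_weak_deriv I f g \<longleftrightarrow>
     (\<forall>\<phi>\<in>C1_compact I. (LINT x|lebesgue_on I. f x * of_real (deriv \<phi> x)) =
                      - (LINT x|lebesgue_on I. g x * of_real (\<phi> x)))"

text \<open>The weak derivative is unique only up to null sets; \<^term>\<open>weak_deriv\<close> below picks a
  representative, and is meaningful only on \<open>H1 I\<close>.\<close>

definition weak_deriv :: "real set \<Rightarrow> (real \<Rightarrow> complex) \<Rightarrow> real \<Rightarrow> complex" where
  "weak_deriv I f = (SOME g. g \<in> L2 I \<and> has_weak_deriv I f g)"

definition H1 :: "real set \<Rightarrow> (real \<Rightarrow> complex) set" where
  "H1 I = {f \<in> L2 I. \<exists>g\<in>L2 I. has_weak_deriv I f g}"

definition H2 :: "real set \<Rightarrow> (real \<Rightarrow> complex) set" where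
  "H2 I = {f \<in> H1 I. weak_deriv I f \<in> H1 I}"

text \<open>One-sided boundary value at \<open>0\<close> of the continuous representative; meaningful on \<open>H1 I\<close>
  for an open interval \<open>I\<close> with endpoint \<open>0\<close>.\<close>

definition trace0 :: "real set \<Rightarrow> (real \<Rightarrow> complex) \<Rightarrow> complex" where
  "trace0 I f = (THE l. \<exists>g. continuous_on I g \<and> (AE x in lebesgue_on I. g x = f x) \<and>
                     (g \<longlongrightarrow> l) (at 0 within I))"

lemma L2_add: assumes "f \<in> L2 I" "g \<in> L2 I" shows "(\<lambda>x. f x + g x) \<in> L2 I"
proof -
  have m: "f \<in> borel_measurable (lebesgue_on I)" "g \<in> borel_measurable (lebesgue_on I)"
    and i: "integrable (lebesgue_on I) (\<lambda>x. 2 * (cmod (f x))\<^sup>2 + 2 * (cmod (g x))\<^sup>2)"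
    using assms by (auto simp: L2_def)
  have "integrable (lebesgue_on I) (\<lambda>x. (cmod (f x + g x))\<^sup>2)"
  proof (rule Bochner_Integration.integrable_bound[OF i])
    show "(\<lambda>x. (cmod (f x + g x))\<^sup>2) \<in> borel_measurable (lebesgue_on I)"
      using m by measurable
    have "(cmod (f x + g x))\<^sup>2 \<le> 2 * (cmod (f x))\<^sup>2 + 2 * (cmod (g x))\<^sup>2" for x
    proof -
      have "(cmod (f x + g x))\<^sup>2 \<le> (cmod (f x) + cmod (g x))\<^sup>2"
        by (intro power_mono norm_triangle_ineq norm_ge_zero)
      also have "\<dots> \<le> 2 * (cmod (f x))\<^sup>2 + 2 * (cmod (g x))\<^sup>2"
        using sum_squares_bound[of "cmod (f x)" "cmod (g x)"] by (simp add: power2_sum)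
      finally show ?thesis .
    qed
    then show "AE x in lebesgue_on I. norm ((cmod (f x + g x))\<^sup>2) \<le>
        norm (2 * (cmod (f x))\<^sup>2 + 2 * (cmod (g x))\<^sup>2)"
      by (intro AE_I2) (simp add: abs_of_nonneg)
  qed
  then show ?thesis using m by (auto simp: L2_def)
qed

lemma L2_cmult: assumes "f \<in> L2 I" shows "(\<lambda>x. a * f x) \<in> L2 I"
  using assms by (auto simp: L2_def norm_mult power_mult_distrib)

lemma L2_zero: "(\<lambda>x. 0) \<in> L2 I"
  by (simp add: L2_def)

lemma L2_integrable_prod:
  assumes "f \<in> L2 I" "g \<in> L2 I" shows "integrable (lebesgue_on I) (\<lambda>x. f x * cnj (g x))"
proof -
  have m: "f \<in> borel_measurable (lebesgue_on I)" "g \<in> borel_measurable (lebesgue_on I)"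
    and i: "integrable (lebesgue_on I) (\<lambda>x. (cmod (f x))\<^sup>2 + (cmod (g x))\<^sup>2)"
    using assms by (auto simp: L2_def)
  show ?thesis
  proof (rule Bochner_Integration.integrable_bound[OF i])
    show "(\<lambda>x. f x * cnj (g x)) \<in> borel_measurable (lebesgue_on I)"
      using m by (intro borel_measurable_times borel_measurable_continuous_on[of cnj] continuous_intros)
    have "cmod (f x) * cmod (g x) \<le> (cmod (f x))\<^sup>2 + (cmod (g x))\<^sup>2" for x
      using sum_squares_bound[of "cmod (f x)" "cmod (g x)"]
        mult_nonneg_nonneg[OF norm_ge_zero[of "f x"] norm_ge_zero[of "g x"]] by linarith
    then show "AE x in lebesgue_on I. norm (f x * cnj (g x)) \<le> norm ((cmod (f x))\<^sup>2 + (cmod (g x))\<^sup>2)"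
      by (intro AE_I2) (simp add: norm_mult abs_of_nonneg)
  qed
qed

lemma weak_deriv_L2: assumes "f \<in> H1 I" shows "weak_deriv I f \<in> L2 I"
proof -
  have "\<exists>g. g \<in> L2 I \<and> has_weak_deriv I f g" using assms by (auto simp: H1_def)
  then show ?thesis unfolding weak_deriv_def by (rule someI2_ex) auto
qed

lemma C1_compact_measurable:
  assumes "\<phi> \<in> C1_compact I"
  shows "\<phi> \<in> borel_measurable (lebesgue_on I)" "deriv \<phi> \<in> borel_measurable (lebesgue_on I)"
proof -
  have "continuous_on UNIV \<phi>"
    using assms unfolding C1_compact_def
    by (auto intro!: continuous_at_imp_continuous_on differentiable_imp_continuous_within)
  then have "\<phi> \<in> borel_measurable lborel"
    by (simp add: borel_measurable_continuous_onI)
  moreover have "deriv \<phi> \<in> borel_measurable lborel"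
    using assms unfolding C1_compact_def by (simp add: borel_measurable_continuous_onI)
  ultimately show "\<phi> \<in> borel_measurable (lebesgue_on I)" "deriv \<phi> \<in> borel_measurable (lebesgue_on I)"
    by (auto intro!: measurable_restrict_space1 measurable_completion)
qed

lemma has_weak_deriv_cong:
  assumes "f \<in> L2 I" "f' \<in> L2 I" "AE x in lebesgue_on I. f x = f' x"
  shows "has_weak_deriv I f g = has_weak_deriv I f' g"
proof -
  have "(LINT x|lebesgue_on I. f x * of_real (deriv \<phi> x)) =
        (LINT x|lebesgue_on I. f' x * of_real (deriv \<phi> x))" if "\<phi> \<in> C1_compact I" for \<phi>
    using assms C1_compact_measurable[OF that]
    by (intro integral_cong_AE) (auto simp: L2_def)
  then show ?thesis by (simp add: has_weak_deriv_def)
qed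

lemma weak_deriv_cong:
  assumes "f \<in> L2 I" "f' \<in> L2 I" "AE x in lebesgue_on I. f x = f' x"
  shows "weak_deriv I f = weak_deriv I f'"
  unfolding weak_deriv_def using has_weak_deriv_cong[OF assms] by simp

lemma H2_cong:
  assumes "f \<in> L2 I" "f' \<in> L2 I" "AE x in lebesgue_on I. f x = f' x"
  shows "f \<in> H2 I \<longleftrightarrow> f' \<in> H2 I"
  using assms weak_deriv_cong[OF assms] has_weak_deriv_cong[OF assms] by (simp add: H2_def H1_def)

lemma trace0_cong:
  assumes "AE x in lebesgue_on I. f x = f' x"
  shows "trace0 I f = trace0 I f'"
proof -
  have "(AE x in lebesgue_on I. g x = f x) \<longleftrightarrow> (AE x in lebesgue_on I. g x = f' x)" for g
    using assms by (auto elim: eventually_elim2)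
  then show ?thesis by (simp add: trace0_def)
qed


section \<open>The Hilbert space on the metric graph\<close>

datatype edge = E1 | E2 | E3

lemma UNIV_edge: "(UNIV :: edge set) = {E1, E2, E3}"
  using edge.exhaust by auto

instance edge :: finite
  by standard (simp add: UNIV_edge)

primrec edge_set :: "edge \<Rightarrow> real set" where
  "edge_set E1 = {..<0}"
| "edge_set E2 = {0<..}"
| "edge_set E3 = {0<..}"

definition L2Y_rel :: "(edge \<Rightarrow> real \<Rightarrow> complex) \<Rightarrow> (edge \<Rightarrow> real \<Rightarrow> complex) \<Rightarrow> bool" where
  "L2Y_rel f g \<longleftrightarrow> (\<forall>j. f j \<in> L2 (edge_set j) \<and> g j \<in> L2 (edge_set j) \<and>
                      (AE x in lebesgue_on (edge_set j). f j x = g j x))"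

quotient_type L2Y = "edge \<Rightarrow> real \<Rightarrow> complex" / partial: L2Y_rel
proof (rule part_equivpI)
  show "\<exists>f. L2Y_rel f f"
    by (rule exI[of _ "\<lambda>j x. 0"]) (simp add: L2Y_rel_def L2_zero)
  show "symp L2Y_rel"
    by (rule sympI) (auto simp: L2Y_rel_def eq_commute)
  show "transp L2Y_rel"
  proof (rule transpI)
    fix f g h assume *: "L2Y_rel f g" "L2Y_rel g h"
    have "AE x in lebesgue_on (edge_set j). f j x = h j x" for j
    proof -
      have "AE x in lebesgue_on (edge_set j). f j x = g j x"
        "AE x in lebesgue_on (edge_set j). g j x = h j x"
        using * by (auto simp: L2Y_rel_def)
      then show ?thesis by eventually_elim simp
    qed
    then show "L2Y_rel f h" using * by (auto simp: L2Y_rel_def)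
  qed
qed

text \<open>The \<open>L\<^sup>2\<close> inner product, linear in the first argument.\<close>

lift_definition cinner :: "L2Y \<Rightarrow> L2Y \<Rightarrow> complex" is
  "\<lambda>f g. \<Sum>j\<in>UNIV. LINT x|lebesgue_on (edge_set j). f j x * cnj (g j x)"
proof -
  fix f f' g g' assume *: "L2Y_rel f f'" "L2Y_rel g g'"
  have "(LINT x|lebesgue_on (edge_set j). f j x * cnj (g j x)) =
        (LINT x|lebesgue_on (edge_set j). f' j x * cnj (g' j x))" for j
  proof (rule integral_cong_AE)
    show "(\<lambda>x. f j x * cnj (g j x)) \<in> borel_measurable (lebesgue_on (edge_set j))"
      "(\<lambda>x. f' j x * cnj (g' j x)) \<in> borel_measurable (lebesgue_on (edge_set j))"
      using * by (auto simp: L2Y_rel_def intro!: borel_measurable_integrable L2_integrable_prod)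
    have "AE x in lebesgue_on (edge_set j). f j x = f' j x"
      "AE x in lebesgue_on (edge_set j). g j x = g' j x"
      using * by (auto simp: L2Y_rel_def)
    then show "AE x in lebesgue_on (edge_set j). f j x * cnj (g j x) = f' j x * cnj (g' j x)"
      by eventually_elim simp
  qed
  then show "(\<Sum>j\<in>UNIV. LINT x|lebesgue_on (edge_set j). f j x * cnj (g j x)) =
             (\<Sum>j\<in>UNIV. LINT x|lebesgue_on (edge_set j). f' j x * cnj (g' j x))" by simp
qed

lift_definition cscale :: "complex \<Rightarrow> L2Y \<Rightarrow> L2Y" is "\<lambda>a f j x. a * f j x"
  by (auto simp: L2Y_rel_def intro!: L2_cmult)

instantiation L2Y :: real_inner
begin

lift_definition zero_L2Y :: L2Y is "\<lambda>j x. 0"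
  by (simp add: L2Y_rel_def L2_zero)

lift_definition plus_L2Y :: "L2Y \<Rightarrow> L2Y \<Rightarrow> L2Y" is "\<lambda>f g j x. f j x + g j x"
  unfolding L2Y_rel_def
proof (intro allI conjI)
  fix f f' g g' :: "edge \<Rightarrow> real \<Rightarrow> complex" and j
  assume *: "\<forall>j. f j \<in> L2 (edge_set j) \<and> f' j \<in> L2 (edge_set j) \<and> (AE x in lebesgue_on (edge_set j). f j x = f' j x)"
    "\<forall>j. g j \<in> L2 (edge_set j) \<and> g' j \<in> L2 (edge_set j) \<and> (AE x in lebesgue_on (edge_set j). g j x = g' j x)"
  then show "(\<lambda>x. f j x + g j x) \<in> L2 (edge_set j)" "(\<lambda>x. f' j x + g' j x) \<in> L2 (edge_set j)"
    by (auto intro!: L2_add)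
  from * have "AE x in lebesgue_on (edge_set j). f j x = f' j x"
    "AE x in lebesgue_on (edge_set j). g j x = g' j x" by auto
  then show "AE x in lebesgue_on (edge_set j). f j x + g j x = f' j x + g' j x"
    by eventually_elim simp
qed

definition uminus_L2Y :: "L2Y \<Rightarrow> L2Y" where
  "- u = cscale (-1) u"

definition minus_L2Y :: "L2Y \<Rightarrow> L2Y \<Rightarrow> L2Y" where
  "u - v = u + (- v :: L2Y)"

definition scaleR_L2Y :: "real \<Rightarrow> L2Y \<Rightarrow> L2Y" where
  "r *\<^sub>R u = cscale (of_real r) u"

definition inner_L2Y :: "L2Y \<Rightarrow> L2Y \<Rightarrow> real" where
  "inner u v = Re (cinner u v)"

definition norm_L2Y :: "L2Y \<Rightarrow> real" where
  "norm u = sqrt (inner u u)" for u :: L2Y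

definition sgn_L2Y :: "L2Y \<Rightarrow> L2Y" where
  "sgn u = inverse (norm u) *\<^sub>R u" for u :: L2Y

definition dist_L2Y :: "L2Y \<Rightarrow> L2Y \<Rightarrow> real" where
  "dist u v = norm (u - v)" for u v :: L2Y

definition uniformity_L2Y :: "(L2Y \<times> L2Y) filter" where
  "uniformity = (INF e\<in>{0<..}. principal {(u :: L2Y, v). dist u v < e})"

definition open_L2Y :: "L2Y set \<Rightarrow> bool" where
  "open U = (\<forall>u\<in>U. \<forall>\<^sub>F (u', v) in uniformity. u' = u \<longrightarrow> v \<in> U)" for U :: "L2Y set"

instance
proof
  fix a b :: real and u v w :: L2Y
  show "u + v + w = u + (v + w)"
    by transfer (auto simp: L2Y_rel_def add.assoc intro!: L2_add)
  show "u + v = v + u"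
    by transfer (auto simp: L2Y_rel_def add.commute intro!: L2_add)
  show "0 + u = u"
    by transfer (auto simp: L2Y_rel_def)
  show "- u + u = 0"
    unfolding uminus_L2Y_def by transfer (auto simp: L2Y_rel_def L2_zero)
  show "u - v = u + - v"
    by (simp add: minus_L2Y_def)
  show "a *\<^sub>R (u + v) = a *\<^sub>R u + a *\<^sub>R v"
    unfolding scaleR_L2Y_def
    by transfer (auto simp: L2Y_rel_def distrib_left intro!: L2_add L2_cmult)
  show "(a + b) *\<^sub>R u = a *\<^sub>R u + b *\<^sub>R u"
    unfolding scaleR_L2Y_def
    by transfer (auto simp: L2Y_rel_def distrib_right intro!: L2_add L2_cmult)
  show "a *\<^sub>R b *\<^sub>R u = (a * b) *\<^sub>R u"
    unfolding scaleR_L2Y_def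
    by transfer (auto simp: L2Y_rel_def mult.assoc intro!: L2_cmult)
  show "1 *\<^sub>R u = u"
    unfolding scaleR_L2Y_def by transfer (auto simp: L2Y_rel_def)
  show "sgn u = inverse (norm u) *\<^sub>R u" by (simp add: sgn_L2Y_def)
  show "dist u v = norm (u - v)" by (simp add: dist_L2Y_def)
  show "uniformity = (INF e\<in>{0<..}. principal {(u :: L2Y, v). dist u v < e})"
    by (simp add: uniformity_L2Y_def)
  show "open U = (\<forall>u\<in>U. \<forall>\<^sub>F (u', v) in uniformity. u' = u \<longrightarrow> v \<in> U)" for U :: "L2Y set"
    by (simp add: open_L2Y_def)
  show "norm u = sqrt (inner u u)" by (simp add: norm_L2Y_def)
  have cnj_int: "cnj (LINT x|M. f x) = (LINT x|M. cnj (f x))" for M and f :: "real \<Rightarrow> complex"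
    by simp
  show "inner u v = inner v u"
  proof -
    have "cinner u v = cnj (cinner v u)"
      by transfer (simp del: integral_cnj add: cnj_int mult.commute)
    then show ?thesis by (simp add: inner_L2Y_def)
  qed
  have "cinner (u + v) w = cinner u w + cinner v w"
    by transfer (auto simp: L2Y_rel_def distrib_right sum.distrib[symmetric]
        intro!: sum.cong Bochner_Integration.integral_add L2_integrable_prod)
  then show "inner (u + v) w = inner u w + inner v w"
    by (simp add: inner_L2Y_def)
  have "cinner (cscale z u) v = z * cinner u v" for z
    by transfer (simp add: mult.assoc sum_distrib_left)
  then show "inner (a *\<^sub>R u) v = a * inner u v"
    by (simp add: inner_L2Y_def scaleR_L2Y_def)
  have re: "Re (LINT x|lebesgue_on (edge_set j). f j x * cnj (f j x)) =
      (LINT x|lebesgue_on (edge_set j). (cmod (f j x))\<^sup>2)" for f and j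
  proof -
    have "(LINT x|lebesgue_on (edge_set j). f j x * cnj (f j x)) =
      (LINT x|lebesgue_on (edge_set j). complex_of_real ((cmod (f j x))\<^sup>2))"
      by (simp add: complex_norm_square del: of_real_power)
    then show ?thesis by (simp only: integral_complex_of_real Re_complex_of_real)
  qed
  have nonneg: "0 \<le> (LINT x|lebesgue_on (edge_set j). (cmod (f j x))\<^sup>2)" for f j
    by simp
  show "0 \<le> inner u u"
    unfolding inner_L2Y_def by transfer (simp add: re sum_nonneg)
  show "inner u u = 0 \<longleftrightarrow> u = 0"
    unfolding inner_L2Y_def
  proof transfer
    fix f assume f: "L2Y_rel f f"
    have "Re (\<Sum>j\<in>UNIV. LINT x|lebesgue_on (edge_set j). f j x * cnj (f j x)) = 0 \<longleftrightarrow>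
        (\<forall>j. (LINT x|lebesgue_on (edge_set j). (cmod (f j x))\<^sup>2) = 0)"
      by (simp add: re sum_nonneg_eq_0_iff nonneg)
    also have "\<dots> \<longleftrightarrow> (\<forall>j. AE x in lebesgue_on (edge_set j). (cmod (f j x))\<^sup>2 = 0)"
      using f by (intro all_cong1 integral_nonneg_eq_0_iff_AE) (auto simp: L2Y_rel_def L2_def)
    also have "\<dots> \<longleftrightarrow> L2Y_rel f (\<lambda>j x. 0)"
      using f by (auto simp: L2Y_rel_def L2_zero)
    finally show "Re (\<Sum>j\<in>UNIV. LINT x|lebesgue_on (edge_set j). f j x * cnj (f j x)) = 0 \<longleftrightarrow>
        L2Y_rel f (\<lambda>j x. 0)" .
  qed
qed

end

interpretation cscale: vector_space cscale
proof
  fix a b :: complex and u v :: L2Y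
  show "cscale a (u + v) = cscale a u + cscale a v"
    by transfer (auto simp: L2Y_rel_def distrib_left intro!: L2_add L2_cmult)
  show "cscale (a + b) u = cscale a u + cscale b u"
    by transfer (auto simp: L2Y_rel_def distrib_right intro!: L2_add L2_cmult)
  show "cscale a (cscale b u) = cscale (a * b) u"
    by transfer (auto simp: L2Y_rel_def mult.assoc intro!: L2_cmult)
  show "cscale 1 u = u"
    by transfer (auto simp: L2Y_rel_def)
qed

lift_definition in_H2Y :: "L2Y \<Rightarrow> bool" is "\<lambda>f. \<forall>j. f j \<in> H2 (edge_set j)"
  using H2_cong by (fastforce simp: L2Y_rel_def)

definition H2Y :: "L2Y set" where
  "H2Y = {v. in_H2Y v}"

text \<open>\<open>vtx v j\<close> and \<open>dvtx v j\<close> are the boundary values at the vertex of the component of \<open>v\<close> on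
  edge \<open>j\<close> and of its derivative; the limits are from the left on \<open>E1\<close> and from the right on
  \<open>E2\<close> and \<open>E3\<close>.\<close>

lift_definition vtx :: "L2Y \<Rightarrow> edge \<Rightarrow> complex" is "\<lambda>f j. trace0 (edge_set j) (f j)"
  by (auto simp: L2Y_rel_def intro!: trace0_cong ext)

lift_definition dvtx :: "L2Y \<Rightarrow> edge \<Rightarrow> complex" is
  "\<lambda>f j. trace0 (edge_set j) (weak_deriv (edge_set j) (f j))"
  by (rule ext, rule arg_cong[where f = "trace0 _"], rule weak_deriv_cong) (auto simp: L2Y_rel_def)

text \<open>The differential expression; the value \<open>0\<close> off \<open>H2\<close> is a dummy.\<close>

lift_definition diff_expr :: "(edge \<Rightarrow> real) \<Rightarrow> L2Y \<Rightarrow> L2Y" is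
  "\<lambda>c f j. if f j \<in> H2 (edge_set j)
           then (\<lambda>x. - (of_real (c j))\<^sup>2 * weak_deriv (edge_set j) (weak_deriv (edge_set j) (f j)) x)
           else (\<lambda>x. 0)"
proof -
  fix c :: "edge \<Rightarrow> real" and f f' :: "edge \<Rightarrow> real \<Rightarrow> complex"
  assume *: "L2Y_rel f f'"
  let ?h = "\<lambda>f j. if f j \<in> H2 (edge_set j)
           then (\<lambda>x. - (of_real (c j))\<^sup>2 * weak_deriv (edge_set j) (weak_deriv (edge_set j) (f j)) x)
           else (\<lambda>x. 0)"
  have "?h f j = ?h f' j" for j
    using * weak_deriv_cong[of "f j" "edge_set j" "f' j"] H2_cong[of "f j" "edge_set j" "f' j"]
    unfolding L2Y_rel_def by auto
  moreover have "?h f j \<in> L2 (edge_set j)" for j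
  proof (cases "f j \<in> H2 (edge_set j)")
    case True
    then have "weak_deriv (edge_set j) (weak_deriv (edge_set j) (f j)) \<in> L2 (edge_set j)"
      by (intro weak_deriv_L2) (simp add: H2_def)
    from L2_cmult[OF this] show ?thesis by (simp only: True if_True)
  next
    case False
    then show ?thesis by (simp add: L2_zero)
  qed
  ultimately show "L2Y_rel (?h f) (?h f')"
    unfolding L2Y_rel_def by simp
qed


section \<open>Unbounded operators\<close>

text \<open>An operator is identified with its graph, so that inclusion is extension of operators and
  equality means equal domains and equal action.\<close>

type_synonym operator = "(L2Y \<times> L2Y) set"

definition restrict_op :: "L2Y set \<Rightarrow> (L2Y \<Rightarrow> L2Y) \<Rightarrow> operator" where
  "restrict_op D T = {(v, T v) |v. v \<in> D}"

definition linear_op :: "operator \<Rightarrow> bool" where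
  "linear_op A \<longleftrightarrow> (0, 0) \<in> A \<and>
     (\<forall>(u, w)\<in>A. \<forall>(u', w')\<in>A. (u + u', w + w') \<in> A) \<and>
     (\<forall>a. \<forall>(u, w)\<in>A. (cscale a u, cscale a w) \<in> A) \<and> single_valued A"

definition densely_defined :: "operator \<Rightarrow> bool" where
  "densely_defined A \<longleftrightarrow> closure (Domain A) = UNIV"

definition symmetric_op :: "operator \<Rightarrow> bool" where
  "symmetric_op A \<longleftrightarrow> (\<forall>(u, Au)\<in>A. \<forall>(v, Av)\<in>A. cinner Au v = cinner u Av)"

text \<open>Single-valued when \<open>A\<close> is densely defined.\<close>

definition adjoint_op :: "operator \<Rightarrow> operator" where
  "adjoint_op A = {(v, w). \<forall>(u, Au)\<in>A. cinner Au v = cinner u w}"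

definition self_adjoint_op :: "operator \<Rightarrow> bool" where
  "self_adjoint_op A \<longleftrightarrow> linear_op A \<and> densely_defined A \<and> adjoint_op A = A"

definition deficiency_plus :: "operator \<Rightarrow> nat" where
  "deficiency_plus A = cscale.dim {v. (v, cscale \<i> v) \<in> adjoint_op A}"

definition deficiency_minus :: "operator \<Rightarrow> nat" where
  "deficiency_minus A = cscale.dim {v. (v, cscale (- \<i>) v) \<in> adjoint_op A}"


section \<open>The operators on the graph\<close>

definition flux :: "(edge \<Rightarrow> real) \<Rightarrow> L2Y \<Rightarrow> complex" where
  "flux c v = (\<Sum>j\<in>{E2, E3}. (of_real (c j))\<^sup>2 * dvtx v j) - (of_real (c E1))\<^sup>2 * dvtx v E1"

definition M_op :: "(edge \<Rightarrow> real) \<Rightarrow> operator" where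
  "M_op c = restrict_op
     {v \<in> H2Y. vtx v E1 = 0 \<and> vtx v E2 = 0 \<and> vtx v E3 = 0 \<and> flux c v = 0} (diff_expr c)"

definition J_op :: "(edge \<Rightarrow> real) \<Rightarrow> real \<Rightarrow> operator" where
  "J_op c Z = restrict_op
     {v \<in> H2Y. vtx v E1 = vtx v E2 \<and> vtx v E2 = vtx v E3 \<and> flux c v = of_real Z * vtx v E1}
     (diff_expr c)"

text \<open>The decoupled Dirichlet operator, the limiting case \<open>Z = \<infinity>\<close> of \<^const>\<open>J_op\<close>. It too is a
  self-adjoint extension of \<^const>\<open>M_op\<close>, so a complete list of extensions has to include it.\<close>

definition J_inf_op :: "(edge \<Rightarrow> real) \<Rightarrow> operator" where
  "J_inf_op c = restrict_op {v \<in> H2Y. vtx v E1 = 0 \<and> vtx v E2 = 0 \<and> vtx v E3 = 0} (diff_expr c)"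

end

theory Submission
  imports Defs
begin

text \<open>On each edge, \<open>H\<^sup>2\<close> functions have a representative whose first derivative is a primitive of an \<open>L\<^sup>2\<close>
  function up to the vertex, so integration by parts gives Green's formula: \<open>\<langle>T u, v\<rangle> - \<langle>u, T v\<rangle>\<close> is a
  sesquilinear form in the boundary values at the vertex, and these can be prescribed arbitrarily.
  Weak regularity shows that the adjoint of any operator containing the minimal one acts as \<open>T\<close> on \<open>H\<^sup>2\<close>, so
  every adjoint is described by a boundary condition. In this way the adjoint of \<open>M\<close> is \<open>T\<close> on the functions
  continuous at the vertex, and there the form reduces to \<open>\<phi>(u) cnj (a(v)) - a(u) cnj (\<phi>(v))\<close> in the vertex value
  \<open>a\<close> and the flux \<open>\<phi>\<close>. A self-adjoint extension is a Lagrangian subspace for this two-dimensional form: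
  either \<open>a = 0\<close> or \<open>\<phi> = Z a\<close> with \<open>Z\<close> real. The deficiency spaces are spanned by decaying exponentials.\<close>

section \<open>Primitives of locally integrable functions\<close>

text \<open>The obstacle that shapes the proof is a mismatch: elements of \<open>L2Y\<close> are
  classes modulo null sets and \<open>weak_deriv\<close> is an arbitrary choice, whereas Green's
  formula needs values at a point. \<open>primitive_on\<close> bridges the two. It expresses
  absolute continuity through integrals instead of pointwise derivatives, and taking the closed
  half-line for \<open>S\<close> makes \<open>F 0\<close> the trace. The price is a product rule and
  a du Bois-Reymond lemma for such functions. A second obstacle is that membership in H2 asks for a
  square integrable first derivative, while the adjoint relation controls only \<open>v\<close> and
  its second weak derivative. The missing bound is a growth argument at infinity, in
  \<open>square_integrable_derivative\<close>. Density is proved for the smallest domain, with all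
  boundary data zero, so that it serves every operator at once. Closedness of M comes from writing M
  as the adjoint of its own adjoint: the graph of an adjoint is an intersection of closed
  sets.\<close>

definition primitive_on :: "real set \<Rightarrow> (real \<Rightarrow> 'a::euclidean_space) \<Rightarrow> (real \<Rightarrow> 'a) \<Rightarrow> bool" where
  "primitive_on S F f \<longleftrightarrow> (\<forall>a\<in>S. \<forall>b\<in>S. a \<le> b \<longrightarrow>
     f absolutely_integrable_on {a..b} \<and> integral {a..b} f = F b - F a)"

lemma primitive_onD:
  assumes "primitive_on S F f" "a \<in> S" "b \<in> S" "a \<le> b"
  shows "f absolutely_integrable_on {a..b}" "f integrable_on {a..b}"
    "integral {a..b} f = F b - F a" "(f has_integral (F b - F a)) {a..b}"
  using assms unfolding primitive_on_def
  by (auto intro: set_lebesgue_integral_eq_integral(1))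
    (metis integrable_integral set_lebesgue_integral_eq_integral(1))

lemma primitive_on_subset: "primitive_on S F f \<Longrightarrow> T \<subseteq> S \<Longrightarrow> primitive_on T F f"
  unfolding primitive_on_def by blast

lemma primitive_on_continuous_Icc:
  assumes "primitive_on {a..b} F f"
  shows "continuous_on {a..b} F"
proof (cases "a \<le> b")
  case True
  have "continuous_on {a..b} (\<lambda>x. F a + integral {a..x} f)"
    using primitive_onD(2)[OF assms, of a b] True
    by (intro continuous_intros indefinite_integral_continuous_1) auto
  then show ?thesis
    by (rule continuous_on_eq) (use primitive_onD(3)[OF assms, of a] True in auto)
qed auto

lemma primitive_on_add:
  assumes "primitive_on S F f" "primitive_on S G g"
  shows "primitive_on S (\<lambda>x. F x + G x) (\<lambda>x. f x + g x)"
  unfolding primitive_on_def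
proof (intro ballI impI conjI)
  fix a b assume ab: "a \<in> S" "b \<in> S" "a \<le> b"
  note * = primitive_onD[OF assms(1) ab] primitive_onD[OF assms(2) ab]
  show "(\<lambda>x. f x + g x) absolutely_integrable_on {a..b}"
    using * by (intro set_integral_add) auto
  show "integral {a..b} (\<lambda>x. f x + g x) = F b + G b - (F a + G a)"
    using * by (simp add: Henstock_Kurzweil_Integration.integral_add)
qed

lemma primitive_on_linear:
  assumes "primitive_on S F f" "bounded_linear h"
  shows "primitive_on S (\<lambda>x. h (F x)) (\<lambda>x. h (f x))"
  unfolding primitive_on_def
proof (intro ballI impI conjI)
  fix a b assume ab: "a \<in> S" "b \<in> S" "a \<le> b"
  note * = primitive_onD[OF assms(1) ab]
  show "(\<lambda>x. h (f x)) absolutely_integrable_on {a..b}"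
    using absolutely_integrable_linear[OF *(1) assms(2)] by (simp add: o_def)
  show "integral {a..b} (\<lambda>x. h (f x)) = h (F b) - h (F a)"
    using integral_linear[OF *(2) assms(2)] *(3) linear_simps(2)[OF assms(2)] by (simp add: o_def)
qed

lemma primitive_on_cmult: "primitive_on S F f \<Longrightarrow> primitive_on S (\<lambda>x. c * F x) (\<lambda>x. c * f x)"
  for c :: complex
  by (rule primitive_on_linear[of S F f "(*) c", OF _ bounded_linear_mult_right])

lemma primitive_on_cnj: "primitive_on S F f \<Longrightarrow> primitive_on S (\<lambda>x. cnj (F x)) (\<lambda>x. cnj (f x))"
  by (rule primitive_on_linear[OF _ bounded_linear_cnj])

lemma primitive_on_diff:
  fixes F G :: "real \<Rightarrow> complex"
  assumes "primitive_on S F f" "primitive_on S G g"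
  shows "primitive_on S (\<lambda>x. F x - G x) (\<lambda>x. f x - g x)"
  using primitive_on_add[OF assms(1) primitive_on_cmult[OF assms(2), of "-1"]] by simp

lemma primitive_on_reflect:
  assumes "primitive_on S F f"
  shows "primitive_on (uminus ` S) (\<lambda>x. F (- x)) (\<lambda>x. - f (- x))"
  unfolding primitive_on_def
proof safe
  fix a b assume ab: "a \<in> S" "b \<in> S" "- a \<le> - b"
  note * = primitive_onD[OF assms ab(2,1)]
  have "(\<lambda>x. f (- x)) absolutely_integrable_on {-a..-b}" 
    using * ab absolutely_integrable_reflect_real[where f=f and a=b and b=a] by simp
  then show "(\<lambda>x. - f (- x)) absolutely_integrable_on {-a..-b}"
    using absolutely_integrable_linear[OF _ bounded_linear_minus[OF bounded_linear_ident]]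
    by (fastforce simp: o_def)
  show "integral {-a..-b} (\<lambda>x. - f (- x)) = F (- (- b)) - F (- (- a))"
    using * ab by simp
qed

text \<open>The finite exceptional set \<open>K\<close> admits piecewise smooth functions; the
  intended case is a truncated polynomial whose second derivative jumps at the two cut points.
  Boundedness of \<open>f\<close> on compact intervals upgrades the gauge integral of the
  fundamental theorem to an absolutely convergent one.\<close>

lemma primitive_on_has_vector_derivative:
  fixes F :: "real \<Rightarrow> 'a::euclidean_space"
  assumes "finite K" "continuous_on UNIV F" "\<And>x. x \<notin> K \<Longrightarrow> (F has_vector_derivative f x) (at x)"
    and f: "f \<in> borel_measurable lebesgue" "\<And>a b. bounded (f ` {a..b})"
  shows "primitive_on UNIV F f"
  unfolding primitive_on_def
proof (intro ballI impI)
  fix a b :: real assume ab: "a \<le> b"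
  have "(f has_integral F b - F a) {a..b}"
    using assms by (intro fundamental_theorem_of_calculus_interior_strong[OF assms(1) ab])
      (auto intro: continuous_on_subset)
  moreover have "f absolutely_integrable_on {a..b}"
  proof -
    obtain B where "\<And>x. x \<in> {a..b} \<Longrightarrow> norm (f x) \<le> B"
      using f(2)[of a b] unfolding bounded_iff by (metis imageI)
    then show ?thesis
      by (intro measurable_bounded_by_integrable_imp_absolutely_integrable[where g="\<lambda>x. B"])
        (use f in \<open>auto intro: measurable_restrict_space1\<close>)
  qed
  ultimately show "f absolutely_integrable_on {a..b} \<and> integral {a..b} f = F b - F a"
    by (simp add: integral_unique)
qed

text \<open>The factors in the product rule below are only absolutely continuous, so it is proved by
  summing these increments over a partition on whose intervals both functions oscillate little.\<close>

lemma mult_increment_bound: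
  fixes F G :: "real \<Rightarrow> complex"
  assumes F: "primitive_on {a..b} F f" and G: "primitive_on {a..b} G g" and "a \<le> b"
    and osc: "\<And>x. x \<in> {a..b} \<Longrightarrow> cmod (F x - F b) \<le> e" "\<And>x. x \<in> {a..b} \<Longrightarrow> cmod (G x - G a) \<le> e"
  shows "(\<lambda>x. F x * g x + f x * G x) absolutely_integrable_on {a..b}"
    "cmod (F b * G b - F a * G a - integral {a..b} (\<lambda>x. F x * g x + f x * G x))
      \<le> e * integral {a..b} (\<lambda>x. cmod (f x) + cmod (g x))"
proof -
  have ab: "a \<in> {a..b}" "b \<in> {a..b}" using assms by auto
  note f = primitive_onD[OF F ab \<open>a \<le> b\<close>] and g = primitive_onD[OF G ab \<open>a \<le> b\<close>]
  have FG: "continuous_on {a..b} F" "continuous_on {a..b} G"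
    by (rule primitive_on_continuous_Icc; fact)+
  have prod: "(\<lambda>x. P x * p x) absolutely_integrable_on {a..b}"
    if "continuous_on {a..b} P" "p absolutely_integrable_on {a..b}" for P p :: "real \<Rightarrow> complex"
    using that
    by (intro absolutely_integrable_bounded_measurable_product[of "(*)"])
      (auto simp: bilinear_conv_bounded_bilinear intro: continuous_imp_measurable_on_sets_lebesgue
         compact_imp_bounded compact_continuous_image bounded_bilinear_mult)
  have 1: "(\<lambda>x. F x * g x) absolutely_integrable_on {a..b}" "(\<lambda>x. f x * G x) absolutely_integrable_on {a..b}"
    using prod[OF FG(1) g(1)] prod[OF FG(2) f(1)] by (simp_all add: mult.commute)
  show 2: "(\<lambda>x. F x * g x + f x * G x) absolutely_integrable_on {a..b}"
    using 1 by (intro set_integral_add) auto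
  \<comment> \<open>Freezing \<open>F\<close> at \<open>b\<close> and \<open>G\<close> at
    \<open>a\<close> makes the integral telescope exactly to \<open>F b * G b - F a * G a\<close>;
    only the oscillation error is left to estimate.\<close>
  have "((\<lambda>x. F b * g x + f x * G a) has_integral (F b * (G b - G a) + (F b - F a) * G a)) {a..b}"
    using f(4) g(4) by (intro has_integral_add has_integral_mult_right has_integral_mult_left)
  then have "((\<lambda>x. (F b * g x + f x * G a) - (F x * g x + f x * G x)) has_integral
      ((F b * (G b - G a) + (F b - F a) * G a) - integral {a..b} (\<lambda>x. F x * g x + f x * G x))) {a..b}"
    by (intro has_integral_diff integrable_integral set_lebesgue_integral_eq_integral(1)[OF 2])
  then have 3: "((\<lambda>x. (F b - F x) * g x + f x * (G a - G x)) has_integral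
     (F b * G b - F a * G a - integral {a..b} (\<lambda>x. F x * g x + f x * G x))) {a..b}"
    by (simp add: algebra_simps)
  have n: "(\<lambda>x. cmod (f x) + cmod (g x)) integrable_on {a..b}"
    using f g by (intro integrable_add) (auto simp: absolutely_integrable_on_def)
  have "cmod (integral {a..b} (\<lambda>x. (F b - F x) * g x + f x * (G a - G x)))
    \<le> integral {a..b} (\<lambda>x. e * (cmod (f x) + cmod (g x)))"
  proof (rule integral_norm_bound_integral)
    show "(\<lambda>x. (F b - F x) * g x + f x * (G a - G x)) integrable_on {a..b}" using 3 by blast
    show "(\<lambda>x. e * (cmod (f x) + cmod (g x))) integrable_on {a..b}"
      using n by (intro integrable_on_mult_right)
    fix x assume x: "x \<in> {a..b}"
    have "cmod ((F b - F x) * g x + f x * (G a - G x)) \<le> cmod (F x - F b) * cmod (g x) + cmod (f x) * cmod (G x - G a)"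
      by (rule order.trans[OF norm_triangle_ineq]) (simp add: norm_mult norm_minus_commute)
    also have "\<dots> \<le> e * cmod (g x) + cmod (f x) * e"
      using osc[OF x] by (intro add_mono mult_left_mono mult_right_mono) auto
    finally show "cmod ((F b - F x) * g x + f x * (G a - G x)) \<le> e * (cmod (f x) + cmod (g x))"
      by (simp add: algebra_simps)
  qed
  then show "cmod (F b * G b - F a * G a - integral {a..b} (\<lambda>x. F x * g x + f x * G x))
      \<le> e * integral {a..b} (\<lambda>x. cmod (f x) + cmod (g x))"
    using integral_unique[OF 3] by simp
qed

lemma primitive_on_mult:
  fixes F G :: "real \<Rightarrow> complex"
  assumes F: "primitive_on S F f" and G: "primitive_on S G g" and S: "is_interval S"
  shows "primitive_on S (\<lambda>x. F x * G x) (\<lambda>x. F x * g x + f x * G x)"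
  unfolding primitive_on_def
proof (intro ballI impI)
  fix a b assume ab: "a \<in> S" "b \<in> S" "a \<le> b"
  then have sub: "{a..b} \<subseteq> S" using S by (meson interval_subset_is_interval is_interval_1 atLeastAtMost_iff subsetI)
  have F: "primitive_on {a..b} F f" and G: "primitive_on {a..b} G g"
    using F G sub by (auto intro: primitive_on_subset)
  have FG: "continuous_on {a..b} F" "continuous_on {a..b} G"
    by (rule primitive_on_continuous_Icc; fact)+
  have bdd: "bounded (F ` {a..b})" "bounded (G ` {a..b})"
    using FG by (auto intro!: compact_imp_bounded compact_continuous_image)
  obtain B where B: "\<And>x. x \<in> {a..b} \<Longrightarrow> cmod (F x) \<le> B" using bdd(1) unfolding bounded_iff by (metis imageI)
  obtain C where C: "\<And>x. x \<in> {a..b} \<Longrightarrow> cmod (G x) \<le> C" using bdd(2) unfolding bounded_iff by (metis imageI)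
  define h where "h x = F x * g x + f x * G x" for x
  define n where "n x = cmod (f x) + cmod (g x)" for x
  have h: "h absolutely_integrable_on {a..b}" unfolding h_def
  \<comment> \<open>Only integrability is wanted here, so any finite bound on the oscillation
    serves.\<close>
  proof (rule mult_increment_bound(1)[OF F G \<open>a \<le> b\<close>, of "2*(\<bar>B\<bar>+\<bar>C\<bar>)"])
    fix x assume x: "x \<in> {a..b}"
    show "cmod (F x - F b) \<le> 2*(\<bar>B\<bar>+\<bar>C\<bar>)"
      using B[OF x] B[of b] ab norm_triangle_ineq4[of "F x" "F b"] by auto
    show "cmod (G x - G a) \<le> 2*(\<bar>B\<bar>+\<bar>C\<bar>)"
      using C[OF x] C[of a] ab norm_triangle_ineq4[of "G x" "G a"] by auto
  qed
  then have hi: "h integrable_on {a..b}" by (rule set_lebesgue_integral_eq_integral(1))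
  have ni: "n integrable_on {a..b}"
    unfolding n_def using primitive_onD(1)[OF F] primitive_onD(1)[OF G] ab
    by (intro integrable_add) (auto simp: absolutely_integrable_on_def)
  let ?D = "\<lambda>x y. F y * G y - F x * G x - integral {x..y} h"
  have *: "cmod (?D a b) \<le> e * integral {a..b} n" if "e > 0" for e
  proof -
    have "uniformly_continuous_on {a..b} F" "uniformly_continuous_on {a..b} G"
      using FG by (auto intro: compact_uniformly_continuous)
    then obtain d1 d2 where d: "d1 > 0" "d2 > 0"
      "\<forall>y\<in>{a..b}. \<forall>x\<in>{a..b}. dist x y < d1 \<longrightarrow> dist (F x) (F y) < e"
      "\<forall>y\<in>{a..b}. \<forall>x\<in>{a..b}. dist x y < d2 \<longrightarrow> dist (G x) (G y) < e"
      using \<open>e > 0\<close> unfolding uniformly_continuous_on_def by blast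
    define d where "d = min d1 d2 / 2"
    have dpos: "d > 0" "d < d1" "d < d2" using d by (auto simp: d_def min_def)
    have step: "cmod (?D x y) \<le> e * integral {x..y} n" if xy: "a \<le> x" "x \<le> y" "y \<le> b" "y - x \<le> d" for x y
      unfolding h_def n_def
    proof (rule mult_increment_bound(2))
      show "primitive_on {x..y} F f" "primitive_on {x..y} G g"
        using F G xy by (auto elim: primitive_on_subset)
      fix z assume "z \<in> {x..y}"
      then show "cmod (F z - F y) \<le> e" "cmod (G z - G x) \<le> e"
        using d(3)[rule_format, of y z] d(4)[rule_format, of x z] xy dpos by (auto simp: dist_norm)
    qed (use xy in auto)
    \<comment> \<open>Induction on the number of steps of length \<open>d\<close> that reach from
      \<open>a\<close> to \<open>y\<close>. Both sides are additive over adjacent intervals; the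
      last step starts at \<open>max a (y - d)\<close> so as not to leave
      \<open>{a..b}\<close>.\<close>
    have "cmod (?D a y) \<le> e * integral {a..y} n" if "a \<le> y" "y \<le> b" "y - a \<le> real k * d" for k y
      using that
    proof (induction k arbitrary: y)
      case 0
      then show ?case by simp
    next
      case (Suc k)
      define x where "x = max a (y - d)"
      have x: "a \<le> x" "x \<le> y" "y \<le> b" "y - x \<le> d" "x - a \<le> real k * d"
        using Suc.prems dpos by (auto simp: x_def max_def algebra_simps)
      have "h integrable_on {a..y}" "n integrable_on {a..y}"
        using hi ni Suc.prems by (auto elim: integrable_subinterval_real)
      then have "integral {a..y} h = integral {a..x} h + integral {x..y} h"
        "integral {a..y} n = integral {a..x} n + integral {x..y} n"
        using x by (simp_all add: Henstock_Kurzweil_Integration.integral_combine)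
      moreover have "cmod (?D a x) \<le> e * integral {a..x} n" using Suc.IH x by auto
      moreover have "cmod (?D x y) \<le> e * integral {x..y} n" using step x by auto
      moreover have "cmod (?D a x + ?D x y) \<le> cmod (?D a x) + cmod (?D x y)"
        by (rule norm_triangle_ineq)
      ultimately show ?case by (simp add: algebra_simps)
    qed
    moreover obtain k :: nat where "(b - a) / d \<le> real k" using real_arch_simple by blast
    ultimately show ?thesis using ab dpos by (auto simp: divide_le_eq)
  qed
  moreover have "integral {a..b} n \<ge> 0"
    by (intro integral_nonneg ni) (auto simp: n_def)
  ultimately have "cmod (?D a b) \<le> e" if "e > 0" for e
  proof -
    let ?N = "integral {a..b} n"
    have "cmod (?D a b) \<le> e / (1 + ?N) * ?N"
      using * \<open>?N \<ge> 0\<close> that by (simp del: times_divide_eq_left)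
    also have "\<dots> \<le> e" using \<open>?N \<ge> 0\<close> that by (simp add: field_simps)
    finally show ?thesis .
  qed
  then have "?D a b = 0" using field_le_epsilon[of "cmod (?D a b)" 0] by auto
  then show "(\<lambda>x. F x * g x + f x * G x) absolutely_integrable_on {a..b} \<and>
      integral {a..b} (\<lambda>x. F x * g x + f x * G x) = F b * G b - F a * G a"
    using h by (simp add: h_def[abs_def])
qed

lemma primitive_on_continuous:
  assumes F: "primitive_on J F f" and J: "J = {0..} \<or> J = {..0::real}"
  shows "continuous_on J F"
  unfolding continuous_on_eq_continuous_within
proof
  fix x assume x: "x \<in> J"
  obtain c d where U: "{c..d} \<subseteq> J" "x \<in> {c..d}" "J \<inter> {x-1<..<x+1} \<subseteq> {c..d}"
  proof (cases "J = {0..}")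
    case True
    then show ?thesis by (intro that[of "max 0 (x-1)" "x+1"]) (use x in auto)
  next
    case False
    then have "J = {..0}" using J by simp
    then show ?thesis by (intro that[of "x-1" "min 0 (x+1)"]) (use x in auto)
  qed
  have "continuous_on {c..d} F"
    using primitive_on_subset[OF F U(1)] by (rule primitive_on_continuous_Icc)
  then have "continuous (at x within {c..d}) F"
    using U(2) by (simp only: continuous_on_eq_continuous_within)
  moreover have "at x within J = at x within {c..d}"
  proof (rule at_within_nhd[of _ "{x-1<..<x+1}"])
    show "J \<inter> {x-1<..<x+1} - {x} = {c..d} \<inter> {x-1<..<x+1} - {x}" using U by blast
  qed simp_all
  ultimately show "continuous (at x within J) F" by simp
qed

lemma primitive_on_exists:
  assumes "0 \<in> J" and f: "\<And>a b. a \<in> J \<Longrightarrow> b \<in> J \<Longrightarrow> a \<le> b \<Longrightarrow> f absolutely_integrable_on {a..b}"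
  shows "\<exists>F. primitive_on J F f"
proof
  \<comment> \<open>The primitive is normalised to vanish at 0. For negative \<open>x\<close> the
    set \<open>{0..x}\<close> is empty, hence the explicit sign.\<close>
  let ?F = "\<lambda>x. if 0 \<le> x then integral {0..x} f else - integral {x..0} f"
  show "primitive_on J ?F f"
    unfolding primitive_on_def
  proof (intro ballI impI conjI f)
    fix a b assume ab: "a \<in> J" "b \<in> J" "a \<le> b"
    have *: "f integrable_on {x..y}" if "x \<in> J" "y \<in> J" "x \<le> y" for x y
      using f[OF that] by (rule set_lebesgue_integral_eq_integral(1))
    consider "0 \<le> a" | "a < 0" "0 \<le> b" | "b < 0" by linarith
    then show "integral {a..b} f = ?F b - ?F a"
    proof cases
      case 1
      then show ?thesis
        using Henstock_Kurzweil_Integration.integral_combine[of 0 a b f] * ab \<open>0 \<in> J\<close> by (auto simp: algebra_simps)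
    next
      case 2
      then show ?thesis
        using Henstock_Kurzweil_Integration.integral_combine[of a 0 b f] * ab by (auto simp: algebra_simps)
    next
      case 3
      then show ?thesis
        using Henstock_Kurzweil_Integration.integral_combine[of a b 0 f] * ab \<open>0 \<in> J\<close> by (auto simp: algebra_simps)
    qed
  qed
qed

section \<open>Integrability and decay on the half-line\<close>

lemma integrable_lebesgue_on_iff:
  assumes "S \<in> sets lebesgue"
  shows "integrable (lebesgue_on S) f \<longleftrightarrow> f absolutely_integrable_on S"
  using assms by (simp add: integrable_restrict_space set_integrable_def)

lemma AE_lebesgue_on_iff:
  assumes "S \<in> sets lebesgue"
  shows "(AE x in lebesgue_on S. P x) \<longleftrightarrow> negligible {x\<in>S. \<not> P x}"
proof -
  have "(AE x in lebesgue_on S. P x) \<longleftrightarrow> (AE x in lebesgue. x \<in> S \<longrightarrow> P x)"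
    using assms by (simp add: AE_restrict_space_iff)
  also have "\<dots> \<longleftrightarrow> (\<exists>N. negligible N \<and> {x\<in>S. \<not> P x} \<subseteq> N)"
    unfolding eventually_ae_filter negligible_iff_null_sets Bex_def by simp
  also have "\<dots> \<longleftrightarrow> negligible {x\<in>S. \<not> P x}"
    using negligible_subset by blast
  finally show ?thesis .
qed

text \<open>If \<open>d\<close> were positive, the integral of \<open>|f|\<close> over
  \<open>{x0..X}\<close> would grow at least like \<open>d * (X - x0)\<close>.\<close>

lemma not_integrable_bounded_below:
  fixes f :: "real \<Rightarrow> real"
  assumes f: "f absolutely_integrable_on {0..}" and le: "\<And>x. x \<ge> x0 \<Longrightarrow> d \<le> f x" and "x0 \<ge> 0"
  shows "d \<le> 0"
proof (rule ccontr)
  assume d: "\<not> d \<le> 0"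
  let ?N = "integral {0..} (\<lambda>x. \<bar>f x\<bar>)"
  have n: "(\<lambda>x. \<bar>f x\<bar>) integrable_on {0..}"
    using f by (auto simp: absolutely_integrable_on_def)
  have "d * (X - x0) \<le> ?N" if "X \<ge> x0" for X
  proof -
    have i: "(\<lambda>x. \<bar>f x\<bar>) integrable_on {x0..X}"
      using absolutely_integrable_on_subinterval[OF f, of x0 X] \<open>x0 \<ge> 0\<close> by (auto simp: absolutely_integrable_on_def)
    have "d * (X - x0) = integral {x0..X} (\<lambda>x. d)" using that by simp
    also have "\<dots> \<le> integral {x0..X} (\<lambda>x. \<bar>f x\<bar>)"
      using le by (intro integral_le i) (auto intro: order.trans[OF le])
    also have "\<dots> \<le> ?N"
      using i n \<open>x0 \<ge> 0\<close> by (intro integral_subset_le) auto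
    finally show ?thesis .
  qed
  \<comment> \<open>At this \<open>X\<close> the lower bound equals \<open>|?N| + 1\<close>.\<close>
  from this[of "x0 + (\<bar>?N\<bar> + 1) / d"] d show False by auto
qed

text \<open>Integrability of \<open>h\<close> gives \<open>H\<close> a limit at infinity, and
  integrability of \<open>H\<close> forces that limit to be 0. This is why Green's formula has no
  contribution from infinity.\<close>

lemma integral_half_line_primitive:
  fixes H :: "real \<Rightarrow> complex"
  assumes P: "primitive_on {0..} H h" and H: "H absolutely_integrable_on {0..}"
    and h: "h absolutely_integrable_on {0..}"
  shows "integral {0..} h = - H 0"
proof -
  have "((\<lambda>b. LINT x:{0..b}|lebesgue. h x) \<longlongrightarrow> (LINT x:{0..}|lebesgue. h x)) at_top"
    by (rule tendsto_set_lebesgue_integral_at_top) (use h in auto)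
  also have "(LINT x:{0..}|lebesgue. h x) = integral {0..} h"
    using h by (rule set_lebesgue_integral_eq_integral(2))
  finally have "((\<lambda>b. H 0 + (LINT x:{0..b}|lebesgue. h x)) \<longlongrightarrow> H 0 + integral {0..} h) at_top" (is "(?f \<longlongrightarrow> ?L) _")
    by (intro tendsto_intros)
  moreover have "\<forall>\<^sub>F b in at_top. ?f b = H b"
    using eventually_ge_at_top[of 0]
    by eventually_elim (use primitive_onD[OF P] in \<open>auto simp: set_lebesgue_integral_eq_integral(2)\<close>)
  ultimately have lim: "(H \<longlongrightarrow> ?L) at_top" by (simp cong: tendsto_cong)
  have "?L = 0"
  proof (rule ccontr)
    assume L: "?L \<noteq> 0"
    have "\<forall>\<^sub>F x in at_top. cmod ?L / 2 < cmod (H x)"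
      using tendsto_norm[OF lim] L by (intro order_tendstoD(1)) auto
    then obtain x0 where x0: "\<And>x. x \<ge> x0 \<Longrightarrow> cmod ?L / 2 < cmod (H x)"
      unfolding eventually_at_top_linorder by auto
    have "cmod ?L / 2 \<le> 0"
      by (rule not_integrable_bounded_below[where f="\<lambda>x. cmod (H x)" and ?x0.0="max 0 x0"])
        (use x0 absolutely_integrable_norm[OF H] in \<open>auto intro: less_imp_le simp: o_def\<close>)
    then show False using L by simp
  qed
  then show ?thesis by (simp add: add_eq_0_iff)
qed

text \<open>Monotone convergence along the truncations of \<open>f\<close> to
  \<open>{0..k}\<close>.\<close>

lemma integrable_half_line_if_bounded:
  fixes f :: "real \<Rightarrow> real"
  assumes f: "\<And>b. b \<ge> 0 \<Longrightarrow> f integrable_on {0..b}" and "\<And>b. b \<ge> 0 \<Longrightarrow> integral {0..b} f \<le> C"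
    and nonneg: "\<And>x. f x \<ge> 0"
  shows "f integrable_on {0..}"
proof -
  let ?g = "\<lambda>k::nat. \<lambda>x. if x \<in> {0..real k} then f x else 0"
  have i: "integral {0..} (?g k) = integral {0..real k} f" for k
    using Henstock_Kurzweil_Integration.integral_restrict_Int[of "{0..}" "{0..real k}" f] by (simp add: Int_absorb1)
  have "f integrable_on {0..} \<and> (\<lambda>k. integral {0..} (?g k)) \<longlonglongrightarrow> integral {0..} f"
  proof (rule monotone_convergence_increasing)
    show "?g k integrable_on {0..}" for k
      using integrable_restrict_Int[of "{0..real k}" f "{0..}"] f[of "real k"] by (simp add: Int_absorb2)
    show "?g k x \<le> ?g (Suc k) x" for k x using nonneg by auto
    show "(\<lambda>k. ?g k x) \<longlonglongrightarrow> f x" if "x \<in> {0..}" for x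
    proof (rule tendsto_eventually)
      obtain N :: nat where "x \<le> real N" using real_arch_simple by blast
      then show "\<forall>\<^sub>F k in sequentially. ?g k x = f x"
        using that by (intro eventually_sequentiallyI[of N]) auto
    qed
    show "bounded (range (\<lambda>k. integral {0..} (?g k)))"
      unfolding bounded_iff i
      using assms(2) integral_nonneg[OF f] nonneg by (intro exI[of _ C]) auto
  qed
  then show ?thesis by simp
qed

text \<open>If \<open>V'\<close> were not square integrable, then \<open>Re (V' * cnj V)\<close>, half the derivative of
  \<open>\<bar>V\<bar>\<^sup>2\<close>, would tend to infinity, and \<open>V\<close> would not be square integrable.\<close>

lemma square_integrable_derivative:
  fixes V V' w :: "real \<Rightarrow> complex"
  assumes V: "primitive_on {0..} V V'" and V': "primitive_on {0..} V' w"
    and i: "(\<lambda>x. (cmod (V x))\<^sup>2) absolutely_integrable_on {0..}"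
      "(\<lambda>x. w x * cnj (V x)) absolutely_integrable_on {0..}"
  shows "(\<lambda>x. (cmod (V' x))\<^sup>2) integrable_on {0..}"
proof -
  let ?P = "\<lambda>x. V' x * cnj (V x)" and ?n = "\<lambda>x. (cmod (V' x))\<^sup>2"
  have int: "is_interval {0::real..}" by simp
  have P: "primitive_on {0..} (\<lambda>x. Re (?P x)) (\<lambda>x. ?n x + Re (w x * cnj (V x)))"
    using primitive_on_linear[OF primitive_on_mult[OF V' primitive_on_cnj[OF V] int] bounded_linear_Re]
    by (simp add: cmod_power2 flip: power2_eq_square)
  have Q: "primitive_on {0..} (\<lambda>x. (cmod (V x))\<^sup>2) (\<lambda>x. 2 * Re (?P x))"
    using primitive_on_linear[OF primitive_on_mult[OF V primitive_on_cnj[OF V] int] bounded_linear_Re]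
    by (simp add: cmod_power2 flip: power2_eq_square) (simp add: algebra_simps)
  define B where "B = integral {0..} (\<lambda>x. cmod (w x * cnj (V x)))"
  have wV: "(\<lambda>x. Re (w x * cnj (V x))) absolutely_integrable_on {0..}"
    using absolutely_integrable_linear[OF i(2) bounded_linear_Re] by (simp add: o_def)
  have wVb: "(\<lambda>x. Re (w x * cnj (V x))) integrable_on {0..b}" for b
    using absolutely_integrable_on_subinterval[OF wV, of 0 b]
    by (auto intro: set_lebesgue_integral_eq_integral(1))
  have n: "?n integrable_on {0..b}" if "b \<ge> 0" for b
    using integrable_diff[OF primitive_onD(2)[OF P _ _ that] wVb[of b]] that by simp
  \<comment> \<open>\<open>B\<close> bounds the contribution of \<open>w * cnj V\<close> uniformly
    in \<open>b\<close>, so up to a constant \<open>Re (?P b)\<close> grows at least as fast as the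
    integral of \<open>?n\<close>.\<close>
  have key: "Re (?P b) \<ge> Re (?P 0) + integral {0..b} ?n - B" if b: "b \<ge> 0" for b
  proof -
    have "Re (?P b) - Re (?P 0) = integral {0..b} ?n + integral {0..b} (\<lambda>x. Re (w x * cnj (V x)))"
      using primitive_onD(3)[OF P _ _ b] n[OF b] wVb[of b] b
      by (simp add: Henstock_Kurzweil_Integration.integral_add)
    moreover have "\<bar>integral {0..b} (\<lambda>x. Re (w x * cnj (V x)))\<bar> \<le> B"
    proof -
      have "(\<lambda>x. w x * cnj (V x)) absolutely_integrable_on {0..b}"
        by (rule absolutely_integrable_on_subinterval[OF i(2)]) auto
      then have 1: "(\<lambda>x. cmod (w x * cnj (V x))) integrable_on {0..b}"
        unfolding absolutely_integrable_on_def by blast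
      have "\<bar>integral {0..b} (\<lambda>x. Re (w x * cnj (V x)))\<bar> \<le> integral {0..b} (\<lambda>x. cmod (w x * cnj (V x)))"
        using integral_norm_bound_integral[OF wVb 1] abs_Re_le_cmod by (metis real_norm_def)
      also have "\<dots> \<le> B"
        unfolding B_def using 1 i(2) by (intro integral_subset_le) (auto simp: absolutely_integrable_on_def)
      finally show ?thesis .
    qed
    ultimately show ?thesis by linarith
  qed
  \<comment> \<open>The bound is chosen so that exceeding it at some \<open>b\<close> makes
    \<open>Re (?P x)\<close> at least 1 for all \<open>x\<close> beyond \<open>b\<close>. Then the
    square of \<open>V\<close> is at least 2 beyond \<open>b + 1\<close>, contradicting its
    integrability.\<close>
  show ?thesis
  proof (rule integrable_half_line_if_bounded[where C="1 + B - Re (?P 0)", OF n])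
    fix b :: real assume b: "b \<ge> 0"
    show "integral {0..b} ?n \<le> 1 + B - Re (?P 0)"
    proof (rule ccontr)
      assume "\<not> ?thesis"
      have P1: "Re (?P x) \<ge> 1" if "x \<ge> b" for x
      proof -
        have "integral {0..b} ?n \<le> integral {0..x} ?n"
          using b that by (intro integral_subset_le n) auto
        then show ?thesis using key[of x] \<open>\<not> _ \<le> _\<close> b that by auto
      qed
      have "(cmod (V x))\<^sup>2 \<ge> 2" if x: "x \<ge> b + 1" for x
      proof -
        have "2 \<le> integral {b..x} (\<lambda>x. 2::real)" using x by simp
        also have "\<dots> \<le> integral {b..x} (\<lambda>x. 2 * Re (?P x))"
        proof (intro integral_le primitive_onD(2)[OF Q])
          show "2 \<le> 2 * Re (?P y)" if "y \<in> {b..x}" for y using P1[of y] that by simp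
        qed (use x b in auto)
        also have "\<dots> = (cmod (V x))\<^sup>2 - (cmod (V b))\<^sup>2"
          using x b by (intro primitive_onD(3)[OF Q]) auto
        finally show ?thesis using zero_le_power2[of "cmod (V b)"] by linarith
      qed
      from not_integrable_bounded_below[OF i(1) this, of "b + 1"] b show False by auto
    qed
  qed auto
qed

text \<open>Lebesgue differentiation: off a null set \<open>f x\<close> is the limit of its averages
  over short intervals starting at \<open>x\<close>, and these averages vanish.\<close>

lemma zero_AE_if_integrals_zero:
  fixes f :: "real \<Rightarrow> complex"
  assumes f: "\<And>a b. a \<in> I \<Longrightarrow> b \<in> I \<Longrightarrow> a \<le> b \<Longrightarrow> (f has_integral 0) {a..b}" and I: "open I" "is_interval I"
  shows "negligible {x\<in>I. f x \<noteq> 0}"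
proof (rule locally_negligible_alt[THEN iffD2], safe)
  fix x assume x: "x \<in> I" "f x \<noteq> 0"
  then obtain e where e: "e > 0" "cball x e \<subseteq> I" using I(1) open_contains_cball by blast
  define a b where "a = x - e" and "b = x + e"
  have ab: "{a..b} \<subseteq> I" "a < x" "x < b" using e by (auto simp: a_def b_def cball_eq_atLeastAtMost)
  have ab': "a \<in> I" "b \<in> I" using ab by auto
  \<comment> \<open>Extension by zero, because the differentiation theorem asks for integrability on
    every interval of the real line.\<close>
  let ?g = "\<lambda>y. if y \<in> {a..b} then f y else 0"
  have g: "(?g has_integral 0) {c..d}" for c d
  proof -
    have "(f has_integral 0) {max a c..min b d}"
    proof (cases "max a c \<le> min b d")
      case True
      then show ?thesis using ab by (intro f) auto
    qed (simp add: has_integral_refl)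
    moreover have "{a..b} \<inter> {c..d} = {max a c..min b d}" by auto
    ultimately have "(f has_integral 0) ({c..d} \<inter> {a..b})" by (simp add: Int_commute)
    then show ?thesis using has_integral_restrict_Int[of "{a..b}" f 0 "{c..d}"] by (simp add: Int_commute)
  qed
  have "?g integrable_on cbox c d" for c d using g by (auto simp: integrable_on_def)
  from integrable_ccontinuous_explicit[OF this] obtain N where N: "negligible N"
    "\<And>x e. \<lbrakk>x \<notin> N; 0 < e\<rbrakk> \<Longrightarrow> \<exists>d>0. \<forall>h. 0 < h \<and> h < d \<longrightarrow>
        norm (integral (cbox x (x + h *\<^sub>R One)) ?g /\<^sub>R h ^ DIM(real) - ?g x) < e"
    by blast
  have "?g y = 0" if y: "y \<notin> N" for y
  proof (rule ccontr)
    assume "?g y \<noteq> 0"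
    then obtain d where d: "d > 0" "\<And>h. 0 < h \<Longrightarrow> h < d \<Longrightarrow>
        norm (integral {y..y + h} ?g /\<^sub>R h - ?g y) < norm (?g y)"
      using N(2)[OF y, of "norm (?g y)"] by (auto simp del: norm_divide)
    from d(2)[of "d/2"] d(1) show False unfolding integral_unique[OF g] by simp
  qed
  then have "y \<in> N" if "f y \<noteq> 0" "a < y" "y < b" for y using that by fastforce
  then have "{y\<in>I. f y \<noteq> 0} \<inter> {a<..<b} \<subseteq> N" by auto
  then show "\<exists>U. openin (top_of_set {x \<in> I. f x \<noteq> 0}) U \<and> x \<in> U \<and> negligible U"
    using ab x N(1)
    by (intro exI[of _ "{y\<in>I. f y \<noteq> 0} \<inter> {a<..<b}"])
      (auto intro: negligible_subset openin_open_Int)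
qed

section \<open>Half-lines, null sets and square integrable functions\<close>

definition half_line :: "real set \<Rightarrow> bool" where
  "half_line I \<longleftrightarrow> I = {0<..} \<or> I = {..<0}"

lemma half_lineD:
  assumes "half_line I"
  shows "open I" "is_interval I" "I \<in> sets lebesgue" "is_interval (insert 0 I)"
    "insert 0 I = {0..} \<or> insert 0 I = {..0}"
    "a \<in> insert 0 I \<Longrightarrow> b \<in> insert 0 I \<Longrightarrow> {a<..<b} \<subseteq> I"
    "a \<in> I \<Longrightarrow> b \<in> I \<Longrightarrow> {a..b} \<subseteq> I"
proof -
  have *: "insert 0 {0<..} = {0::real..}" "insert 0 {..<0} = {..0::real}" by auto
  show "open I" "is_interval I" "is_interval (insert 0 I)" "insert 0 I = {0..} \<or> insert 0 I = {..0}"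
    using assms * by (auto simp: half_line_def)
  show "I \<in> sets lebesgue" using assms by (auto simp: half_line_def)
  show "a \<in> insert 0 I \<Longrightarrow> b \<in> insert 0 I \<Longrightarrow> {a<..<b} \<subseteq> I" "a \<in> I \<Longrightarrow> b \<in> I \<Longrightarrow> {a..b} \<subseteq> I"
    using assms by (auto simp: half_line_def)
qed

text \<open>A compact subset of the open half-line keeps a positive distance from 0. Applied to
  \<open>{}\<close> it merely supplies two distinct points of \<open>I\<close>.\<close>

lemma half_line_compact_cover:
  assumes "half_line I" "compact K" "K \<subseteq> I"
  obtains c d where "c < d" "c \<in> I" "d \<in> I" "K \<subseteq> {c<..<d}"
proof (cases "K = {}")
  case True
  then show ?thesis using assms(1) that[of 1 2] that[of "-2" "-1"] by (auto simp: half_line_def)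
next
  case False
  obtain m where m: "m \<in> K" "\<And>x. x \<in> K \<Longrightarrow> m \<le> x" using compact_attains_inf[OF assms(2) False] by blast
  obtain M where M: "M \<in> K" "\<And>x. x \<in> K \<Longrightarrow> x \<le> M" using compact_attains_sup[OF assms(2) False] by blast
  have le: "m \<le> M" using m(2)[OF M(1)] .
  have sub: "K \<subseteq> {m..M}" using m(2) M(2) by auto
  have mM: "m \<in> I" "M \<in> I" using m(1) M(1) assms(3) by auto
  show ?thesis
  proof (cases "I = {0<..}")
    case True
    then show ?thesis using sub mM le by (intro that[of "m/2" "M+1"]) auto
  next
    case False
    then have "I = {..<0}" using assms(1) by (simp add: half_line_def)
    then show ?thesis using sub mM le by (intro that[of "m-1" "M/2"]) auto
  qed
qed

lemma absolutely_integrable_support: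
  fixes f :: "real \<Rightarrow> 'a::euclidean_space"
  assumes "f absolutely_integrable_on {c..d}" "{c..d} \<subseteq> S" "\<And>x. x \<in> S \<Longrightarrow> x \<notin> {c..d} \<Longrightarrow> f x = 0"
  shows "f absolutely_integrable_on S" "integral S f = integral {c..d} f"
proof -
  have "{x \<in> {c..d} - S. f x \<noteq> 0} = {}" "{x \<in> S - {c..d}. f x \<noteq> 0} = {}" using assms by auto
  then have "negligible {x \<in> {c..d} - S. f x \<noteq> 0}" "negligible {x \<in> S - {c..d}. f x \<noteq> 0}"
    by (simp_all only: negligible_empty)
  then show "f absolutely_integrable_on S" "integral S f = integral {c..d} f"
    using absolutely_integrable_spike_set[OF assms(1), of S] integral_spike_set[of "{c..d}" S f] by metis+
qed

lemma primitive_on_cong_AE: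
  assumes F: "primitive_on (insert 0 I) F g" and h: "negligible {x\<in>I. g x \<noteq> h x}" and I: "half_line I"
  shows "primitive_on (insert 0 I) F h"
  unfolding primitive_on_def
proof (intro ballI impI)
  fix a b assume ab: "a \<in> insert 0 I" "b \<in> insert 0 I" "a \<le> b"
  \<comment> \<open>The endpoint joins the null set, since nothing relates \<open>g 0\<close> to
    \<open>h 0\<close>.\<close>
  let ?N = "insert 0 {x\<in>I. g x \<noteq> h x}"
  have N: "negligible ?N" using h by simp
  have eq: "h x = g x" if x: "x \<in> {a..b} - ?N" for x
  proof -
    have "x \<in> insert 0 I" 
      using half_lineD(4)[OF I] ab x unfolding is_interval_1 by (meson atLeastAtMost_iff DiffD1)
    then show ?thesis using x by simp
  qed
  have "h absolutely_integrable_on {a..b}"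
    using primitive_onD(1)[OF F ab] N eq by (rule absolutely_integrable_spike)
  moreover have "integral {a..b} h = integral {a..b} g"
    using N eq[symmetric] by (rule integral_spike)
  ultimately show "h absolutely_integrable_on {a..b} \<and> integral {a..b} h = F b - F a"
    using primitive_onD(3)[OF F ab] by simp
qed

text \<open>The set where two continuous functions differ is open, and a nonempty open set is not
  negligible.\<close>

lemma continuous_eq_if_AE_eq:
  fixes F G :: "real \<Rightarrow> complex"
  assumes "continuous_on I F" "continuous_on I G" "open I" "negligible {x\<in>I. F x \<noteq> G x}" "x \<in> I"
  shows "F x = G x"
proof (rule ccontr)
  assume "F x \<noteq> G x"
  have "open {x\<in>I. F x - G x \<in> - {0}}"
    using assms(1-3) by (intro continuous_open_preimage[unfolded vimage_def Int_def, simplified] continuous_on_diff) auto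
  then have "open {x\<in>I. F x \<noteq> G x}" by simp
  then show False using open_not_negligible[of "{x\<in>I. F x \<noteq> G x}"] assms \<open>F x \<noteq> G x\<close> by blast
qed

lemma L2_iff:
  assumes "S \<in> sets lebesgue"
  shows "f \<in> L2 S \<longleftrightarrow> f \<in> borel_measurable (lebesgue_on S) \<and> (\<lambda>x. (cmod (f x))\<^sup>2) absolutely_integrable_on S"
  using assms by (simp add: L2_def integrable_lebesgue_on_iff)

lemma L2_cnj: "f \<in> L2 S \<Longrightarrow> (\<lambda>x. cnj (f x)) \<in> L2 S"
  unfolding L2_def by (auto intro: borel_measurable_continuous_on[of cnj] continuous_intros)

lemma L2_diff: "f \<in> L2 S \<Longrightarrow> g \<in> L2 S \<Longrightarrow> (\<lambda>x. f x - g x) \<in> L2 S"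
  using L2_add[OF _ L2_cmult[of g S "-1"], of f] by simp

lemma L2_mult_integrable:
  assumes "f \<in> L2 S" "g \<in> L2 S" "S \<in> sets lebesgue"
  shows "(\<lambda>x. f x * g x) absolutely_integrable_on S"
  using L2_integrable_prod[OF assms(1) L2_cnj[OF assms(2)]] assms(3) by (simp add: integrable_lebesgue_on_iff)

lemma L2_cong_AE:
  assumes f: "f \<in> L2 S" and g: "g \<in> borel_measurable (lebesgue_on S)"
    and eq: "negligible {x\<in>S. f x \<noteq> g x}" and S: "S \<in> sets lebesgue"
  shows "g \<in> L2 S"
proof -
  have "AE x in lebesgue_on S. f x = g x" using eq S by (simp add: AE_lebesgue_on_iff)
  then have "AE x in lebesgue_on S. (cmod (f x))\<^sup>2 = (cmod (g x))\<^sup>2" by eventually_elim simp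
  then have "integrable (lebesgue_on S) (\<lambda>x. (cmod (f x))\<^sup>2) = integrable (lebesgue_on S) (\<lambda>x. (cmod (g x))\<^sup>2)"
    using f g by (intro integrable_cong_AE) (auto simp: L2_def)
  then show ?thesis using f g by (simp add: L2_def)
qed

text \<open>On a bounded interval \<open>1 + |f|^2\<close> is integrable and dominates
  \<open>|f|\<close>. The endpoint 0 is allowed, so a square integrable weak derivative has a
  primitive up to the vertex.\<close>

lemma L2_locally_integrable:
  assumes I: "half_line I" and f: "f \<in> L2 I" and ab: "a \<in> insert 0 I" "b \<in> insert 0 I"
  shows "f absolutely_integrable_on {a..b}"
proof -
  have sub: "{a<..<b} \<subseteq> I" using half_lineD(6)[OF I ab] .
  have "f absolutely_integrable_on {a<..<b}"
  proof (rule measurable_bounded_by_integrable_imp_absolutely_integrable)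
    show "f \<in> borel_measurable (lebesgue_on {a<..<b})"
      using f sub by (auto simp: L2_def intro: measurable_restrict_mono)
    have "(\<lambda>x. (cmod (f x))\<^sup>2) absolutely_integrable_on {a<..<b}"
      using f sub by (auto simp: L2_iff[OF half_lineD(3)[OF I]] intro: set_integrable_subset)
    then show "(\<lambda>x. 1 + (cmod (f x))\<^sup>2) integrable_on {a<..<b}"
      by (intro integrable_add set_lebesgue_integral_eq_integral(1))
        (auto intro: absolutely_integrable_on_const)
    show "cmod (f x) \<le> 1 + (cmod (f x))\<^sup>2" for x
      using zero_le_power2[of "cmod (f x) - 1"] by (simp add: power2_eq_square algebra_simps) (smt (verit) norm_ge_zero)
  qed auto
  then show ?thesis using absolutely_integrable_on_Icc_iff_Ioo by blast
qed

section \<open>Weak derivatives on a half-line\<close>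

lemma C1_compactD:
  assumes \<phi>: "\<phi> \<in> C1_compact I" and I: "half_line I"
  obtains c d where "c < d" "c \<in> I" "d \<in> I" "\<And>x. x \<notin> {c<..<d} \<Longrightarrow> \<phi> x = 0" "\<And>x. x \<notin> {c..d} \<Longrightarrow> deriv \<phi> x = 0"
    "continuous_on UNIV \<phi>" "continuous_on UNIV (deriv \<phi>)"
    "\<And>x. (\<phi> has_real_derivative deriv \<phi> x) (at x)"
proof -
  obtain K where K: "compact K" "K \<subseteq> I" "\<And>x. x \<notin> K \<Longrightarrow> \<phi> x = 0"
    using \<phi> unfolding C1_compact_def by blast
  obtain c d where cd: "c < d" "c \<in> I" "d \<in> I" "K \<subseteq> {c<..<d}"
    using half_line_compact_cover[OF I K(1,2)] by blast
  have 0: "\<phi> x = 0" if "x \<notin> {c<..<d}" for x using cd(4) K(3)[of x] that by blast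
  have "deriv \<phi> x = 0" if x: "x \<notin> {c..d}" for x
  proof -
    have "eventually (\<lambda>y. y \<in> - {c..d}) (nhds x)" using x by (intro eventually_nhds_in_open) auto
    then have "eventually (\<lambda>y. \<phi> y = 0) (nhds x)" by eventually_elim (rule 0, auto)
    then have "deriv \<phi> x = deriv (\<lambda>_. 0) x" by (intro deriv_cong_ev) auto
    then show ?thesis by simp
  qed
  moreover have der: "(\<phi> has_real_derivative deriv \<phi> x) (at x)" for x
    using \<phi> unfolding C1_compact_def by (simp add: DERIV_deriv_iff_real_differentiable)
  moreover have "continuous_on UNIV \<phi>"
    using der by (intro DERIV_continuous_on) (auto intro: has_field_derivative_at_within)
  moreover have "continuous_on UNIV (deriv \<phi>)" using \<phi> unfolding C1_compact_def by blast
  ultimately show ?thesis using that[OF cd(1-3) 0] by blast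
qed

lemma locally_integrable_mult_continuous:
  fixes f :: "real \<Rightarrow> complex" and \<psi> :: "real \<Rightarrow> real"
  assumes "f absolutely_integrable_on {a..b}" "continuous_on UNIV \<psi>"
  shows "(\<lambda>x. f x * of_real (\<psi> x)) absolutely_integrable_on {a..b}"
proof -
  have c: "continuous_on {a..b} (\<lambda>x. complex_of_real (\<psi> x))"
    using assms(2) by (auto intro!: continuous_intros intro: continuous_on_subset)
  have "bounded ((\<lambda>x. complex_of_real (\<psi> x)) ` {a..b})"
    by (intro compact_imp_bounded compact_continuous_image c compact_Icc)
  then have "(\<lambda>x. of_real (\<psi> x) * f x) absolutely_integrable_on {a..b}"
    by (intro absolutely_integrable_bounded_measurable_product[of "(*)"] assms(1)
        continuous_imp_measurable_on_sets_lebesgue c)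
      (auto simp: bilinear_conv_bounded_bilinear bounded_bilinear_mult)
  then show ?thesis by (simp add: mult.commute)
qed

lemma primitive_on_of_real:
  assumes der: "\<And>x. (\<phi> has_real_derivative \<psi> x) (at x)" and cont: "continuous_on UNIV \<psi>"
  shows "primitive_on S (\<lambda>x. complex_of_real (\<phi> x)) (\<lambda>x. complex_of_real (\<psi> x))"
  unfolding primitive_on_def
proof (intro ballI impI conjI)
  fix a b :: real assume ab: "a \<le> b"
  show "(\<lambda>x. complex_of_real (\<psi> x)) absolutely_integrable_on {a..b}"
    using cont by (intro absolutely_integrable_continuous_real continuous_intros) (auto intro: continuous_on_subset)
  have "((\<lambda>x. complex_of_real (\<phi> x)) has_vector_derivative complex_of_real (\<psi> x)) (at x within {a..b})" for x
    using der[of x] by (intro has_vector_derivative_of_real)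
      (auto simp: has_real_derivative_iff_has_vector_derivative intro: has_vector_derivative_at_within)
  then show "integral {a..b} (\<lambda>x. complex_of_real (\<psi> x)) = of_real (\<phi> b) - of_real (\<phi> a)"
    using ab by (intro integral_unique fundamental_theorem_of_calculus) auto
qed

text \<open>The product rule with a test function: the boundary terms drop out because \<phi>
  vanishes at \<open>c\<close> and \<open>d\<close>.\<close>

lemma primitive_imp_has_weak_deriv:
  assumes I: "half_line I" and F: "primitive_on (insert 0 I) F g"
  shows "has_weak_deriv I F g"
  unfolding has_weak_deriv_def
proof
  fix \<phi> assume \<phi>: "\<phi> \<in> C1_compact I"
  obtain c d where cd: "c < d" "c \<in> I" "d \<in> I"
    and 0: "\<And>x. x \<notin> {c<..<d} \<Longrightarrow> \<phi> x = 0" "\<And>x. x \<notin> {c..d} \<Longrightarrow> deriv \<phi> x = 0"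
    and cont: "continuous_on UNIV \<phi>" "continuous_on UNIV (deriv \<phi>)"
    and der: "\<And>x. (\<phi> has_real_derivative deriv \<phi> x) (at x)"
    by (rule C1_compactD[OF \<phi> I]) blast
  have sub: "{c..d} \<subseteq> I" using half_lineD(7)[OF I cd(2,3)] .
  have F': "primitive_on {c..d} F g" using primitive_on_subset[OF F] sub by blast
  have "primitive_on {c..d} (\<lambda>x. complex_of_real (\<phi> x)) (\<lambda>x. complex_of_real (deriv \<phi> x))"
    by (rule primitive_on_of_real[OF der cont(2)])
  from primitive_on_mult[OF F' this]
  have P: "primitive_on {c..d} (\<lambda>x. F x * of_real (\<phi> x)) (\<lambda>x. F x * of_real (deriv \<phi> x) + g x * of_real (\<phi> x))"
    by simp
  have Fc: "F absolutely_integrable_on {c..d}"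
    using primitive_on_continuous_Icc[OF F'] by (rule absolutely_integrable_continuous_real)
  have gc: "g absolutely_integrable_on {c..d}"
    using primitive_onD(1)[OF F', of c d] cd by auto
  have i: "(\<lambda>x. F x * of_real (deriv \<phi> x)) absolutely_integrable_on {c..d}" 
    "(\<lambda>x. g x * of_real (\<phi> x)) absolutely_integrable_on {c..d}"
    using Fc gc cont by (auto intro: locally_integrable_mult_continuous)
  have z: "F x * of_real (deriv \<phi> x) = 0" "g x * of_real (\<phi> x) = 0" if "x \<notin> {c..d}" for x
    using 0 that by auto
  have "integral {c..d} (\<lambda>x. F x * of_real (deriv \<phi> x)) + integral {c..d} (\<lambda>x. g x * of_real (\<phi> x)) = 0"
    using primitive_onD(3)[OF P, of c d] cd 0 i[THEN set_lebesgue_integral_eq_integral(1)]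
    by (simp add: Henstock_Kurzweil_Integration.integral_add)
  then show "(LINT x|lebesgue_on I. F x * of_real (deriv \<phi> x)) = - (LINT x|lebesgue_on I. g x * of_real (\<phi> x))"
    using absolutely_integrable_support[OF i(1) sub z(1)] absolutely_integrable_support[OF i(2) sub z(2)]
      half_lineD(3)[OF I]
    by (simp add: lebesgue_integral_eq_integral integrable_lebesgue_on_iff add_eq_0_iff)
qed

text \<open>Zero mean is exactly the condition under which the primitive started at \<open>c\<close>
  vanishes again beyond \<open>d\<close>.\<close>

lemma C1_compact_antiderivative:
  assumes \<psi>: "continuous_on UNIV \<psi>" "\<And>x. x \<notin> {c..d} \<Longrightarrow> \<psi> x = 0" and cd: "c \<le> d" "{c..d} \<subseteq> I"
    and "integral {c..d} \<psi> = 0"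
  obtains \<phi> where "\<phi> \<in> C1_compact I" "deriv \<phi> = \<psi>"
proof -
  define \<phi> where "\<phi> x = integral {c..x} \<psi>" for x
  have \<psi>i: "\<psi> integrable_on {a..b}" for a b
    using \<psi>(1) by (intro integrable_continuous_real) (auto intro: continuous_on_subset)
  have der: "(\<phi> has_real_derivative \<psi> x) (at x)" for x
  proof -
    \<comment> \<open>Moving the base point to the left of both \<open>c\<close> and
      \<open>x\<close> makes \<open>x\<close> interior; the integral is unchanged because \<psi>
      vanishes left of \<open>c\<close>.\<close>
    define a b where "a = min c x - 1" and "b = x + 1"
    have ab: "a < c" "a < x" "x < b" by (auto simp: a_def b_def)
    have eq: "\<phi> y = integral {a..y} \<psi>" for y
    proof (cases "c \<le> y")
      case True
      have "integral {a..y} \<psi> = integral {a..c} \<psi> + integral {c..y} \<psi>"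
        using ab True \<psi>i by (simp add: Henstock_Kurzweil_Integration.integral_combine)
      moreover have "integral {a..c} \<psi> = 0"
        unfolding integral_open_interval_real by (rule integral_unique[OF has_integral_is_0]) (use \<psi>(2) in auto)
      ultimately show ?thesis by (simp add: \<phi>_def)
    next
      case False
      then have "integral {a..y} \<psi> = 0" by (intro integral_unique[OF has_integral_is_0]) (use \<psi>(2) in auto)
      then show ?thesis using False by (simp add: \<phi>_def)
    qed
    have "((\<lambda>y. integral {a..y} \<psi>) has_real_derivative \<psi> x) (at x within {a..b})"
      using \<psi>(1) ab by (intro integral_has_real_derivative) (auto intro: continuous_on_subset)
    then show ?thesis using ab by (simp add: eq[abs_def] at_within_Icc_at)
  qed
  then have d: "deriv \<phi> = \<psi>" by (intro ext DERIV_imp_deriv)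
  have 0: "\<phi> x = 0" if "x \<notin> {c..d}" for x
  proof (cases "x < c")
    case False
    then have x: "x > d" using that by auto
    have "integral {c..x} \<psi> = integral {c..d} \<psi> + integral {d..x} \<psi>"
      using x cd \<psi>i by (simp add: Henstock_Kurzweil_Integration.integral_combine)
    moreover have "integral {d..x} \<psi> = 0"
      unfolding integral_open_interval_real by (rule integral_unique[OF has_integral_is_0]) (use \<psi>(2) in auto)
    ultimately show ?thesis using assms(5) by (simp add: \<phi>_def)
  qed (simp add: \<phi>_def)
  have "\<phi> \<in> C1_compact I"
    unfolding C1_compact_def d using der \<psi>(1) 0 cd(2)
    by (auto simp: d real_differentiable_def intro!: exI[of _ "{c..d}"])
  then show ?thesis using d that by blast
qed

text \<open>Continuous stand-ins for the indicator of \<open>{a<..<b}\<close>. Continuity suffices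
  because they enter through derivatives of test functions, which are themselves only
  continuous.\<close>

definition bump :: "real \<Rightarrow> real \<Rightarrow> nat \<Rightarrow> real \<Rightarrow> real" where
  "bump a b n x = max 0 (min 1 (real n * ((x - a) * (b - x))))"

lemma bump:
  shows "continuous_on UNIV (bump a b n)" "0 \<le> bump a b n x" "bump a b n x \<le> 1"
    "a \<le> b \<Longrightarrow> x \<notin> {a<..<b} \<Longrightarrow> bump a b n x = 0"
    "x \<in> {a<..<b} \<Longrightarrow> 0 < n \<Longrightarrow> 0 < bump a b n x"
    "x \<in> {a<..<b} \<Longrightarrow> (\<lambda>n. bump a b n x) \<longlonglongrightarrow> 1"
proof -
  show "continuous_on UNIV (bump a b n)" unfolding bump_def by (intro continuous_intros)
  show "0 \<le> bump a b n x" "bump a b n x \<le> 1" by (auto simp: bump_def)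
  show "bump a b n x = 0" if "a \<le> b" "x \<notin> {a<..<b}"
  proof -
    have "(x - a) * (b - x) \<le> 0" using that by (auto simp: mult_le_0_iff)
    then have "real n * ((x - a) * (b - x)) \<le> 0" by (simp add: mult_le_0_iff)
    then show ?thesis by (simp add: bump_def)
  qed
  assume x: "x \<in> {a<..<b}"
  then have p: "(x - a) * (b - x) > 0" by auto
  then show "0 < bump a b n x" if "0 < n" using that by (simp add: bump_def)
  obtain N :: nat where N: "1 / ((x - a) * (b - x)) \<le> real N" using real_arch_simple by blast
  have "bump a b n x = 1" if "n \<ge> N" for n
  proof -
    have "1 / ((x - a) * (b - x)) \<le> real n" using N that by linarith
    then have "1 \<le> real n * ((x - a) * (b - x))" using p by (simp add: divide_le_eq)
    then show ?thesis by (simp add: bump_def)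
  qed
  then show "(\<lambda>n. bump a b n x) \<longlonglongrightarrow> 1"
    by (intro tendsto_eventually eventually_sequentiallyI[of N])
qed

text \<open>Testing with \<open>bump a b n\<close> and letting \<open>n\<close> grow, with
  \<open>|h|\<close> as dominating function, gives integral 0 over every interval.\<close>

lemma zero_AE_if_test_zero:
  fixes h :: "real \<Rightarrow> complex"
  assumes I: "half_line I" and h: "\<And>a b. a \<in> I \<Longrightarrow> b \<in> I \<Longrightarrow> h absolutely_integrable_on {a..b}"
    and test: "\<And>\<psi> a b. continuous_on UNIV \<psi> \<Longrightarrow> a \<in> I \<Longrightarrow> b \<in> I \<Longrightarrow> a \<le> b \<Longrightarrow> (\<And>x. x \<notin> {a..b} \<Longrightarrow> \<psi> x = 0) \<Longrightarrow>
       integral {a..b} (\<lambda>x. h x * of_real (\<psi> x)) = 0"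
  shows "negligible {x\<in>I. h x \<noteq> 0}"
proof (rule zero_AE_if_integrals_zero)
  show "open I" "is_interval I" using half_lineD[OF I] by auto
  fix a b assume ab: "a \<in> I" "b \<in> I" "a \<le> b"
  let ?f = "\<lambda>n x. h x * complex_of_real (bump a b n x)"
  have fi: "?f n integrable_on {a<..<b}" for n
    using locally_integrable_mult_continuous[OF h[OF ab(1,2)] bump(1)[of a b n], THEN set_lebesgue_integral_eq_integral(1)]
    by (simp only: integrable_on_Icc_iff_Ioo)
  have nh: "(\<lambda>x. cmod (h x)) integrable_on {a<..<b}" "h integrable_on {a<..<b}"
    using h[OF ab(1,2)] by (auto simp: absolutely_integrable_on_def integrable_on_Icc_iff_Ioo)
  have "(\<lambda>n. integral {a<..<b} (?f n)) \<longlonglongrightarrow> integral {a<..<b} h"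
  proof (rule dominated_convergence(2)[OF fi nh(1)])
    show "cmod (?f n x) \<le> cmod (h x)" for n x
      using bump(2,3)[of a b n x] by (simp add: norm_mult mult_left_le)
    show "(\<lambda>n. ?f n x) \<longlonglongrightarrow> h x" if "x \<in> {a<..<b}" for x
      using tendsto_mult[OF tendsto_const[of "h x"] tendsto_of_real[OF bump(6)[OF that]]] by simp
  qed
  moreover have "integral {a<..<b} (?f n) = 0" for n
    unfolding integral_open_interval_real[symmetric]
    by (rule test[OF bump(1) ab]) (use ab in \<open>auto intro: bump(4)\<close>)
  ultimately have "integral {a<..<b} h = 0" by (simp add: LIMSEQ_const_iff)
  then show "(h has_integral 0) {a..b}"
    using nh(2) unfolding has_integral_iff integrable_on_Icc_iff_Ioo integral_open_interval_real by simp
qed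

lemma LINT_test:
  fixes h :: "real \<Rightarrow> complex" and \<psi> :: "real \<Rightarrow> real"
  assumes I: "half_line I" and h: "h absolutely_integrable_on {c..d}"
    and \<psi>: "continuous_on UNIV \<psi>" "\<And>x. x \<notin> {c..d} \<Longrightarrow> \<psi> x = 0" and cd: "{c..d} \<subseteq> I"
  shows "integrable (lebesgue_on I) (\<lambda>x. h x * of_real (\<psi> x))"
    "(LINT x|lebesgue_on I. h x * of_real (\<psi> x)) = integral {c..d} (\<lambda>x. h x * of_real (\<psi> x))"
proof -
  note * = absolutely_integrable_support[OF locally_integrable_mult_continuous[OF h \<psi>(1)] cd]
  show i: "integrable (lebesgue_on I) (\<lambda>x. h x * of_real (\<psi> x))"
    unfolding integrable_lebesgue_on_iff[OF half_lineD(3)[OF I]] by (rule *(1)) (use \<psi> in auto)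
  show "(LINT x|lebesgue_on I. h x * of_real (\<psi> x)) = integral {c..d} (\<lambda>x. h x * of_real (\<psi> x))"
    unfolding lebesgue_integral_eq_integral[OF i half_lineD(3)[OF I]] by (rule *(2)) (use \<psi> in auto)
qed

text \<open>Subtracting a multiple of one fixed bump \<open>\<psi>0\<close> gives any \<psi> zero
  mean and hence makes it the derivative of a test function. The constant \<open>C\<close> is
  therefore the mean of \<open>h\<close> with weight \<open>\<psi>0 / s0\<close>.\<close>

lemma du_Bois_Reymond:
  fixes h :: "real \<Rightarrow> complex"
  assumes I: "half_line I" and h: "\<And>a b. a \<in> I \<Longrightarrow> b \<in> I \<Longrightarrow> h absolutely_integrable_on {a..b}"
    and test: "\<And>\<phi>. \<phi> \<in> C1_compact I \<Longrightarrow> (LINT x|lebesgue_on I. h x * of_real (deriv \<phi> x)) = 0"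
  shows "\<exists>C. negligible {x\<in>I. h x \<noteq> C}"
proof -
  obtain a0 b0 where ab0: "a0 < b0" "a0 \<in> I" "b0 \<in> I"
    using half_line_compact_cover[OF I, of "{}"] by auto
  define \<psi>0 where "\<psi>0 = bump a0 b0 1"
  have \<psi>0: "continuous_on UNIV \<psi>0" "\<And>x. x \<notin> {a0..b0} \<Longrightarrow> \<psi>0 x = 0"
    unfolding \<psi>0_def using ab0(1) by (auto intro: bump)
  define s0 where "s0 = integral {a0..b0} \<psi>0"
  have "integral {a0..b0} (\<lambda>x. 0) < s0"
    unfolding s0_def using \<psi>0(1) ab0(1)
    by (intro integral_less_real) (auto intro: continuous_on_subset simp: \<psi>0_def bump(5))
  then have s0: "s0 > 0" by simp
  define C where "C = integral {a0..b0} (\<lambda>x. h x * of_real (\<psi>0 x)) / of_real s0"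
  have "negligible {x\<in>I. h x - C \<noteq> 0}"
  proof (rule zero_AE_if_test_zero[OF I])
    show "(\<lambda>x. h x - C) absolutely_integrable_on {a..b}" if "a \<in> I" "b \<in> I" for a b
      using h[OF that] by (intro set_integral_diff) (auto intro: absolutely_integrable_on_const)
    fix \<psi> :: "real \<Rightarrow> real" and a b
    assume \<psi>: "continuous_on UNIV \<psi>" "\<And>x. x \<notin> {a..b} \<Longrightarrow> \<psi> x = 0" and ab: "a \<in> I" "b \<in> I" "a \<le> b"
    \<comment> \<open>One interval inside \<open>I\<close> that carries both \<psi> and the fixed
      bump.\<close>
    define c d where "c = min a a0" and "d = max b b0"
    have cd: "c \<in> I" "d \<in> I" "c \<le> d" "{a..b} \<subseteq> {c..d}" "{a0..b0} \<subseteq> {c..d}"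
      using ab ab0 by (auto simp: c_def d_def min_def max_def)
    have cdI: "{c..d} \<subseteq> I" using half_lineD(7)[OF I cd(1,2)] .
    note hcd = h[OF cd(1,2)]
    have ci: "\<psi> integrable_on {x..y}" "\<psi>0 integrable_on {x..y}" for x y
      using \<psi>(1) \<psi>0(1) by (auto intro!: integrable_continuous_real intro: continuous_on_subset)
    define s where "s = integral {c..d} \<psi>"
    have s0': "integral {c..d} \<psi>0 = s0"
      unfolding s0_def using \<psi>0 cd(5)
      by (intro absolutely_integrable_support(2) absolutely_integrable_continuous_real) (auto intro: continuous_on_subset)
    define \<theta> where "\<theta> x = \<psi> x - s / s0 * \<psi>0 x" for x
    have "continuous_on UNIV \<theta>" unfolding \<theta>_def by (intro continuous_intros \<psi> \<psi>0)
    moreover have z: "\<psi> x = 0" "\<psi>0 x = 0" "\<theta> x = 0" if "x \<notin> {c..d}" for x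
      using \<psi>(2)[of x] \<psi>0(2)[of x] cd that by (auto simp: \<theta>_def)
    moreover have "integral {c..d} \<theta> = 0"
      unfolding \<theta>_def using ci s0 s0'
      by (simp add: Henstock_Kurzweil_Integration.integral_diff integrable_on_mult_right s_def)
    ultimately obtain \<phi> where \<phi>: "\<phi> \<in> C1_compact I" "deriv \<phi> = \<theta>"
      using C1_compact_antiderivative[OF _ _ cd(3) cdI, of \<theta>] by blast
    have \<theta>c: "continuous_on UNIV \<theta>" by fact
    have hi: "(\<lambda>x. h x * of_real (\<psi> x)) integrable_on {c..d}" "(\<lambda>x. h x * of_real (\<psi>0 x)) integrable_on {c..d}"
      using locally_integrable_mult_continuous[OF hcd] \<psi>(1) \<psi>0(1) by (auto intro: set_lebesgue_integral_eq_integral(1))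
    have "0 = integral {c..d} (\<lambda>x. h x * of_real (\<theta> x))"
      using test[OF \<phi>(1)] LINT_test(2)[OF I hcd \<theta>c z(3) cdI] by (simp add: \<phi>(2))
    also have "\<dots> = integral {c..d} (\<lambda>x. h x * of_real (\<psi> x) - of_real (s / s0) * (h x * of_real (\<psi>0 x)))"
      by (simp add: \<theta>_def algebra_simps)
    also have "\<dots> = integral {c..d} (\<lambda>x. h x * of_real (\<psi> x)) - of_real (s / s0) * integral {c..d} (\<lambda>x. h x * of_real (\<psi>0 x))"
      using hi by (simp only: Henstock_Kurzweil_Integration.integral_diff integrable_on_mult_right
          Henstock_Kurzweil_Integration.integral_mult_right)
    also have "integral {c..d} (\<lambda>x. h x * of_real (\<psi>0 x)) = C * of_real s0"
      using absolutely_integrable_support(2)[OF locally_integrable_mult_continuous[OF h[OF ab0(2,3)] \<psi>0(1)] cd(5)] \<psi>0(2) s0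
      by (simp add: C_def)
    finally have 1: "integral {c..d} (\<lambda>x. h x * of_real (\<psi> x)) = C * of_real s" using s0 by simp
    have 2: "integral {c..d} (\<lambda>x. complex_of_real (\<psi> x)) = of_real s"
      "(\<lambda>x. complex_of_real (\<psi> x)) integrable_on {c..d}"
      using integral_linear[OF ci(1) bounded_linear_of_real] integrable_linear[OF ci(1) bounded_linear_of_real]
      by (auto simp: s_def o_def)
    have "integral {c..d} (\<lambda>x. (h x - C) * of_real (\<psi> x)) = integral {c..d} (\<lambda>x. h x * of_real (\<psi> x) - C * of_real (\<psi> x))"
      by (simp add: algebra_simps)
    also have "\<dots> = 0"
      using hi 1 2 by (simp add: Henstock_Kurzweil_Integration.integral_diff integrable_on_mult_right)
    finally have "integral {c..d} (\<lambda>x. (h x - C) * of_real (\<psi> x)) = 0" .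
    moreover have "integral {c..d} (\<lambda>x. (h x - C) * of_real (\<psi> x)) = integral {a..b} (\<lambda>x. (h x - C) * of_real (\<psi> x))"
      using h[OF ab(1,2)] \<psi> cd(4)
      by (intro absolutely_integrable_support(2) locally_integrable_mult_continuous set_integral_diff)
        (auto intro: absolutely_integrable_on_const)
    ultimately show "integral {a..b} (\<lambda>x. (h x - C) * of_real (\<psi> x)) = 0" by simp
  qed
  then show ?thesis by auto
qed

text \<open>Any primitive of \<open>g\<close> also has weak derivative \<open>g\<close>, so its
  difference from \<open>f\<close> has weak derivative 0 and is constant almost everywhere.
  Integrability of \<open>g\<close> up to 0 is what extends the continuous representative to the
  vertex.\<close>

lemma has_weak_deriv_imp_primitive:
  assumes I: "half_line I"
    and f: "\<And>a b. a \<in> I \<Longrightarrow> b \<in> I \<Longrightarrow> f absolutely_integrable_on {a..b}"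
    and g: "\<And>a b. a \<in> insert 0 I \<Longrightarrow> b \<in> insert 0 I \<Longrightarrow> g absolutely_integrable_on {a..b}"
    and weak: "has_weak_deriv I f g"
  shows "\<exists>F. primitive_on (insert 0 I) F g \<and> negligible {x\<in>I. f x \<noteq> F x}"
proof -
  obtain F where F: "primitive_on (insert 0 I) F g"
    using primitive_on_exists[of "insert 0 I" g] g by blast
  note wF = primitive_imp_has_weak_deriv[OF I F]
  have Fi: "F absolutely_integrable_on {a..b}" if "a \<in> I" "b \<in> I" for a b
  proof -
    have "primitive_on {a..b} F g"
      using half_lineD(7)[OF I that] by (intro primitive_on_subset[OF F]) blast
    then show ?thesis
      by (intro absolutely_integrable_continuous_real primitive_on_continuous_Icc)
  qed
  have "\<exists>C. negligible {x\<in>I. f x - F x \<noteq> C}"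
  proof (rule du_Bois_Reymond[OF I])
    show "(\<lambda>x. f x - F x) absolutely_integrable_on {a..b}" if "a \<in> I" "b \<in> I" for a b
      using f[OF that] Fi[OF that] by (rule set_integral_diff)
    fix \<phi> assume \<phi>: "\<phi> \<in> C1_compact I"
    obtain c d where cd: "c < d" "c \<in> I" "d \<in> I"
      and 0: "\<And>x. x \<notin> {c..d} \<Longrightarrow> deriv \<phi> x = 0" and cont: "continuous_on UNIV (deriv \<phi>)"
      by (rule C1_compactD[OF \<phi> I]) blast
    note L = LINT_test(1)[OF I _ cont 0 half_lineD(7)[OF I cd(2,3)]]
    have "(LINT x|lebesgue_on I. (f x - F x) * of_real (deriv \<phi> x)) =
      (LINT x|lebesgue_on I. f x * of_real (deriv \<phi> x)) - (LINT x|lebesgue_on I. F x * of_real (deriv \<phi> x))"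
      unfolding left_diff_distrib using L[OF f[OF cd(2,3)]] L[OF Fi[OF cd(2,3)]]
      by (rule Bochner_Integration.integral_diff)
    also have "\<dots> = 0" using weak wF \<phi> unfolding has_weak_deriv_def by simp
    finally show "(LINT x|lebesgue_on I. (f x - F x) * of_real (deriv \<phi> x)) = 0" .
  qed
  then obtain C where C: "negligible {x\<in>I. f x - F x \<noteq> C}" by blast
  have "primitive_on (insert 0 I) (\<lambda>x. F x + C) g"
    using F unfolding primitive_on_def by simp
  moreover have "{x\<in>I. f x \<noteq> F x + C} = {x\<in>I. f x - F x \<noteq> C}" by (auto simp: algebra_simps)
  with C have "negligible {x\<in>I. f x \<noteq> F x + C}" by simp
  ultimately show ?thesis by (intro exI[of _ "\<lambda>x. F x + C"]) simp
qed

lemma absolutely_integrable_reflect_set: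
  fixes f :: "real \<Rightarrow> 'a::euclidean_space"
  assumes "f absolutely_integrable_on S"
  shows "(\<lambda>x. f (- x)) absolutely_integrable_on (uminus ` S)"
    "integral (uminus ` S) (\<lambda>x. f (- x)) = integral S f"
proof -
  have i: "integrable lebesgue (\<lambda>x. indicat_real S x *\<^sub>R f x)" using assms by (simp add: set_integrable_def)
  have eq: "indicat_real S (- x) = indicat_real (uminus ` S) x" for x by (auto simp: indicator_def image_iff)
  have 2: "has_bochner_integral lebesgue (\<lambda>x. indicat_real (uminus ` S) x *\<^sub>R f (- x)) (LINT x:S|lebesgue. f x)"
    using has_bochner_integral_lebesgue_real_affine_iff[of "-1" "\<lambda>x. indicat_real S x *\<^sub>R f x" _ 0] has_bochner_integral_integrable[OF i]
    by (simp add: eq set_lebesgue_integral_def)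
  show 3: "(\<lambda>x. f (- x)) absolutely_integrable_on (uminus ` S)"
    using 2 by (simp add: set_integrable_def has_bochner_integral_iff)
  have "(LINT x:uminus ` S|lebesgue. f (- x)) = (LINT x:S|lebesgue. f x)"
    using 2 by (simp add: set_lebesgue_integral_def has_bochner_integral_iff)
  then show "integral (uminus ` S) (\<lambda>x. f (- x)) = integral S f"
    using set_lebesgue_integral_eq_integral(2)[OF assms] set_lebesgue_integral_eq_integral(2)[OF 3] by simp
qed

lemma absolutely_integrable_insert:
  fixes f :: "real \<Rightarrow> 'a::euclidean_space"
  shows "f absolutely_integrable_on (insert a S) \<longleftrightarrow> f absolutely_integrable_on S"
    "integral (insert a S) f = integral S f"
proof -
  have "negligible {x \<in> insert a S - S. f x \<noteq> 0}" "negligible {x \<in> S - insert a S. f x \<noteq> 0}"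
    by (rule negligible_subset[of "{a}"]; auto)+
  then show "f absolutely_integrable_on (insert a S) \<longleftrightarrow> f absolutely_integrable_on S"
    "integral (insert a S) f = integral S f"
    by (rule absolutely_integrable_spike_set_eq, rule integral_spike_set)
qed

text \<open>The analysis at infinity is done on \<open>{0..}\<close> only; the negative case is
  phrased so that a reflection leads there.\<close>

lemma half_line_cases [consumes 1, case_names pos neg]:
  assumes "half_line I"
    and "I = {0<..} \<Longrightarrow> insert 0 I = {0..} \<Longrightarrow> P" 
    and "I = {..<0} \<Longrightarrow> uminus ` insert 0 I = {0..} \<Longrightarrow> 0 \<notin> I \<Longrightarrow> P"
  shows P
proof -
  have "insert 0 {0<..} = {0::real..}" "uminus ` insert 0 {..<0::real} = {0..}"
    by (force simp: image_iff)+
  then show ?thesis using assms unfolding half_line_def by auto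
qed

lemma integral_primitive_half_line:
  fixes H :: "real \<Rightarrow> complex"
  assumes I: "half_line I" and P: "primitive_on (insert 0 I) H h"
    and H: "H absolutely_integrable_on I" and h: "h absolutely_integrable_on I"
  shows "integral I h = (if I = {0<..} then - H 0 else H 0)"
  using I
proof (cases rule: half_line_cases)
  case pos
  then have "integral (insert 0 I) h = - H 0"
    using P H h by (metis integral_half_line_primitive absolutely_integrable_insert(1))
  then show ?thesis using pos by (simp add: absolutely_integrable_insert(2) del: pos(2))
next
  case neg
  note ins = absolutely_integrable_insert(1)[of 0 I]
  have h': "(\<lambda>x. - h (- x)) absolutely_integrable_on (uminus ` insert 0 I)"
    using absolutely_integrable_linear[OF absolutely_integrable_reflect_set(1) bounded_linear_minus[OF bounded_linear_ident]] h ins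
    by (fastforce simp: o_def)
  have "integral (uminus ` insert 0 I) (\<lambda>x. - h (- x)) = - H (- 0)"
    using primitive_on_reflect[OF P] h' absolutely_integrable_reflect_set(1)[of "insert 0 I" H] H ins
    unfolding neg(2) by (intro integral_half_line_primitive) auto
  moreover have "integral (uminus ` insert 0 I) (\<lambda>x. h (- x)) = integral I h"
    using absolutely_integrable_reflect_set(2)[of "insert 0 I" h] h ins absolutely_integrable_insert(2) by metis
  moreover have "I \<noteq> {0<..}"
  proof
    assume "I = {0<..}"
    then have "(1::real) \<in> {..<0}" using neg(1) by (metis greaterThan_iff zero_less_one)
    then show False by simp
  qed
  ultimately show ?thesis by simp
qed

lemma primitive_on_borel_measurable:
  assumes I: "half_line I" and F: "primitive_on (insert 0 I) F f"
  shows "F \<in> borel_measurable (lebesgue_on I)"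
  using primitive_on_continuous[OF F half_lineD(5)[OF I]] half_lineD(3)[OF I]
  by (intro continuous_imp_measurable_on_sets_lebesgue) (auto intro: continuous_on_subset)

text \<open>Recovers the first-derivative bound that H2 requires from bounds on \<open>V\<close> and
  \<open>w\<close> alone; the negative half-line is reflected.\<close>

lemma primitive_L2:
  assumes I: "half_line I" and V: "primitive_on (insert 0 I) V V'" and V': "primitive_on (insert 0 I) V' w"
    and L2: "V \<in> L2 I" "w \<in> L2 I"
  shows "V' \<in> L2 I"
proof -
  have "(\<lambda>x. (cmod (V' x))\<^sup>2) absolutely_integrable_on I"
    using I
  proof (cases rule: half_line_cases)
    case pos
    have "(\<lambda>x. (cmod (V' x))\<^sup>2) integrable_on {0..}"
    proof (rule square_integrable_derivative)
      show "primitive_on {0..} V V'" "primitive_on {0..} V' w" using V V' pos by simp_all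
      show "(\<lambda>x. (cmod (V x))\<^sup>2) absolutely_integrable_on {0..}"
        "(\<lambda>x. w x * cnj (V x)) absolutely_integrable_on {0..}"
        unfolding pos(2)[symmetric] absolutely_integrable_insert
        using L2 L2_mult_integrable[OF L2(2) L2_cnj[OF L2(1)]] by (auto simp: L2_iff half_lineD(3)[OF I])
    qed
    then have "(\<lambda>x. (cmod (V' x))\<^sup>2) absolutely_integrable_on (insert 0 I)"
      unfolding pos(2) by (rule nonnegative_absolutely_integrable_1) simp
    then show ?thesis by (simp only: absolutely_integrable_insert)
  next
    case neg
    have "(\<lambda>x. (cmod (- V' (- x)))\<^sup>2) integrable_on {0..}"
    proof (rule square_integrable_derivative)
      show "primitive_on {0..} (\<lambda>x. V (- x)) (\<lambda>x. - V' (- x))"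
        using primitive_on_reflect[OF V] unfolding neg(2) .
      show "primitive_on {0..} (\<lambda>x. - V' (- x)) (\<lambda>x. w (- x))"
        using primitive_on_cmult[OF primitive_on_reflect[OF V'], of "-1"] unfolding neg(2) by simp
      show "(\<lambda>x. (cmod (V (- x)))\<^sup>2) absolutely_integrable_on {0..}"
        unfolding neg(2)[symmetric]
        using L2 by (intro absolutely_integrable_reflect_set(1)) (auto simp: L2_iff half_lineD(3)[OF I] absolutely_integrable_insert)
      show "(\<lambda>x. w (- x) * cnj (V (- x))) absolutely_integrable_on {0..}"
        unfolding neg(2)[symmetric]
        using L2_mult_integrable[OF L2(2) L2_cnj[OF L2(1)] half_lineD(3)[OF I]]
          absolutely_integrable_reflect_set(1)[of "insert 0 I" "\<lambda>x. w x * cnj (V x)"]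
        by (simp add: absolutely_integrable_insert)
    qed
    then have "(\<lambda>x. (cmod (V' (- x)))\<^sup>2) absolutely_integrable_on {0..}"
      by (intro nonnegative_absolutely_integrable_1) auto
    from absolutely_integrable_reflect_set(1)[OF this] have "(\<lambda>x. (cmod (V' x))\<^sup>2) absolutely_integrable_on (uminus ` {0..})"
      by simp
    moreover have "uminus ` {0::real..} = insert 0 I"
      unfolding neg(2)[symmetric] by (simp only: image_image minus_minus image_ident)
    ultimately show ?thesis by (simp add: absolutely_integrable_insert)
  qed
  then show ?thesis
    using primitive_on_borel_measurable[OF I V'] by (simp add: L2_iff half_lineD(3)[OF I])
qed

text \<open>Makes the choice inside \<open>weak_deriv\<close> harmless. The primitives of
  \<open>g\<close> and \<open>g'\<close> both represent \<open>f\<close>, hence coincide on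
  \<open>I\<close> by continuity, and so \<open>g - g'\<close> has integral 0 over every
  interval.\<close>

lemma has_weak_deriv_unique:
  assumes I: "half_line I" and f: "f \<in> L2 I" and g: "g \<in> L2 I" "g' \<in> L2 I"
    and weak: "has_weak_deriv I f g" "has_weak_deriv I f g'"
  shows "negligible {x\<in>I. g x \<noteq> g' x}"
proof -
  note loc = L2_locally_integrable[OF I]
  obtain F where F: "primitive_on (insert 0 I) F g" "negligible {x\<in>I. f x \<noteq> F x}"
    using has_weak_deriv_imp_primitive[OF I loc[OF f] loc[OF g(1)] weak(1)] by auto
  obtain F' where F': "primitive_on (insert 0 I) F' g'" "negligible {x\<in>I. f x \<noteq> F' x}"
    using has_weak_deriv_imp_primitive[OF I loc[OF f] loc[OF g(2)] weak(2)] by auto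
  have "continuous_on I F" "continuous_on I F'"
    using primitive_on_continuous[OF F(1) half_lineD(5)[OF I]] primitive_on_continuous[OF F'(1) half_lineD(5)[OF I]]
    by (auto intro: continuous_on_subset)
  moreover have "negligible {x\<in>I. F x \<noteq> F' x}"
    by (rule negligible_subset[OF negligible_Un[OF F(2) F'(2)]]) auto
  ultimately have eq: "F x = F' x" if "x \<in> I" for x
    using continuous_eq_if_AE_eq half_lineD(1)[OF I] that by blast
  have "negligible {x\<in>I. g x - g' x \<noteq> 0}"
  proof (rule zero_AE_if_integrals_zero)
    fix a b assume ab: "a \<in> I" "b \<in> I" "a \<le> b"
    then show "((\<lambda>x. g x - g' x) has_integral 0) {a..b}"
      using has_integral_diff[OF primitive_onD(4)[OF F(1), of a b] primitive_onD(4)[OF F'(1), of a b]] eq by simp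
  qed (use half_lineD[OF I] in auto)
  then show ?thesis by simp
qed

text \<open>The description in \<open>trace0\<close> is unique because continuous representatives
  agree on all of \<open>I\<close> and 0 is a limit point of \<open>I\<close>.\<close>

lemma trace0_eq:
  assumes I: "half_line I" and F: "primitive_on (insert 0 I) F g" and f: "negligible {x\<in>I. f x \<noteq> F x}"
  shows "trace0 I f = F 0"
proof -
  have cF: "continuous_on (insert 0 I) F"
    using primitive_on_continuous[OF F half_lineD(5)[OF I]] .
  then have cFI: "continuous_on I F" by (rule continuous_on_subset) auto
  have nt: "at 0 within I \<noteq> bot"
    using I unfolding half_line_def by (auto simp: at_within_eq_bot_iff)
  have lim: "(F \<longlongrightarrow> F 0) (at 0 within I)"
    using cF unfolding continuous_on_def by (meson insertI1 subset_insertI tendsto_within_subset)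
  have ae: "(AE x in lebesgue_on I. g x = f x) \<longleftrightarrow> negligible {x\<in>I. g x \<noteq> f x}" for g
    using half_lineD(3)[OF I] by (simp add: AE_lebesgue_on_iff)
  show ?thesis unfolding trace0_def ae
  proof (rule the_equality)
    have "{x\<in>I. F x \<noteq> f x} = {x\<in>I. f x \<noteq> F x}" by auto
    then show "\<exists>g. continuous_on I g \<and> negligible {x\<in>I. g x \<noteq> f x} \<and> (g \<longlongrightarrow> F 0) (at 0 within I)"
      using f lim cFI by auto
    fix l assume "\<exists>g. continuous_on I g \<and> negligible {x\<in>I. g x \<noteq> f x} \<and> (g \<longlongrightarrow> l) (at 0 within I)"
    then obtain g where g: "continuous_on I g" "negligible {x\<in>I. g x \<noteq> f x}" "(g \<longlongrightarrow> l) (at 0 within I)" by blast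
    have "negligible {x\<in>I. g x \<noteq> F x}"
      by (rule negligible_subset[OF negligible_Un[OF g(2) f]]) auto
    then have "g x = F x" if "x \<in> I" for x
      using continuous_eq_if_AE_eq[OF g(1) cFI half_lineD(1)[OF I]] that by blast
    then have "(F \<longlongrightarrow> l) (at 0 within I)"
      using g(3) by (rule_tac Lim_transform_within[of g l 0 I 1]) auto
    then show "l = F 0" using lim nt tendsto_unique by blast
  qed
qed

text \<open>Membership in \<open>H\<^sup>2\<close> through primitives on \<open>insert 0 I\<close>: including the endpoint makes \<open>F 0\<close> and \<open>G 0\<close>
  the traces.\<close>

definition H2_data :: "real set \<Rightarrow> (real \<Rightarrow> complex) \<Rightarrow> (real \<Rightarrow> complex) \<Rightarrow> (real \<Rightarrow> complex) \<Rightarrow> bool" where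
  "H2_data I F G H \<longleftrightarrow> primitive_on (insert 0 I) F G \<and> primitive_on (insert 0 I) G H \<and>
     F \<in> L2 I \<and> G \<in> L2 I \<and> H \<in> L2 I"

lemma weak_deriv_AE_eq:
  assumes I: "half_line I" and F: "primitive_on (insert 0 I) F G" and L2: "F \<in> L2 I" "G \<in> L2 I"
  shows "F \<in> H1 I" "negligible {x\<in>I. weak_deriv I F x \<noteq> G x}"
proof -
  have w: "has_weak_deriv I F G" by (rule primitive_imp_has_weak_deriv[OF I F])
  then show H1: "F \<in> H1 I" using L2 by (auto simp: H1_def)
  have "weak_deriv I F \<in> L2 I \<and> has_weak_deriv I F (weak_deriv I F)"
    unfolding weak_deriv_def by (rule someI[of _ G]) (use L2 w in auto)
  then show "negligible {x\<in>I. weak_deriv I F x \<noteq> G x}"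
    using has_weak_deriv_unique[OF I L2(1) _ L2(2) _ w] by blast
qed

lemma H2_dataD:
  assumes I: "half_line I" and D: "H2_data I F G H"
  shows "F \<in> H2 I" "negligible {x\<in>I. weak_deriv I F x \<noteq> G x}"
    "negligible {x\<in>I. weak_deriv I (weak_deriv I F) x \<noteq> H x}"
    "trace0 I F = F 0" "trace0 I (weak_deriv I F) = G 0"
proof -
  have FG: "primitive_on (insert 0 I) F G" and GH: "primitive_on (insert 0 I) G H"
    and L2: "F \<in> L2 I" "G \<in> L2 I" "H \<in> L2 I" using D by (auto simp: H2_data_def)
  note F = weak_deriv_AE_eq[OF I FG L2(1,2)] and G = weak_deriv_AE_eq[OF I GH L2(2,3)]
  show F2: "negligible {x\<in>I. weak_deriv I F x \<noteq> G x}" by (rule F(2))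
  have wL2: "weak_deriv I F \<in> L2 I" by (rule weak_deriv_L2[OF F(1)])
  have ae: "AE x in lebesgue_on I. weak_deriv I F x = G x"
    using F2 by (simp add: AE_lebesgue_on_iff half_lineD(3)[OF I])
  \<comment> \<open>\<open>weak_deriv I F\<close> and \<open>G\<close> agree only almost everywhere,
    but such functions have the same set of weak derivatives, so the choice operator returns
    literally the same function for both.\<close>
  show "negligible {x\<in>I. weak_deriv I (weak_deriv I F) x \<noteq> H x}"
    unfolding weak_deriv_cong[OF wL2 L2(2) ae] by (rule G(2))
  have "weak_deriv I F \<in> H1 I"
    using G(1) wL2 has_weak_deriv_cong[OF wL2 L2(2) ae] by (simp add: H1_def)
  then show "F \<in> H2 I" using F(1) by (simp add: H2_def)
  show "trace0 I F = F 0" by (rule trace0_eq[OF I FG]) simp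
  show "trace0 I (weak_deriv I F) = G 0" by (rule trace0_eq[OF I GH F2])
qed

text \<open>Converse of \<open>H2_dataD\<close>. The chosen derivative \<open>g\<close> of
  \<open>f\<close> has itself a continuous representative \<open>G\<close>, and replacing
  \<open>g\<close> by \<open>G\<close> leaves the primitive \<open>F\<close> unchanged.\<close>

lemma H2_obtain:
  assumes I: "half_line I" and f: "f \<in> H2 I"
  obtains F G H where "H2_data I F G H" "negligible {x\<in>I. f x \<noteq> F x}"
proof -
  note loc = L2_locally_integrable[OF I]
  have weak: "weak_deriv I g \<in> L2 I" "has_weak_deriv I g (weak_deriv I g)" if "g \<in> H1 I" for g
  proof -
    have "\<exists>h. h \<in> L2 I \<and> has_weak_deriv I g h" using that by (auto simp: H1_def)
    then have "weak_deriv I g \<in> L2 I \<and> has_weak_deriv I g (weak_deriv I g)"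
      unfolding weak_deriv_def by (rule someI_ex)
    then show "weak_deriv I g \<in> L2 I" "has_weak_deriv I g (weak_deriv I g)" by auto
  qed
  define g h where "g = weak_deriv I f" and "h = weak_deriv I g"
  have H1: "f \<in> H1 I" "g \<in> H1 I" using f by (auto simp: H2_def g_def)
  then have L2: "f \<in> L2 I" "g \<in> L2 I" by (auto simp: H1_def)
  note wf = weak[OF H1(1), folded g_def] and wg = weak[OF H1(2), folded h_def]
  obtain F where F: "primitive_on (insert 0 I) F g" "negligible {x\<in>I. f x \<noteq> F x}"
    using has_weak_deriv_imp_primitive[OF I loc[OF L2(1)] loc[OF L2(2)] wf(2)] by auto
  obtain G where G: "primitive_on (insert 0 I) G h" "negligible {x\<in>I. g x \<noteq> G x}"
    using has_weak_deriv_imp_primitive[OF I loc[OF L2(2)] loc[OF wg(1)] wg(2)] by auto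
  have FG: "primitive_on (insert 0 I) F G" by (rule primitive_on_cong_AE[OF F(1) G(2) I])
  have "F \<in> L2 I" "G \<in> L2 I"
    using L2_cong_AE[OF L2(1) primitive_on_borel_measurable[OF I F(1)] F(2) half_lineD(3)[OF I]]
      L2_cong_AE[OF L2(2) primitive_on_borel_measurable[OF I G(1)] G(2) half_lineD(3)[OF I]] .
  then have "H2_data I F G h" using FG G(1) wg(1) by (simp add: H2_data_def)
  then show ?thesis using F(2) that by blast
qed

section \<open>Regularity of weak second derivatives\<close>

lemma continuous_compact_support_L2:
  fixes f :: "real \<Rightarrow> complex"
  assumes I: "half_line I" and f: "continuous_on {c..d} f" "\<And>x. x \<notin> {c..d} \<Longrightarrow> f x = 0" and cd: "{c..d} \<subseteq> I"
  shows "f \<in> L2 I"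
proof -
  have "f absolutely_integrable_on I"
    by (rule absolutely_integrable_support(1)[OF absolutely_integrable_continuous_real[OF f(1)] cd]) (rule f(2))
  then have "f \<in> borel_measurable (lebesgue_on I)"
    using half_lineD(3)[OF I] by (rule absolutely_integrable_imp_borel_measurable)
  moreover have "(\<lambda>x. (cmod (f x))\<^sup>2) absolutely_integrable_on I"
    by (rule absolutely_integrable_support(1)[OF absolutely_integrable_continuous_real cd])
      (use f in \<open>auto intro!: continuous_intros\<close>)
  ultimately show ?thesis using half_lineD(3)[OF I] by (simp add: L2_iff)
qed

lemma C1_compact_L2:
  assumes I: "half_line I" and \<phi>: "\<phi> \<in> C1_compact I"
  shows "(\<lambda>x. complex_of_real (\<phi> x)) \<in> L2 I" "(\<lambda>x. complex_of_real (deriv \<phi> x)) \<in> L2 I"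
proof -
  obtain c d where cd: "c < d" "c \<in> I" "d \<in> I"
    and 0: "\<And>x. x \<notin> {c<..<d} \<Longrightarrow> \<phi> x = 0" "\<And>x. x \<notin> {c..d} \<Longrightarrow> deriv \<phi> x = 0"
    and cont: "continuous_on UNIV \<phi>" "continuous_on UNIV (deriv \<phi>)"
    by (rule C1_compactD[OF \<phi> I]) blast
  show "(\<lambda>x. complex_of_real (\<phi> x)) \<in> L2 I" "(\<lambda>x. complex_of_real (deriv \<phi> x)) \<in> L2 I"
    using 0 half_lineD(7)[OF I cd(2,3)] cont
    by (intro continuous_compact_support_L2[OF I, of c d] continuous_intros; auto intro: continuous_on_subset)+
qed

lemma C1_compact_lincomb:
  assumes "\<phi> \<in> C1_compact I" "\<psi> \<in> C1_compact I"
  shows "(\<lambda>x. \<phi> x - s * \<psi> x) \<in> C1_compact I" "deriv (\<lambda>x. \<phi> x - s * \<psi> x) = (\<lambda>x. deriv \<phi> x - s * deriv \<psi> x)"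
proof -
  have d: "\<And>x. (\<phi> has_real_derivative deriv \<phi> x) (at x)" "\<And>x. (\<psi> has_real_derivative deriv \<psi> x) (at x)"
    using assms unfolding C1_compact_def by (simp_all add: DERIV_deriv_iff_real_differentiable)
  have der: "((\<lambda>x. \<phi> x - s * \<psi> x) has_real_derivative (deriv \<phi> x - s * deriv \<psi> x)) (at x)" for x
    by (intro DERIV_diff d DERIV_cmult)
  then show eq: "deriv (\<lambda>x. \<phi> x - s * \<psi> x) = (\<lambda>x. deriv \<phi> x - s * deriv \<psi> x)"
    by (intro ext DERIV_imp_deriv)
  obtain K L where K: "compact K" "K \<subseteq> I" "\<And>x. x \<notin> K \<Longrightarrow> \<phi> x = 0" and L: "compact L" "L \<subseteq> I" "\<And>x. x \<notin> L \<Longrightarrow> \<psi> x = 0"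
    using assms unfolding C1_compact_def by blast
  have "compact (K \<union> L)" "K \<union> L \<subseteq> I" "\<And>x. x \<notin> K \<union> L \<Longrightarrow> \<phi> x - s * \<psi> x = 0"
    using K L by auto
  moreover have "continuous_on UNIV (\<lambda>x. deriv \<phi> x - s * deriv \<psi> x)"
    using assms unfolding C1_compact_def by (intro continuous_intros) auto
  ultimately show "(\<lambda>x. \<phi> x - s * \<psi> x) \<in> C1_compact I"
    unfolding C1_compact_def mem_Collect_eq eq using der real_differentiable_def by blast
qed

lemma continuous_locally_integrable:
  fixes F :: "real \<Rightarrow> complex"
  assumes "half_line I" "continuous_on I F" "a \<in> I" "b \<in> I"
  shows "F absolutely_integrable_on {a..b}"
  using half_lineD(7)[OF assms(1,3,4)] assms(2)
  by (intro absolutely_integrable_continuous_real) (rule continuous_on_subset)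

text \<open>If all test functions had integral zero, then \<open>x\<close>, whose weak derivative is \<open>1\<close>, would also have
  weak derivative \<open>0\<close> and be constant.\<close>

lemma ex_C1_compact_integral_nonzero:
  assumes I: "half_line I"
  shows "\<exists>\<phi>\<in>C1_compact I. (LINT x|lebesgue_on I. complex_of_real (\<phi> x)) \<noteq> 0"
proof (rule ccontr)
  assume *: "\<not> ?thesis"
  have F: "primitive_on (insert 0 I) (\<lambda>x. complex_of_real x) (\<lambda>x. complex_of_real 1)"
    by (rule primitive_on_of_real[of "\<lambda>x. x" "\<lambda>x. 1"]) auto
  have "\<exists>C. negligible {x\<in>I. complex_of_real x \<noteq> C}"
  proof (rule du_Bois_Reymond[OF I])
    show "(\<lambda>x. complex_of_real x) absolutely_integrable_on {a..b}" for a b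
      by (intro absolutely_integrable_continuous_real continuous_intros)
    show "(LINT x|lebesgue_on I. complex_of_real x * complex_of_real (deriv \<phi> x)) = 0" if "\<phi> \<in> C1_compact I" for \<phi>
      using primitive_imp_has_weak_deriv[OF I F] * that by (auto simp: has_weak_deriv_def)
  qed
  then obtain C where C: "negligible {x\<in>I. complex_of_real x \<noteq> C}" by blast
  have eq: "complex_of_real x = C" if "x \<in> I" for x
    using continuous_eq_if_AE_eq[OF _ _ half_lineD(1)[OF I] C that] by (auto intro!: continuous_intros)
  obtain c d where "c < d" "c \<in> I" "d \<in> I" using half_line_compact_cover[OF I, of "{}"] by auto
  then show False using eq[of c] eq[of d] by auto
qed

text \<open>With \<open>W\<close> a double primitive of \<open>w\<close>, the difference
  \<open>h = v - W\<close> annihilates all second derivatives of test functions. It then has a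
  constant weak derivative and is affine, so \<open>v\<close> is \<open>W\<close> plus an affine
  function almost everywhere.\<close>

lemma second_weak_deriv_regularity:
  assumes I: "half_line I" and v: "v \<in> L2 I" and w: "w \<in> L2 I"
    and test: "\<And>\<phi>. \<phi> \<in> C1_compact I \<Longrightarrow> deriv \<phi> \<in> C1_compact I \<Longrightarrow>
      (LINT x|lebesgue_on I. v x * of_real (deriv (deriv \<phi>) x)) = (LINT x|lebesgue_on I. w x * of_real (\<phi> x))"
  obtains V V' where "H2_data I V V' w" "negligible {x\<in>I. v x \<noteq> V x}"
proof -
  note loc = L2_locally_integrable[OF I]
  obtain W' where W': "primitive_on (insert 0 I) W' w"
    using primitive_on_exists[of "insert 0 I" w] loc[OF w] by blast
  have "W' absolutely_integrable_on {a..b}" if "a \<in> insert 0 I" "b \<in> insert 0 I" for a b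
  proof (cases "a \<le> b")
    case True
    then have "{a..b} \<subseteq> insert 0 I"
      using half_lineD(4)[OF I] that unfolding is_interval_1 by (meson atLeastAtMost_iff subsetI)
    then show ?thesis
      using primitive_on_continuous[OF W' half_lineD(5)[OF I]]
      by (intro absolutely_integrable_continuous_real) (rule continuous_on_subset)
  qed simp
  then obtain W where W: "primitive_on (insert 0 I) W W'"
    using primitive_on_exists[of "insert 0 I" W'] by blast
  have cW: "continuous_on I W"
    using primitive_on_continuous[OF W half_lineD(5)[OF I]] by (rule continuous_on_subset) auto
  define h where "h x = v x - W x" for x
  have hloc: "h absolutely_integrable_on {a..b}" if "a \<in> I" "b \<in> I" for a b
    unfolding h_def using loc[OF v] continuous_locally_integrable[OF I cW that] that
    by (intro set_integral_diff) auto
  have Lh: "integrable (lebesgue_on I) (\<lambda>x. g x * of_real (deriv \<phi> x))" 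
    if \<phi>: "\<phi> \<in> C1_compact I" and g: "\<And>a b. a \<in> I \<Longrightarrow> b \<in> I \<Longrightarrow> g absolutely_integrable_on {a..b}" for g :: "real \<Rightarrow> complex" and \<phi>
  proof -
    obtain c d where cd: "c < d" "c \<in> I" "d \<in> I"
      and 0: "\<And>x. x \<notin> {c..d} \<Longrightarrow> deriv \<phi> x = 0" and cont: "continuous_on UNIV (deriv \<phi>)"
      by (rule C1_compactD[OF \<phi> I]) blast
    show ?thesis by (rule LINT_test(1)[OF I g[OF cd(2,3)] cont 0 half_lineD(7)[OF I cd(2,3)]])
  qed
  have h0: "(LINT x|lebesgue_on I. h x * of_real (deriv (deriv \<phi>) x)) = 0"
    if \<phi>: "\<phi> \<in> C1_compact I" "deriv \<phi> \<in> C1_compact I" for \<phi>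
  proof -
    have "(LINT x|lebesgue_on I. h x * of_real (deriv (deriv \<phi>) x)) =
      (LINT x|lebesgue_on I. v x * of_real (deriv (deriv \<phi>) x)) - (LINT x|lebesgue_on I. W x * of_real (deriv (deriv \<phi>) x))"
      unfolding h_def left_diff_distrib
      using Lh[OF \<phi>(2), of v] Lh[OF \<phi>(2), of W] loc[OF v] continuous_locally_integrable[OF I cW]
      by (intro Bochner_Integration.integral_diff) auto
    \<comment> \<open>Two integrations by parts: the derivative of \<phi> is itself an admissible
      test function.\<close>
    also have "(LINT x|lebesgue_on I. W x * of_real (deriv (deriv \<phi>) x)) = (LINT x|lebesgue_on I. w x * of_real (\<phi> x))"
      using primitive_imp_has_weak_deriv[OF I W] primitive_imp_has_weak_deriv[OF I W'] \<phi>
      by (simp add: has_weak_deriv_def)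
    finally show ?thesis using test[OF \<phi>] by simp
  qed
  obtain \<phi>0 where \<phi>0: "\<phi>0 \<in> C1_compact I" "(LINT x|lebesgue_on I. complex_of_real (\<phi>0 x)) \<noteq> 0"
    using ex_C1_compact_integral_nonzero[OF I] by blast
  define s0 where "s0 = (LINT x|lebesgue_on I. \<phi>0 x)"
  have s0: "s0 \<noteq> 0" using \<phi>0(2) by (simp add: s0_def)
  have Ci: "integrable (lebesgue_on I) \<phi>" if \<phi>: "\<phi> \<in> C1_compact I" for \<phi>
  proof -
    obtain c d where cd: "c < d" "c \<in> I" "d \<in> I" "\<And>x. x \<notin> {c<..<d} \<Longrightarrow> \<phi> x = 0" "continuous_on UNIV \<phi>"
      by (rule C1_compactD[OF \<phi> I]) blast
    show ?thesis
      unfolding integrable_lebesgue_on_iff[OF half_lineD(3)[OF I]]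
      by (rule absolutely_integrable_support(1)[where c=c and d=d])
        (use cd half_lineD(7)[OF I cd(2,3)] in \<open>auto intro!: absolutely_integrable_continuous_real intro: continuous_on_subset\<close>)
  qed
  \<comment> \<open>The only possible value: it is what the weak derivative identity for
    \<open>h\<close> demands when tested with \<open>\<phi>0\<close>.\<close>
  define D where "D = - (LINT x|lebesgue_on I. h x * of_real (deriv \<phi>0 x)) / of_real s0"
  have weak: "has_weak_deriv I h (\<lambda>x. D)"
    unfolding has_weak_deriv_def
  proof
    fix \<phi> assume \<phi>: "\<phi> \<in> C1_compact I"
    define s where "s = (LINT x|lebesgue_on I. \<phi> x) / s0"
    \<comment> \<open>Removing the mean of \<phi> makes \<theta> the derivative of a test function
      \<Phi>, and \<open>h0\<close> then applies to \<Phi>.\<close>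
    define \<theta> where "\<theta> x = \<phi> x - s * \<phi>0 x" for x
    have \<theta>: "\<theta> \<in> C1_compact I" "deriv \<theta> = (\<lambda>x. deriv \<phi> x - s * deriv \<phi>0 x)"
      using C1_compact_lincomb[OF \<phi> \<phi>0(1), of s] by (simp_all add: \<theta>_def[abs_def])
    have L0: "(LINT x|lebesgue_on I. \<theta> x) = 0"
      unfolding \<theta>_def using Ci[OF \<phi>] Ci[OF \<phi>0(1)] s0 by (simp add: s_def s0_def)
    obtain c d where cd: "c < d" "c \<in> I" "d \<in> I" and 0: "\<And>x. x \<notin> {c<..<d} \<Longrightarrow> \<theta> x = 0" and cont: "continuous_on UNIV \<theta>"
      by (rule C1_compactD[OF \<theta>(1) I]) blast
    have cdI: "{c..d} \<subseteq> I" using half_lineD(7)[OF I cd(2,3)] .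
    have "integral {c..d} \<theta> = integral I \<theta>"
      using cdI 0 cont by (intro absolutely_integrable_support(2)[symmetric] absolutely_integrable_continuous_real)
        (auto intro: continuous_on_subset)
    also have "\<dots> = 0"
      using L0 lebesgue_integral_eq_integral[OF Ci[OF \<theta>(1)] half_lineD(3)[OF I]] by simp
    finally obtain \<Phi> where \<Phi>: "\<Phi> \<in> C1_compact I" "deriv \<Phi> = \<theta>"
      using C1_compact_antiderivative[OF cont _ _ cdI] 0 cd(1) by (metis greaterThanLessThan_subseteq_atLeastAtMost_iff less_imp_le order_refl subsetD)
    have "0 = (LINT x|lebesgue_on I. h x * of_real (deriv \<phi> x) - of_real s * (h x * of_real (deriv \<phi>0 x)))"
      using h0[of \<Phi>] \<Phi> \<theta> by (simp add: algebra_simps)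
    also have "\<dots> = (LINT x|lebesgue_on I. h x * of_real (deriv \<phi> x)) - of_real s * (LINT x|lebesgue_on I. h x * of_real (deriv \<phi>0 x))"
      using Lh[OF \<phi> hloc] Lh[OF \<phi>0(1) hloc] by simp
    finally have "(LINT x|lebesgue_on I. h x * of_real (deriv \<phi> x)) = - D * of_real (s * s0)"
      using s0 by (simp add: D_def)
    also have "s * s0 = (LINT x|lebesgue_on I. \<phi> x)" using s0 by (simp add: s_def)
    finally show "(LINT x|lebesgue_on I. h x * of_real (deriv \<phi> x)) = - (LINT x|lebesgue_on I. D * of_real (\<phi> x))"
      by simp
  qed
  obtain K where K: "primitive_on (insert 0 I) K (\<lambda>x. D)" "negligible {x\<in>I. h x \<noteq> K x}"
    using has_weak_deriv_imp_primitive[OF I hloc _ weak] by (auto intro: absolutely_integrable_on_const)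
  have "primitive_on (insert 0 I) (\<lambda>x. W' x + D) w" using W' unfolding primitive_on_def by simp
  moreover have V: "primitive_on (insert 0 I) (\<lambda>x. W x + K x) (\<lambda>x. W' x + D)" by (rule primitive_on_add[OF W K(1)])
  moreover have "{x\<in>I. v x \<noteq> W x + K x} = {x\<in>I. h x \<noteq> K x}" by (auto simp: h_def algebra_simps)
  then have ae: "negligible {x\<in>I. v x \<noteq> W x + K x}" using K(2) by simp
  \<comment> \<open>\<open>W\<close> and \<open>K\<close> separately may grow at infinity. Their sum
    represents \<open>v\<close> and so is square integrable, which \<open>primitive_L2\<close>
    passes on to \<open>W' + D\<close>.\<close>
  moreover have VL: "(\<lambda>x. W x + K x) \<in> L2 I"
    by (rule L2_cong_AE[OF v primitive_on_borel_measurable[OF I V] ae half_lineD(3)[OF I]])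
  ultimately have "H2_data I (\<lambda>x. W x + K x) (\<lambda>x. W' x + D) w"
    unfolding H2_data_def using primitive_L2[OF I _ _ VL w] w by blast
  then show ?thesis using ae that by blast
qed

section \<open>Density\<close>

lemma bounded_measurable_integrable:
  fixes f :: "real \<Rightarrow> 'a::euclidean_space"
  assumes "f \<in> borel_measurable lebesgue" "\<And>x. x \<in> {a..b} \<Longrightarrow> norm (f x) \<le> B"
  shows "f absolutely_integrable_on {a..b}"
  by (rule measurable_bounded_by_integrable_imp_absolutely_integrable[where g="\<lambda>x. B"])
    (use assms in \<open>auto intro: measurable_restrict_space1\<close>)

lemma power2_cmod_diff_le: "(cmod (x - z))\<^sup>2 \<le> 2 * (cmod (x - y))\<^sup>2 + 2 * (cmod (y - z))\<^sup>2"
proof -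
  have "cmod (x - z) \<le> cmod (x - y) + cmod (y - z)" using norm_triangle_ineq[of "x - y" "y - z"] by simp
  then have "(cmod (x - z))\<^sup>2 \<le> (cmod (x - y) + cmod (y - z))\<^sup>2" by (intro power_mono) auto
  also have "\<dots> \<le> 2 * (cmod (x - y))\<^sup>2 + 2 * (cmod (y - z))\<^sup>2"
    using sum_squares_bound[of "cmod (x - y)" "cmod (y - z)"] by (simp add: power2_sum)
  finally show ?thesis .
qed

text \<open>A measurable function is an almost everywhere limit of continuous ones. Bounded
  truncations of these converge in mean square by dominated convergence, and Stone-Weierstrass
  replaces one of them by a polynomial.\<close>

lemma polynomial_approx_bounded_measurable:
  fixes h :: "real \<Rightarrow> complex"
  assumes h: "h \<in> borel_measurable lebesgue" "\<And>x. cmod (h x) \<le> B" and "a \<le> b" "0 < e"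
  obtains p where "polynomial_function p" "(\<lambda>x. (cmod (h x - p x))\<^sup>2) integrable_on {a..b}"
    "integral {a..b} (\<lambda>x. (cmod (h x - p x))\<^sup>2) < e"
proof -
  have B: "B \<ge> 0" using order.trans[OF norm_ge_zero h(2)] .
  obtain N g where N: "negligible N" and g: "\<And>n. continuous_on UNIV (g n)"
    "\<And>x. x \<notin> N \<Longrightarrow> (\<lambda>n. g n x) \<longlonglongrightarrow> h x"
    using lebesgue_measurable_imp_measurable_on[OF h(1), of UNIV] unfolding measurable_on_def by auto
  \<comment> \<open>Projecting onto the ball of radius \<open>B\<close> keeps continuity, does not
    disturb the limit \<open>h x\<close>, which already lies in the ball, and supplies the uniform
    bound for dominated convergence.\<close>
  define c where "c n x = closest_point (cball 0 B) (g n x)" for n :: nat and x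
  have ball: "convex (cball (0::complex) B)" "closed (cball (0::complex) B)" "cball (0::complex) B \<noteq> {}"
    using B by auto
  have cc: "continuous_on UNIV (c n)" for n
    unfolding c_def using continuous_on_compose2[OF continuous_on_closest_point[OF ball] g(1)] by auto
  have cB: "cmod (c n x) \<le> B" for n x
    unfolding c_def using closest_point_in_set[OF ball(2,3), of "g n x"] by simp
  have clim: "(\<lambda>n. c n x) \<longlonglongrightarrow> h x" if "x \<notin> N" for x
  proof -
    have "(\<lambda>n. c n x) \<longlonglongrightarrow> closest_point (cball 0 B) (h x)"
      unfolding c_def using continuous_at_closest_point[OF ball] g(2)[OF that] by (rule isCont_tendsto_compose)
    then show ?thesis using h(2) by (simp add: closest_point_self)
  qed
  have bd: "(cmod (h x - c n x))\<^sup>2 \<le> (2 * B)\<^sup>2" for n x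
  proof -
    have "cmod (h x - c n x) \<le> 2 * B"
      using h(2)[of x] cB[of n x] norm_triangle_ineq4[of "h x" "c n x"] by linarith
    then show ?thesis by (rule power_mono) simp
  qed
  have cmeas: "c n \<in> borel_measurable lebesgue" for n
    using borel_measurable_continuous_onI[OF cc] by (simp add: measurable_completion)
  have ki: "(\<lambda>x. (cmod (h x - c n x))\<^sup>2) integrable_on {a..b}" for n
  proof (rule set_lebesgue_integral_eq_integral(1), rule bounded_measurable_integrable)
    show "(\<lambda>x. (cmod (h x - c n x))\<^sup>2) \<in> borel_measurable lebesgue" using h(1) cmeas[of n] by measurable
    show "norm ((cmod (h x - c n x))\<^sup>2) \<le> (2 * B)\<^sup>2" for x
      unfolding real_norm_def abs_power2 by (rule bd)
  qed
  \<comment> \<open>Dominated convergence is used with convergence at every point, so the error is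
    set to 0 on the null set where it may fail.\<close>
  define k where "k n x = (if x \<in> N then 0 else (cmod (h x - c n x))\<^sup>2)" for n x
  have spike: "k n x = (cmod (h x - c n x))\<^sup>2" if "x \<in> {a..b} - N" for n x using that by (simp add: k_def)
  have ki': "k n integrable_on {a..b}" for n
    using ki N spike by (rule integrable_spike)
  have "(\<lambda>n. integral {a..b} (k n)) \<longlonglongrightarrow> integral {a..b} (\<lambda>x. 0::real)"
  proof (rule dominated_convergence(2)[OF ki'])
    show "(\<lambda>x. (2 * B)\<^sup>2) integrable_on {a..b}" by (rule integrable_const_ivl)
    show "norm (k n x) \<le> (2 * B)\<^sup>2" for n x
      using bd[of x n] unfolding k_def real_norm_def by (simp del: power_mult_distrib)
    show "(\<lambda>n. k n x) \<longlonglongrightarrow> 0" for x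
    proof (cases "x \<in> N")
      case False
      have "(\<lambda>n. (cmod (h x - c n x))\<^sup>2) \<longlonglongrightarrow> (cmod (h x - h x))\<^sup>2"
        by (intro tendsto_intros clim False)
      then show ?thesis using False by (simp add: k_def)
    qed (simp add: k_def)
  qed
  then have "\<forall>\<^sub>F n in sequentially. integral {a..b} (k n) < e / 4"
    using \<open>0 < e\<close> by (intro order_tendstoD(2)[of _ 0]) auto
  then obtain n where "integral {a..b} (k n) < e / 4" using eventually_happens'[OF sequentially_bot] by blast
  moreover have "integral {a..b} (k n) = integral {a..b} (\<lambda>x. (cmod (h x - c n x))\<^sup>2)"
    by (rule integral_spike[OF N]) (rule spike[symmetric])
  ultimately have n: "integral {a..b} (\<lambda>x. (cmod (h x - c n x))\<^sup>2) < e / 4" by simp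
  \<comment> \<open>Makes \<open>2 * \<delta>\<^sup>2 * (b - a)\<close> at most
    \<open>e / 2\<close>; the summand 1 keeps the denominator positive when
    \<open>a = b\<close>.\<close>
  define \<delta> where "\<delta> = sqrt (e / (4 * (b - a + 1)))"
  have \<delta>: "\<delta> > 0" "\<delta>\<^sup>2 = e / (4 * (b - a + 1))" using \<open>0 < e\<close> \<open>a \<le> b\<close> by (auto simp: \<delta>_def)
  obtain p where p: "polynomial_function p" "\<And>x. x \<in> {a..b} \<Longrightarrow> cmod (c n x - p x) < \<delta>"
    using Stone_Weierstrass_polynomial_function[OF compact_Icc continuous_on_subset[OF cc] \<delta>(1), of a b n] by auto
  have pm: "p \<in> borel_measurable lebesgue"
    using borel_measurable_continuous_onI[OF continuous_on_polymonial_function[OF p(1), of UNIV]] by (simp add: measurable_completion)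
  have le: "(cmod (h x - p x))\<^sup>2 \<le> 2 * (cmod (h x - c n x))\<^sup>2 + 2 * \<delta>\<^sup>2" if "x \<in> {a..b}" for x
  proof -
    have "(cmod (c n x - p x))\<^sup>2 \<le> \<delta>\<^sup>2" using p(2)[OF that] by (intro power_mono) auto
    then show ?thesis using power2_cmod_diff_le[of "h x" "p x" "c n x"] by linarith
  qed
  have pi: "(\<lambda>x. (cmod (h x - p x))\<^sup>2) integrable_on {a..b}"
  proof (rule set_lebesgue_integral_eq_integral(1), rule bounded_measurable_integrable)
    show "(\<lambda>x. (cmod (h x - p x))\<^sup>2) \<in> borel_measurable lebesgue" using h(1) pm by measurable
    show "norm ((cmod (h x - p x))\<^sup>2) \<le> 2 * (2 * B)\<^sup>2 + 2 * \<delta>\<^sup>2" if "x \<in> {a..b}" for x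
      using bd[of x n] le[OF that] unfolding real_norm_def abs_power2 by linarith
  qed
  have ri: "(\<lambda>x. 2 * (cmod (h x - c n x))\<^sup>2 + 2 * \<delta>\<^sup>2) integrable_on {a..b}"
    by (intro integrable_add integrable_on_mult_right ki integrable_const_ivl)
  have "integral {a..b} (\<lambda>x. (cmod (h x - p x))\<^sup>2) \<le> integral {a..b} (\<lambda>x. 2 * (cmod (h x - c n x))\<^sup>2 + 2 * \<delta>\<^sup>2)"
    by (rule integral_le[OF pi ri le])
  also have "\<dots> = 2 * integral {a..b} (\<lambda>x. (cmod (h x - c n x))\<^sup>2) + (b - a) * (2 * \<delta>\<^sup>2)"
    using ki[of n] \<open>a \<le> b\<close>
    by (subst Henstock_Kurzweil_Integration.integral_add) (auto intro: integrable_on_mult_right)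
  also have "\<dots> < 2 * (e / 4) + e / 2"
  proof -
    have "(b - a) * (2 * \<delta>\<^sup>2) \<le> e / 2" 
      unfolding \<delta>(2) using \<open>0 < e\<close> \<open>a \<le> b\<close> by (simp add: divide_simps)
    then show ?thesis using n by linarith
  qed
  finally show ?thesis using that[OF p(1) pi] by simp
qed

text \<open>Cuts off near 0, near infinity and at large values. Each truncation equals
  \<open>f\<close> or 0 at every point of \<open>I\<close>, so the squared error is dominated by the
  square of \<open>|f|\<close>.\<close>

lemma L2_truncate:
  fixes f :: "real \<Rightarrow> complex"
  assumes I: "half_line I" and f: "f \<in> L2 I" and "0 < e"
  obtains a b B g where "a < b" "a \<in> I" "b \<in> I" "g \<in> borel_measurable lebesgue" "\<And>x. cmod (g x) \<le> B"
    "\<And>x. x \<notin> {a..b} \<Longrightarrow> g x = 0" "(\<lambda>x. (cmod (f x - g x))\<^sup>2) integrable_on I"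
    "integral I (\<lambda>x. (cmod (f x - g x))\<^sup>2) < e"
proof -
  define A where "A n = (if I = {0<..} then inverse (real (Suc n) + 1) else - (real (Suc n) + 1))" for n
  define B where "B n = (if I = {0<..} then real (Suc n) + 1 else - inverse (real (Suc n) + 1))" for n
  have inv: "0 < inverse (real (Suc n) + 1)" "inverse (real (Suc n) + 1) < 1" for n
    by (simp_all add: inverse_less_1_iff)
  have AB: "A n < B n" "A n \<in> I" "B n \<in> I" for n
    using I inv[of n] unfolding half_line_def A_def B_def by auto
  have AB_lim: "\<exists>N. \<forall>n\<ge>N. x \<in> {A n..B n}" if x: "x \<in> I" for x
  proof -
    have x0: "x \<noteq> 0" using x I by (auto simp: half_line_def)
    \<comment> \<open>A single bound controls \<open>x\<close> both towards infinity and towards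
      0.\<close>
    obtain N :: nat where N: "real N \<ge> \<bar>x\<bar> + inverse \<bar>x\<bar>" using real_arch_simple by blast
    have "x \<in> {A n..B n}" if "n \<ge> N" for n
    proof -
      let ?M = "real (Suc n) + 1"
      have "?M \<ge> \<bar>x\<bar> + inverse \<bar>x\<bar>" using N that by auto
      moreover have "0 < inverse \<bar>x\<bar>" "0 < \<bar>x\<bar>" using x0 by simp_all
      ultimately have "\<bar>x\<bar> \<le> ?M" "inverse \<bar>x\<bar> \<le> ?M" by linarith+
      moreover have "inverse ?M \<le> \<bar>x\<bar>"
        using le_imp_inverse_le[OF \<open>inverse \<bar>x\<bar> \<le> ?M\<close>] x0 by simp
      ultimately have *: "\<bar>x\<bar> \<le> ?M" "inverse ?M \<le> \<bar>x\<bar>" by blast+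
      show ?thesis
      proof (cases "I = {0<..}")
        case True
        then have "0 < x" using x by simp
        then show ?thesis using * True by (simp add: A_def B_def)
      next
        case False
        then have "x < 0" using x I by (auto simp: half_line_def)
        then show ?thesis using * False by (simp add: A_def B_def)
      qed
    qed
    then show ?thesis by blast
  qed
  define f0 where "f0 x = (if x \<in> I then f x else 0)" for x
  have f0: "f0 \<in> borel_measurable lebesgue"
    unfolding f0_def using f half_lineD(3)[OF I] by (intro borel_measurable_if_I) (auto simp: L2_def)
  define t where "t n x = (indicator {A n..B n} x * indicator {..real n} (cmod (f0 x)) :: real)" for n x
  define g where "g n x = of_real (t n x) * f0 x" for n x
  have t01: "t n x = 0 \<or> t n x = 1" for n x by (auto simp: t_def indicator_def)
  have tm: "t n \<in> borel_measurable lebesgue" for n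
    unfolding t_def using f0 by (intro borel_measurable_times measurable_compose[of "\<lambda>x. cmod (f0 x)" lebesgue borel "indicator {..real n}"]) 
      (auto simp: measurable_completion)
  have gm: "g n \<in> borel_measurable lebesgue" for n
    unfolding g_def using f0 tm[of n] by (intro borel_measurable_times borel_measurable_of_real) auto
  have gB: "cmod (g n x) \<le> real n" for n x
    by (auto simp: g_def t_def indicator_def)
  have g0: "g n x = 0" if "x \<notin> {A n..B n}" for n x using that by (simp add: g_def t_def)
  have f2: "(\<lambda>x. (cmod (f x))\<^sup>2) integrable_on I"
    using f half_lineD(3)[OF I] by (auto simp: L2_iff intro: set_lebesgue_integral_eq_integral(1))
  have le: "norm ((cmod (f x - g n x))\<^sup>2) \<le> (cmod (f x))\<^sup>2" if "x \<in> I" for n x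
    using t01[of n x] that by (auto simp: g_def f0_def)
  have gi: "(\<lambda>x. (cmod (f x - g n x))\<^sup>2) integrable_on I" for n
  proof (rule set_lebesgue_integral_eq_integral(1), 
      rule measurable_bounded_by_integrable_imp_absolutely_integrable[OF _ half_lineD(3)[OF I] f2 le])
    have "g n \<in> borel_measurable (lebesgue_on I)" using gm by (rule measurable_restrict_space1)
    moreover have "f \<in> borel_measurable (lebesgue_on I)" using f by (simp add: L2_def)
    ultimately show "(\<lambda>x. (cmod (f x - g n x))\<^sup>2) \<in> borel_measurable (lebesgue_on I)" by measurable
  qed
  have "(\<lambda>n. integral I (\<lambda>x. (cmod (f x - g n x))\<^sup>2)) \<longlonglongrightarrow> integral I (\<lambda>x. 0::real)"
  proof (rule dominated_convergence(2)[OF gi f2 le])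
    fix x assume x: "x \<in> I"
    obtain N where N: "\<And>n. n \<ge> N \<Longrightarrow> x \<in> {A n..B n}" using AB_lim[OF x] by blast
    obtain M :: nat where M: "cmod (f0 x) \<le> real M" using real_arch_simple by blast
    have "(cmod (f x - g n x))\<^sup>2 = 0" if "n \<ge> max N M" for n
      using N[of n] M that x by (simp add: g_def t_def f0_def)
    then show "(\<lambda>n. (cmod (f x - g n x))\<^sup>2) \<longlonglongrightarrow> 0"
      by (intro tendsto_eventually eventually_sequentiallyI[of "max N M"]) auto
  qed
  then have "\<forall>\<^sub>F n in sequentially. integral I (\<lambda>x. (cmod (f x - g n x))\<^sup>2) < e"
    using \<open>0 < e\<close> by (intro order_tendstoD(2)[of _ 0]) auto
  then obtain n where "integral I (\<lambda>x. (cmod (f x - g n x))\<^sup>2) < e"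
    using eventually_happens'[OF sequentially_bot] by blast
  then show ?thesis using that[OF AB gm gB g0 gi] by blast
qed

text \<open>The squared quadratic factor has double zeros at \<open>a\<close> and \<open>b\<close>.
  Cutting off there keeps the function and its first derivative continuous, while the second
  derivative merely jumps.\<close>

lemma H2_data_compact_polynomial:
  fixes p :: "real \<Rightarrow> complex"
  assumes I: "half_line I" and p: "polynomial_function p" and ab: "a < b" "a \<in> I" "b \<in> I"
  obtains F G H where "H2_data I F G H" "F 0 = 0" "G 0 = 0"
    "\<And>x. F x = (if x \<in> {a..b} then ((x - a) * (b - x))\<^sup>2 *\<^sub>R p x else 0)"
proof -
  have abI: "{a..b} \<subseteq> I" "0 \<notin> {a..b}" using half_lineD(7)[OF I ab(2,3)] I by (auto simp: half_line_def)
  define P where "P x = ((x - a) * (b - x))\<^sup>2 *\<^sub>R p x" for x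
  obtain p' where p': "\<And>x. (p has_vector_derivative p' x) (at x)"
    using has_vector_derivative_polynomial_function[OF p] by metis
  have "real_polynomial_function (\<lambda>x::real. ((x - a) * (b - x))\<^sup>2)"
    by (intro real_polynomial_function_power real_polynomial_function.intros real_polynomial_function_diff bounded_linear_ident)
  then have Pp: "polynomial_function P"
    unfolding P_def using p by (intro polynomial_function_mult) (simp_all add: real_polynomial_function_eq)
  obtain P1 where P1: "polynomial_function P1" "\<And>x. (P has_vector_derivative P1 x) (at x)"
    using has_vector_derivative_polynomial_function[OF Pp] by metis
  obtain P2 where P2: "polynomial_function P2" "\<And>x. (P1 has_vector_derivative P2 x) (at x)"
    using has_vector_derivative_polynomial_function[OF P1(1)] by metis
  have P1_eq: "P1 x = (2 * ((x - a) * (b - x)) * (a + b - 2 * x)) *\<^sub>R p x + ((x - a) * (b - x))\<^sup>2 *\<^sub>R p' x" for x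
  proof (rule vector_derivative_unique_at[OF P1(2)])
    have "((\<lambda>x. ((x - a) * (b - x))\<^sup>2) has_real_derivative (2 * ((x - a) * (b - x)) * (a + b - 2 * x))) (at x)"
      by (auto intro!: derivative_eq_intros simp: algebra_simps power2_eq_square)
    from has_vector_derivative_scaleR[OF this p']
    show "(P has_vector_derivative (2 * ((x - a) * (b - x)) * (a + b - 2 * x)) *\<^sub>R p x + ((x - a) * (b - x))\<^sup>2 *\<^sub>R p' x) (at x)"
      unfolding P_def[abs_def] by (simp only: add.commute[of "((x - a) * (b - x))\<^sup>2 *\<^sub>R p' x"])
  qed
  have ends: "P a = 0" "P b = 0" "P1 a = 0" "P1 b = 0" by (simp_all add: P_def P1_eq)
  \<comment> \<open>Composing with the clamp to \<open>{a..b}\<close> yields functions continuous on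
    the whole line, which vanish outside because \<open>P\<close> and \<open>P1\<close> are 0 at
    both ends.\<close>
  define cl where "cl x = max a (min b x)" for x
  have cl: "cl x = (if x < a then a else if x > b then b else x)" for x using ab(1) by (auto simp: cl_def)
  have ccl: "continuous_on UNIV cl" unfolding cl_def by (intro continuous_intros)
  define F G H where "F x = P (cl x)" and "G x = P1 (cl x)" and "H x = (if x \<in> {a<..<b} then P2 x else 0)" for x
  have cF: "continuous_on UNIV F" "continuous_on UNIV G"
    unfolding F_def G_def using continuous_on_polymonial_function[OF Pp] continuous_on_polymonial_function[OF P1(1)]
    by (auto intro: continuous_on_compose2[OF _ ccl])
  have F0: "F x = 0" "G x = 0" "H x = 0" if "x \<notin> {a..b}" for x
    using that ends by (auto simp: F_def G_def H_def cl)
  have dF: "(F has_vector_derivative G x) (at x)" "(G has_vector_derivative H x) (at x)" if x: "x \<notin> {a, b}" for x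
  proof -
    consider "x \<in> {a<..<b}" | "x \<in> - {a..b}" using x by force
    then have "(F has_vector_derivative G x) (at x) \<and> (G has_vector_derivative H x) (at x)"
    proof cases
      case 1
      then show ?thesis
        using has_vector_derivative_transform_within_open[OF P1(2) open_greaterThanLessThan 1, of F]
          has_vector_derivative_transform_within_open[OF P2(2) open_greaterThanLessThan 1, of G]
        by (auto simp: F_def G_def H_def cl)
    next
      case 2
      have "open (- {a..b})" by (intro open_Compl closed_atLeastAtMost)
      then show ?thesis
        using has_vector_derivative_transform_within_open[OF has_vector_derivative_const _ 2, of 0 F]
          has_vector_derivative_transform_within_open[OF has_vector_derivative_const _ 2, of 0 G] F0 2
        by auto
    qed
    then show "(F has_vector_derivative G x) (at x)" "(G has_vector_derivative H x) (at x)" by auto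
  qed
  have meas: "H \<in> borel_measurable lebesgue" "G \<in> borel_measurable lebesgue"
  proof -
    have "P2 \<in> borel_measurable lebesgue" "G \<in> borel_measurable lebesgue"
      using borel_measurable_continuous_onI[OF continuous_on_polymonial_function[OF P2(1), of UNIV]] 
        borel_measurable_continuous_onI[OF cF(2)] by (simp_all add: measurable_completion)
    then show "H \<in> borel_measurable lebesgue" "G \<in> borel_measurable lebesgue"
      unfolding H_def by (auto intro!: measurable_If)
  qed
  have "compact (P2 ` {a..b})"
    using continuous_on_polymonial_function[OF P2(1)] by (intro compact_continuous_image) auto
  then have "bounded (P2 ` {a..b})" by (rule compact_imp_bounded)
  then obtain C where C: "\<And>x. x \<in> {a..b} \<Longrightarrow> cmod (P2 x) \<le> C"
    unfolding bounded_iff by blast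
  have HC: "cmod (H x) \<le> \<bar>C\<bar>" for x using C[of x] by (auto simp: H_def)
  have prim: "primitive_on S F G" "primitive_on S G H" for S
  proof -
    have "bounded (G ` {x..y})" for x y
      using cF(2) by (intro compact_imp_bounded compact_continuous_image) (auto intro: continuous_on_subset)
    moreover have "bounded (H ` {x..y})" for x y
      using HC unfolding bounded_iff by auto
    ultimately have "primitive_on UNIV F G" "primitive_on UNIV G H"
      using primitive_on_has_vector_derivative[where K="{a, b}", OF _ cF(1) dF(1) meas(2)]
        primitive_on_has_vector_derivative[where K="{a, b}", OF _ cF(2) dF(2) meas(1)] by simp_all
    then show "primitive_on S F G" "primitive_on S G H" using primitive_on_subset by blast+
  qed
  have "H \<in> L2 I"
  proof -
    have "(\<lambda>x. (cmod (H x))\<^sup>2) absolutely_integrable_on I"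
    proof (rule absolutely_integrable_support(1)[OF bounded_measurable_integrable abI(1)])
      show "(\<lambda>x. (cmod (H x))\<^sup>2) \<in> borel_measurable lebesgue" using meas(1) by measurable
      show "norm ((cmod (H x))\<^sup>2) \<le> \<bar>C\<bar>\<^sup>2" for x 
        using power_mono[OF HC, of x 2] by simp
    qed (use F0 in auto)
    then show ?thesis
      using meas(1) half_lineD(3)[OF I] by (auto simp: L2_iff intro: measurable_restrict_space1)
  qed
  moreover have "F \<in> L2 I" "G \<in> L2 I"
    by (rule continuous_compact_support_L2[OF I _ _ abI(1)]; use cF F0 in \<open>auto intro: continuous_on_subset\<close>)+
  ultimately have "H2_data I F G H" using prim by (simp add: H2_data_def)
  moreover have "F 0 = 0" "G 0 = 0" using F0 abI(2) by auto
  moreover have "F x = (if x \<in> {a..b} then ((x - a) * (b - x))\<^sup>2 *\<^sub>R p x else 0)" for x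
    using ends by (auto simp: F_def cl P_def)
  ultimately show ?thesis using that by blast
qed

text \<open>The approximants must carry the factor \<open>(q x)\<^sup>2\<close> that flattens them
  at the ends. So the truncated function is first divided by this factor, the quotient is
  approximated by a polynomial, and the factor is multiplied back.\<close>

lemma H2_data_dense:
  assumes I: "half_line I" and f: "f \<in> L2 I" and "0 < e"
  obtains F G H where "H2_data I F G H" "F 0 = 0" "G 0 = 0"
    "integral I (\<lambda>x. (cmod (f x - F x))\<^sup>2) < e"
proof -
  have "0 < e / 4" using \<open>0 < e\<close> by simp
  then obtain a b B g where ab: "a < b" "a \<in> I" "b \<in> I" and g: "g \<in> borel_measurable lebesgue" "\<And>x. cmod (g x) \<le> B"
    "\<And>x. x \<notin> {a..b} \<Longrightarrow> g x = 0" and gi: "(\<lambda>x. (cmod (f x - g x))\<^sup>2) integrable_on I"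
    "integral I (\<lambda>x. (cmod (f x - g x))\<^sup>2) < e / 4"
    by (rule L2_truncate[OF I f]) blast
  \<comment> \<open>The strictly larger interval keeps \<open>q\<close> at least
    \<open>m > 0\<close> on \<open>{a..b}\<close>, where the division takes place.\<close>
  obtain a' b' where ab': "a' < b'" "a' \<in> I" "b' \<in> I" "{a..b} \<subseteq> {a'<..<b'}"
    using half_line_compact_cover[OF I compact_Icc half_lineD(7)[OF I ab(2,3)]] by blast
  moreover have "a \<in> {a..b}" "b \<in> {a..b}" using ab(1) by auto
  ultimately have "a \<in> {a'<..<b'}" "b \<in> {a'<..<b'}" by blast+
  then have lt: "a' < a" "b < b'" by auto
  define q where "q x = (x - a') * (b' - x)" for x
  define m where "m = (a - a') * (b' - b)"
  have m: "m > 0" using lt by (simp add: m_def)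
  have qm: "q x \<ge> m" if "x \<in> {a..b}" for x
    unfolding q_def m_def using that lt by (intro mult_mono) auto
  have qM: "0 \<le> q x" "q x \<le> (b' - a')\<^sup>2" if "x \<in> {a'..b'}" for x
    unfolding q_def power2_eq_square using that by (auto intro!: mult_mono)
  define h where "h x = (if x \<in> {a..b} then g x /\<^sub>R (q x)\<^sup>2 else 0)" for x
  have hm: "h \<in> borel_measurable lebesgue"
  proof -
    have "q \<in> borel_measurable borel" unfolding q_def by measurable
    then have "q \<in> borel_measurable lebesgue" by (simp add: measurable_completion)
    then show ?thesis unfolding h_def using g(1)
      by (intro measurable_If borel_measurable_scaleR borel_measurable_inverse borel_measurable_power) auto
  qed
  have B: "B \<ge> 0" using order.trans[OF norm_ge_zero g(2)] .
  have hB: "cmod (h x) \<le> B / m\<^sup>2" for x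
  proof (cases "x \<in> {a..b}")
    case True
    have "cmod (h x) = cmod (g x) / (q x)\<^sup>2" using True by (simp add: h_def divide_inverse mult.commute)
    also have "\<dots> \<le> B / m\<^sup>2"
      using g(2)[of x] qm[OF True] m B by (intro frac_le power_mono) auto
    finally show ?thesis .
  next
    case False
    then have "h x = 0" unfolding h_def by (rule if_not_P)
    then show ?thesis using B by simp
  qed
  \<comment> \<open>Multiplying back scales the squared error by \<open>(q x) ^ 4\<close>, and
    \<open>q\<close> is at most \<open>(b' - a')\<^sup>2\<close>.\<close>
  define M where "M = (b' - a') ^ 8"
  have M: "M > 0" using ab'(1) by (simp add: M_def)
  have "a' \<le> b'" "0 < e / (4 * M)" using ab'(1) M \<open>0 < e\<close> by simp_all
  then obtain p where p: "polynomial_function p" "(\<lambda>x. (cmod (h x - p x))\<^sup>2) integrable_on {a'..b'}"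
    "integral {a'..b'} (\<lambda>x. (cmod (h x - p x))\<^sup>2) < e / (4 * M)"
    by (rule polynomial_approx_bounded_measurable[OF hm hB]) blast
  obtain F G H where F: "H2_data I F G H" "F 0 = 0" "G 0 = 0"
    "\<And>x. F x = (if x \<in> {a'..b'} then ((x - a') * (b' - x))\<^sup>2 *\<^sub>R p x else 0)"
    using H2_data_compact_polynomial[OF I p(1) ab'(1-3)] by blast
  have eq: "g x - F x = (q x)\<^sup>2 *\<^sub>R (h x - p x)" if "x \<in> {a'..b'}" for x
  proof -
    have "g x = (q x)\<^sup>2 *\<^sub>R h x"
    proof (cases "x \<in> {a..b}")
      case True
      then show ?thesis using qm[OF True] m by (simp add: h_def)
    next
      case False
      then show ?thesis using g(3)[OF False] by (simp add: h_def)
    qed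
    then show ?thesis using that by (simp add: F(4) q_def scaleR_diff_right)
  qed
  have eq0: "g x - F x = 0" if "x \<notin> {a'..b'}" for x
  proof -
    have "x \<notin> {a..b}" using that lt by auto
    then have "g x = 0" by (rule g(3))
    moreover have "F x = 0" using F(4)[of x] that by (simp only: if_False)
    ultimately show ?thesis by simp
  qed
  have le: "(cmod (g x - F x))\<^sup>2 \<le> M * (cmod (h x - p x))\<^sup>2" if x: "x \<in> {a'..b'}" for x
  proof -
    have "(q x)^4 \<le> ((b' - a')\<^sup>2)^4" using qM[OF x] by (intro power_mono) auto
    then have "(q x)^4 \<le> M" by (simp add: M_def flip: power_mult)
    then have "(q x)^4 * (cmod (h x - p x))\<^sup>2 \<le> M * (cmod (h x - p x))\<^sup>2" by (intro mult_right_mono) auto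
    then show ?thesis by (simp add: eq[OF x] power_mult_distrib flip: power_mult)
  qed
  have L2: "F \<in> L2 I" using F(1) by (simp add: H2_data_def)
  have I': "{a'..b'} \<subseteq> I" using half_lineD(7)[OF I ab'(2,3)] .
  have gFm: "(\<lambda>x. (cmod (g x - F x))\<^sup>2) \<in> borel_measurable (lebesgue_on I)"
  proof -
    have "F \<in> borel_measurable (lebesgue_on I)" using L2 by (simp add: L2_def)
    then show ?thesis using measurable_restrict_space1[OF g(1)] by measurable
  qed
  have gFi: "(\<lambda>x. (cmod (g x - F x))\<^sup>2) absolutely_integrable_on {a'..b'}"
  proof (rule measurable_bounded_by_integrable_imp_absolutely_integrable)
    show "(\<lambda>x. (cmod (g x - F x))\<^sup>2) \<in> borel_measurable (lebesgue_on {a'..b'})"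
      using gFm I' by (rule measurable_restrict_mono)
    show "(\<lambda>x. M * (cmod (h x - p x))\<^sup>2) integrable_on {a'..b'}" by (intro integrable_on_mult_right p(2))
  qed (use le in auto)
  have gF: "(\<lambda>x. (cmod (g x - F x))\<^sup>2) integrable_on I" 
    "integral I (\<lambda>x. (cmod (g x - F x))\<^sup>2) = integral {a'..b'} (\<lambda>x. (cmod (g x - F x))\<^sup>2)"
    using absolutely_integrable_support[OF gFi I'] eq0 by (auto intro: set_lebesgue_integral_eq_integral(1))
  have "integral {a'..b'} (\<lambda>x. (cmod (g x - F x))\<^sup>2) \<le> integral {a'..b'} (\<lambda>x. M * (cmod (h x - p x))\<^sup>2)"
    using gFi le p(2) by (intro integral_le integrable_on_mult_right) (auto intro: set_lebesgue_integral_eq_integral(1))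
  also have "\<dots> = M * integral {a'..b'} (\<lambda>x. (cmod (h x - p x))\<^sup>2)" by simp
  also have "\<dots> < M * (e / (4 * M))" using p(3) M by (intro mult_strict_left_mono)
  also have "\<dots> = e / 4" using M by simp
  finally have gF4: "integral I (\<lambda>x. (cmod (g x - F x))\<^sup>2) < e / 4" using gF(2) by simp
  have fF: "(\<lambda>x. (cmod (f x - F x))\<^sup>2) integrable_on I"
    using L2_diff[OF f L2] half_lineD(3)[OF I] by (auto simp: L2_iff intro: set_lebesgue_integral_eq_integral(1))
  have "integral I (\<lambda>x. (cmod (f x - F x))\<^sup>2) \<le> integral I (\<lambda>x. 2 * (cmod (f x - g x))\<^sup>2 + 2 * (cmod (g x - F x))\<^sup>2)"
    by (intro integral_le fF integrable_add integrable_on_mult_right gi(1) gF(1) power2_cmod_diff_le)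
  also have "\<dots> = 2 * integral I (\<lambda>x. (cmod (f x - g x))\<^sup>2) + 2 * integral I (\<lambda>x. (cmod (g x - F x))\<^sup>2)"
    using gi(1) gF(1) by (subst Henstock_Kurzweil_Integration.integral_add) (auto intro: integrable_on_mult_right)
  also have "\<dots> < e" using gi(2) gF4 by linarith
  finally show ?thesis using that F by blast
qed

section \<open>Green's formula on a single edge\<close>

lemma half_line_edge_set: "half_line (edge_set j)"
  by (cases j) (auto simp: half_line_def)

lemma H2_data_add:
  assumes "H2_data I F G H" "H2_data I F' G' H'"
  shows "H2_data I (\<lambda>x. F x + F' x) (\<lambda>x. G x + G' x) (\<lambda>x. H x + H' x)"
  using assms unfolding H2_data_def by (auto intro: primitive_on_add L2_add)

lemma H2_data_cmult: "H2_data I F G H \<Longrightarrow> H2_data I (\<lambda>x. a * F x) (\<lambda>x. a * G x) (\<lambda>x. a * H x)"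
  unfolding H2_data_def by (auto intro: primitive_on_cmult L2_cmult)

lemma H2_data_zero: "H2_data I (\<lambda>x. 0) (\<lambda>x. 0) (\<lambda>x. 0)"
  unfolding H2_data_def by (simp add: L2_zero primitive_on_def)

text \<open>Lagrange's identity: \<open>?p\<close> has the primitive \<open>?P\<close>, since the
  products \<open>G x * cnj (G' x)\<close> cancel. Only the value of \<open>?P\<close> at the vertex
  survives, with a sign that depends on which end of \<open>I\<close> the vertex is.\<close>

lemma Green_half_line:
  assumes I: "half_line I" and F: "H2_data I F G H" and F': "H2_data I F' G' H'"
  shows "(LINT x|lebesgue_on I. H x * cnj (F' x)) - (LINT x|lebesgue_on I. F x * cnj (H' x)) =
    (if I = {0<..} then -1 else 1) * (G 0 * cnj (F' 0) - F 0 * cnj (G' 0))"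
proof -
  let ?P = "\<lambda>x. G x * cnj (F' x) - F x * cnj (G' x)" and ?p = "\<lambda>x. H x * cnj (F' x) - F x * cnj (H' x)"
  have L2: "F \<in> L2 I" "G \<in> L2 I" "H \<in> L2 I" "F' \<in> L2 I" "G' \<in> L2 I" "H' \<in> L2 I"
    and p: "primitive_on (insert 0 I) F G" "primitive_on (insert 0 I) G H"
      "primitive_on (insert 0 I) F' G'" "primitive_on (insert 0 I) G' H'"
    using F F' by (auto simp: H2_data_def)
  note S = half_lineD(3)[OF I]
  have "primitive_on (insert 0 I) ?P (\<lambda>x. (G x * cnj (G' x) + H x * cnj (F' x)) - (F x * cnj (H' x) + G x * cnj (G' x)))"
    by (intro primitive_on_diff primitive_on_mult primitive_on_cnj p half_lineD(4)[OF I])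
  then have P: "primitive_on (insert 0 I) ?P ?p" by (simp add: algebra_simps)
  have prod: "(\<lambda>x. f x * cnj (g x)) absolutely_integrable_on I" if "f \<in> L2 I" "g \<in> L2 I" for f g
    using L2_mult_integrable[OF that(1) L2_cnj[OF that(2)] S] .
  have i: "integrable (lebesgue_on I) (\<lambda>x. f x * cnj (g x))" if "f \<in> L2 I" "g \<in> L2 I" for f g
    using L2_integrable_prod[OF that] .
  have "integral I ?p = (if I = {0<..} then - ?P 0 else ?P 0)"
    by (intro integral_primitive_half_line I P set_integral_diff prod L2)
  moreover have "integral I ?p = (LINT x|lebesgue_on I. ?p x)"
    using L2 S by (intro lebesgue_integral_eq_integral[symmetric] Bochner_Integration.integrable_diff i)
  moreover have "(LINT x|lebesgue_on I. ?p x) = (LINT x|lebesgue_on I. H x * cnj (F' x)) - (LINT x|lebesgue_on I. F x * cnj (H' x))"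
    using L2 by (intro Bochner_Integration.integral_diff i)
  ultimately show ?thesis by (simp split: if_splits)
qed

section \<open>Sobolev functions on the graph and Green's formula\<close>

lemma L2Y_rel_refl_iff: "L2Y_rel f f \<longleftrightarrow> (\<forall>j. f j \<in> L2 (edge_set j))"
  by (auto simp: L2Y_rel_def)

lemma abs_L2Y_eqI:
  assumes "\<And>j. f j \<in> L2 (edge_set j)" "\<And>j. g j \<in> L2 (edge_set j)"
    "\<And>j. negligible {x\<in>edge_set j. f j x \<noteq> g j x}"
  shows "abs_L2Y f = abs_L2Y g"
proof -
  have "L2Y_rel f g"
    using assms half_lineD(3)[OF half_line_edge_set] by (auto simp: L2Y_rel_def AE_lebesgue_on_iff)
  then show ?thesis using Quotient_rel[OF Quotient_L2Y] by blast
qed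

lemma L2Y_cases: obtains f where "\<And>j. f j \<in> L2 (edge_set j)" "u = abs_L2Y f"
proof -
  have "L2Y_rel (rep_L2Y u) (rep_L2Y u)" "abs_L2Y (rep_L2Y u) = u"
    using Quotient_rep_reflp[OF Quotient_L2Y] Quotient_abs_rep[OF Quotient_L2Y] by auto
  then show ?thesis using that[of "rep_L2Y u"] by (simp add: L2Y_rel_refl_iff)
qed

text \<open>Trades a class in \<open>L2Y\<close> for continuous representatives on the closed edges,
  from which boundary values and the differential expression can be read off.\<close>

definition H2Y_data :: "L2Y \<Rightarrow> (edge \<Rightarrow> real \<Rightarrow> complex) \<Rightarrow> (edge \<Rightarrow> real \<Rightarrow> complex) \<Rightarrow> (edge \<Rightarrow> real \<Rightarrow> complex) \<Rightarrow> bool" where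
  "H2Y_data v F G H \<longleftrightarrow> v = abs_L2Y F \<and> (\<forall>j. H2_data (edge_set j) (F j) (G j) (H j))"

lemma H2Y_data_L2:
  assumes "H2Y_data v F G H"
  shows "L2Y_rel F F" "L2Y_rel H H" "L2Y_rel (\<lambda>j x. a j * H j x) (\<lambda>j x. a j * H j x)"
  using assms by (auto simp: H2Y_data_def H2_data_def L2Y_rel_refl_iff intro: L2_cmult)

lemma H2Y_dataD:
  assumes D: "H2Y_data v F G H"
  shows "v \<in> H2Y" "vtx v j = F j 0" "dvtx v j = G j 0"
    "diff_expr c v = abs_L2Y (\<lambda>j x. - (of_real (c j))\<^sup>2 * H j x)"
proof -
  have v: "v = abs_L2Y F" and F: "H2_data (edge_set j) (F j) (G j) (H j)" for j
    using D by (auto simp: H2Y_data_def)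
  note * = H2_dataD[OF half_line_edge_set F]
  have FF: "L2Y_rel F F" by (rule H2Y_data_L2[OF D])
  show "v \<in> H2Y" unfolding H2Y_def v using in_H2Y.abs_eq[OF FF] * by simp
  show "vtx v j = F j 0" "dvtx v j = G j 0"
    unfolding v vtx.abs_eq[OF FF] dvtx.abs_eq[OF FF] using * by simp_all
  have w: "weak_deriv (edge_set j) (F j) \<in> H1 (edge_set j)" for j
    using *(1)[of j] by (simp add: H2_def)
  have "diff_expr c v = abs_L2Y (\<lambda>j x. - (of_real (c j))\<^sup>2 * weak_deriv (edge_set j) (weak_deriv (edge_set j) (F j)) x)"
    unfolding v diff_expr.abs_eq[OF FF] using * by simp
  also have "\<dots> = abs_L2Y (\<lambda>j x. - (of_real (c j))\<^sup>2 * H j x)"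
  proof (rule abs_L2Y_eqI)
    show "(\<lambda>x. - (of_real (c j))\<^sup>2 * weak_deriv (edge_set j) (weak_deriv (edge_set j) (F j)) x) \<in> L2 (edge_set j)" for j
      by (rule L2_cmult[OF weak_deriv_L2[OF w]])
    show "(\<lambda>x. - (of_real (c j))\<^sup>2 * H j x) \<in> L2 (edge_set j)" for j
      using F[of j] by (intro L2_cmult) (simp add: H2_data_def)
    show "negligible {x \<in> edge_set j. - (of_real (c j))\<^sup>2 * weak_deriv (edge_set j) (weak_deriv (edge_set j) (F j)) x \<noteq>
        - (of_real (c j))\<^sup>2 * H j x}" for j
      by (rule negligible_subset[OF *(3)[of j]]) auto
  qed
  finally show "diff_expr c v = abs_L2Y (\<lambda>j x. - (of_real (c j))\<^sup>2 * H j x)" .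
qed

lemma H2Y_obtain:
  assumes "v \<in> H2Y"
  obtains F G H where "H2Y_data v F G H"
proof -
  obtain f where f: "\<And>j. f j \<in> L2 (edge_set j)" "v = abs_L2Y f" by (rule L2Y_cases[of v]) blast
  have "f j \<in> H2 (edge_set j)" for j
    using assms f in_H2Y.abs_eq[of f] by (simp add: H2Y_def L2Y_rel_refl_iff)
  then have "\<exists>F G H. H2_data (edge_set j) F G H \<and> negligible {x\<in>edge_set j. f j x \<noteq> F x}" for j
    using H2_obtain[OF half_line_edge_set] by metis
  then obtain F G H where D: "\<And>j. H2_data (edge_set j) (F j) (G j) (H j)" "\<And>j. negligible {x\<in>edge_set j. f j x \<noteq> F j x}"
    by metis
  have "v = abs_L2Y F"
    unfolding f(2) by (rule abs_L2Y_eqI) (use f D in \<open>auto simp: H2_data_def\<close>)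
  then show ?thesis using D that[of F G H] by (simp add: H2Y_data_def)
qed

lemma H2Y_data_add:
  assumes "H2Y_data u F G H" "H2Y_data v F' G' H'"
  shows "H2Y_data (u + v) (\<lambda>j x. F j x + F' j x) (\<lambda>j x. G j x + G' j x) (\<lambda>j x. H j x + H' j x)"
  using assms plus_L2Y.abs_eq[OF H2Y_data_L2(1)[OF assms(1)] H2Y_data_L2(1)[OF assms(2)]]
  by (auto simp: H2Y_data_def intro: H2_data_add)

lemma H2Y_data_cscale:
  assumes "H2Y_data u F G H"
  shows "H2Y_data (cscale a u) (\<lambda>j x. a * F j x) (\<lambda>j x. a * G j x) (\<lambda>j x. a * H j x)"
  using assms cscale.abs_eq[OF H2Y_data_L2(1)[OF assms]]
  by (auto simp: H2Y_data_def intro: H2_data_cmult)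

lemma H2Y_data_zero: "H2Y_data 0 (\<lambda>j x. 0) (\<lambda>j x. 0) (\<lambda>j x. 0)"
  by (simp add: H2Y_data_def zero_L2Y_def H2_data_zero)

lemma H2Y_linear:
  assumes "u \<in> H2Y" "v \<in> H2Y"
  shows "u + v \<in> H2Y" "vtx (u + v) j = vtx u j + vtx v j" "dvtx (u + v) j = dvtx u j + dvtx v j"
    "diff_expr c (u + v) = diff_expr c u + diff_expr c v"
    "cscale a u \<in> H2Y" "vtx (cscale a u) j = a * vtx u j" "dvtx (cscale a u) j = a * dvtx u j"
    "diff_expr c (cscale a u) = cscale a (diff_expr c u)"
proof -
  obtain F G H where u: "H2Y_data u F G H" by (rule H2Y_obtain[OF assms(1)])
  obtain F' G' H' where v: "H2Y_data v F' G' H'" by (rule H2Y_obtain[OF assms(2)])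
  note add = H2Y_dataD[OF H2Y_data_add[OF u v]] and cs = H2Y_dataD[OF H2Y_data_cscale[OF u]]
  show "u + v \<in> H2Y" "vtx (u + v) j = vtx u j + vtx v j" "dvtx (u + v) j = dvtx u j + dvtx v j"
    "cscale a u \<in> H2Y" "vtx (cscale a u) j = a * vtx u j" "dvtx (cscale a u) j = a * dvtx u j"
    using H2Y_dataD(2,3)[OF u] H2Y_dataD(2,3)[OF v] add(1,2,3) cs(1,2,3) by simp_all
  show "diff_expr c (u + v) = diff_expr c u + diff_expr c v"
    unfolding add(4) H2Y_dataD(4)[OF u] H2Y_dataD(4)[OF v] plus_L2Y.abs_eq[OF H2Y_data_L2(3)[OF u] H2Y_data_L2(3)[OF v]]
    by (simp add: algebra_simps)
  show "diff_expr c (cscale a u) = cscale a (diff_expr c u)"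
    unfolding cs(4) H2Y_dataD(4)[OF u] cscale.abs_eq[OF H2Y_data_L2(3)[OF u]]
    by (simp add: algebra_simps)
qed

lemma H2Y_zero: "0 \<in> H2Y" "vtx 0 j = 0" "dvtx 0 j = 0" "diff_expr c 0 = 0"
proof -
  show "0 \<in> H2Y" "vtx 0 j = 0" "dvtx 0 j = 0" using H2Y_dataD[OF H2Y_data_zero] by simp_all
  show "diff_expr c 0 = 0" using H2Y_dataD(4)[OF H2Y_data_zero] by (simp add: zero_L2Y_def)
qed

text \<open>Derivatives are taken away from the vertex, hence the sign on \<open>E1\<close>.\<close>

definition normal_deriv :: "(edge \<Rightarrow> real) \<Rightarrow> L2Y \<Rightarrow> edge \<Rightarrow> complex" where
  "normal_deriv c v j = (if j = E1 then -1 else 1) * (of_real (c j))\<^sup>2 * dvtx v j"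

lemma sum_edge: "(\<Sum>j\<in>UNIV. f j) = f E1 + f E2 + f E3" for f :: "edge \<Rightarrow> 'a::comm_monoid_add"
  by (simp add: UNIV_edge ac_simps)

lemma flux_eq: "flux c v = (\<Sum>j\<in>UNIV. normal_deriv c v j)"
  by (simp add: flux_def sum_edge normal_deriv_def)

definition boundary_form :: "(edge \<Rightarrow> real) \<Rightarrow> L2Y \<Rightarrow> L2Y \<Rightarrow> complex" where
  "boundary_form c u v = (\<Sum>j\<in>UNIV. normal_deriv c u j * cnj (vtx v j) - vtx u j * cnj (normal_deriv c v j))"

lemma Green:
  assumes "u \<in> H2Y" "v \<in> H2Y"
  shows "cinner (diff_expr c u) v - cinner u (diff_expr c v) = boundary_form c u v"
proof -
  obtain F G H where u: "H2Y_data u F G H" by (rule H2Y_obtain[OF assms(1)])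
  obtain F' G' H' where v: "H2Y_data v F' G' H'" by (rule H2Y_obtain[OF assms(2)])
  have uv: "u = abs_L2Y F" "v = abs_L2Y F'" using u v by (auto simp: H2Y_data_def)
  have "cinner (diff_expr c u) v = (\<Sum>j\<in>UNIV. - (of_real (c j))\<^sup>2 * (LINT x|lebesgue_on (edge_set j). H j x * cnj (F' j x)))"
    unfolding H2Y_dataD(4)[OF u] unfolding uv cinner.abs_eq[OF H2Y_data_L2(3)[OF u] H2Y_data_L2(1)[OF v]]
    by (simp add: mult.assoc)
  moreover have "cinner u (diff_expr c v) = (\<Sum>j\<in>UNIV. - (of_real (c j))\<^sup>2 * (LINT x|lebesgue_on (edge_set j). F j x * cnj (H' j x)))"
  proof -
    have e: "F j x * cnj (- (of_real (c j))\<^sup>2 * H' j x) = - (of_real (c j))\<^sup>2 * (F j x * cnj (H' j x))" for j x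
      by simp
    show ?thesis
      unfolding H2Y_dataD(4)[OF v] unfolding uv cinner.abs_eq[OF H2Y_data_L2(1)[OF u] H2Y_data_L2(3)[OF v]] e
      by (simp only: integral_mult_right_zero)
  qed
  ultimately have "cinner (diff_expr c u) v - cinner u (diff_expr c v) =
    (\<Sum>j\<in>UNIV. - (of_real (c j))\<^sup>2 * ((LINT x|lebesgue_on (edge_set j). H j x * cnj (F' j x)) - (LINT x|lebesgue_on (edge_set j). F j x * cnj (H' j x))))"
    by (simp only: sum_subtractf right_diff_distrib)
  also have "\<dots> = boundary_form c u v"
    unfolding boundary_form_def
  proof (rule sum.cong[OF refl])
    fix j
    have "{..<0} \<noteq> {0::real<..}" by (metis greaterThan_iff lessThan_iff less_asym zero_less_one)
    then have "(if edge_set j = {0<..} then -1 else 1) = - (if j = E1 then -1 else 1 :: complex)" by (cases j) auto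
    then have g: "(LINT x|lebesgue_on (edge_set j). H j x * cnj (F' j x)) - (LINT x|lebesgue_on (edge_set j). F j x * cnj (H' j x))
      = - (if j = E1 then -1 else 1) * (G j 0 * cnj (F' j 0) - F j 0 * cnj (G' j 0))"
      using Green_half_line[OF half_line_edge_set[of j]] u v by (simp add: H2Y_data_def)
    show "- (of_real (c j))\<^sup>2 * ((LINT x|lebesgue_on (edge_set j). H j x * cnj (F' j x)) - (LINT x|lebesgue_on (edge_set j). F j x * cnj (H' j x)))
      = normal_deriv c u j * cnj (vtx v j) - vtx u j * cnj (normal_deriv c v j)"
      unfolding g normal_deriv_def H2Y_dataD(2,3)[OF u] H2Y_dataD(2,3)[OF v] by (simp add: algebra_simps)
  qed
  finally show ?thesis .
qed

lemma norm_abs_L2Y: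
  assumes "\<And>j. f j \<in> L2 (edge_set j)"
  shows "(norm (abs_L2Y f))\<^sup>2 = (\<Sum>j\<in>UNIV. integral (edge_set j) (\<lambda>x. (cmod (f j x))\<^sup>2))"
proof -
  have ff: "L2Y_rel f f" using assms by (simp add: L2Y_rel_refl_iff)
  have "(norm (abs_L2Y f))\<^sup>2 = Re (cinner (abs_L2Y f) (abs_L2Y f))"
    by (simp add: power2_norm_eq_inner inner_L2Y_def)
  also have "\<dots> = (\<Sum>j\<in>UNIV. Re (LINT x|lebesgue_on (edge_set j). f j x * cnj (f j x)))"
    unfolding cinner.abs_eq[OF ff ff] by simp
  also have "\<dots> = (\<Sum>j\<in>UNIV. integral (edge_set j) (\<lambda>x. (cmod (f j x))\<^sup>2))"
  proof (rule sum.cong[OF refl])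
    fix j
    have "(LINT x|lebesgue_on (edge_set j). f j x * cnj (f j x)) = (LINT x|lebesgue_on (edge_set j). complex_of_real ((cmod (f j x))\<^sup>2))"
      by (simp add: complex_norm_square del: of_real_power)
    also have "\<dots> = of_real (LINT x|lebesgue_on (edge_set j). (cmod (f j x))\<^sup>2)"
      by (rule integral_complex_of_real)
    also have "(LINT x|lebesgue_on (edge_set j). (cmod (f j x))\<^sup>2) = integral (edge_set j) (\<lambda>x. (cmod (f j x))\<^sup>2)"
      using assms[of j] half_lineD(3)[OF half_line_edge_set] by (intro lebesgue_integral_eq_integral) (auto simp: L2_def)
    finally show "Re (LINT x|lebesgue_on (edge_set j). f j x * cnj (f j x)) = integral (edge_set j) (\<lambda>x. (cmod (f j x))\<^sup>2)"
      by simp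
  qed
  finally show ?thesis .
qed

text \<open>The domain of the minimal operator. Every vertex condition used below holds on it, so it
  yields both density of domains and regularity of adjoints.\<close>

definition H2Y0 :: "L2Y set" where
  "H2Y0 = {v \<in> H2Y. \<forall>j. vtx v j = 0 \<and> dvtx v j = 0}"

lemma H2Y0_dense: "closure H2Y0 = UNIV"
proof -
  have "\<exists>u\<in>H2Y0. dist u v < e" if "e > 0" for v e
  proof -
    obtain f where f: "\<And>j. f j \<in> L2 (edge_set j)" "v = abs_L2Y f" by (rule L2Y_cases[of v]) blast
    \<comment> \<open>Three edges share the squared error, hence the third.\<close>
    let ?Q = "\<lambda>j F G H. H2_data (edge_set j) F G H \<and> F 0 = 0 \<and> G 0 = 0 \<and>
        integral (edge_set j) (\<lambda>x. (cmod (f j x - F x))\<^sup>2) < e\<^sup>2 / 3"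
    have "\<exists>F G H. ?Q j F G H" for j
    proof -
      have "0 < e\<^sup>2 / 3" using \<open>e > 0\<close> by simp
      then show ?thesis by (rule H2_data_dense[OF half_line_edge_set f(1)[of j]]) blast
    qed
    then have "\<forall>j. \<exists>F G H. ?Q j F G H" by blast
    from choice[OF this] obtain F where "\<forall>j. \<exists>G H. ?Q j (F j) G H" ..
    from choice[OF this] obtain G where "\<forall>j. \<exists>H. ?Q j (F j) (G j) H" ..
    from choice[OF this] obtain H where "\<forall>j. ?Q j (F j) (G j) (H j)" ..
    then have D: "\<And>j. H2_data (edge_set j) (F j) (G j) (H j)" "\<And>j. F j 0 = 0" "\<And>j. G j 0 = 0"
      "\<And>j. integral (edge_set j) (\<lambda>x. (cmod (f j x - F j x))\<^sup>2) < e\<^sup>2 / 3" by blast+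
    define u where "u = abs_L2Y F"
    have u: "H2Y_data u F G H" using D by (simp add: H2Y_data_def u_def)
    have F: "F j \<in> L2 (edge_set j)" for j using D(1)[of j] by (simp add: H2_data_def)
    have rel: "L2Y_rel F F" "L2Y_rel f f" "L2Y_rel (\<lambda>j x. - 1 * F j x) (\<lambda>j x. - 1 * F j x)"
      using F f L2_cmult[OF F, of "-1"] by (simp_all add: L2Y_rel_refl_iff)
    have "v - u = abs_L2Y (\<lambda>j x. f j x - F j x)"
      unfolding minus_L2Y_def uminus_L2Y_def u_def f(2) cscale.abs_eq[OF rel(1)] plus_L2Y.abs_eq[OF rel(2,3)] by simp
    then have "(norm (v - u))\<^sup>2 = (\<Sum>j\<in>UNIV. integral (edge_set j) (\<lambda>x. (cmod (f j x - F j x))\<^sup>2))"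
      using norm_abs_L2Y[of "\<lambda>j x. f j x - F j x"] L2_diff[OF f(1) F] by simp
    also have "\<dots> < e\<^sup>2" using D(4)[of E1] D(4)[of E2] D(4)[of E3] by (simp add: sum_edge)
    finally have "norm (v - u) < e" using \<open>e > 0\<close> by (simp add: power2_less_imp_less)
    then have "dist u v < e" by (simp add: dist_norm norm_minus_commute)
    moreover have "u \<in> H2Y0" using H2Y_dataD[OF u] D by (simp add: H2Y0_def)
    ultimately show ?thesis by blast
  qed
  then show ?thesis by (auto simp: closure_approachable)
qed

text \<open>The sign \<open>s\<close> makes the exponential decay away from the vertex on either
  kind of half-line; since \<open>s * s = 1\<close>, the second derivative is the same multiple of
  \<open>F\<close> on both.\<close>

lemma exp_H2_data:
  fixes k :: complex
  assumes I: "half_line I" and k: "Re k > 0"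
  defines "s \<equiv> (if I = {0<..} then -1 else 1)"
  defines "F \<equiv> \<lambda>x. exp (s * k * of_real x)"
  shows "H2_data I F (\<lambda>x. s * k * F x) (\<lambda>x. k\<^sup>2 * F x)"
proof -
  have s2: "s * s = 1" by (simp add: s_def)
  have der: "(F has_vector_derivative s * k * F x) (at x)" for x
    unfolding F_def
    by (rule has_vector_derivative_real_field[where f="\<lambda>z. exp (s * k * z)"])
      (auto intro!: derivative_eq_intros)
  have cF: "continuous_on S F" for S unfolding F_def by (intro continuous_intros)
  have m: "(\<lambda>x. a * F x) \<in> borel_measurable lebesgue" for a
  proof -
    have "continuous_on UNIV (\<lambda>x. a * F x)" by (intro continuous_intros cF)
    then show ?thesis by (simp add: borel_measurable_continuous_onI measurable_completion)
  qed
  have prim: "primitive_on S F (\<lambda>x. s * k * F x)" for S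
  proof -
    have "primitive_on UNIV F (\<lambda>x. s * k * F x)"
    proof (rule primitive_on_has_vector_derivative[of "{}"])
      show "bounded ((\<lambda>x. s * k * F x) ` {a..b})" for a b
        by (intro compact_imp_bounded compact_continuous_image continuous_intros cF) auto
    qed (use der cF m in auto)
    then show ?thesis using primitive_on_subset by blast
  qed
  have "primitive_on S (\<lambda>x. s * k * F x) (\<lambda>x. s * k * (s * k * F x))" for S
    by (rule primitive_on_cmult[OF prim])
  moreover have "s * k * (s * k * F x) = k\<^sup>2 * F x" for x
  proof -
    have "s * k * (s * k * F x) = (s * s) * (k\<^sup>2 * F x)" by (simp add: power2_eq_square mult_ac)
    then show ?thesis by (simp add: s2)
  qed
  ultimately have prim2: "primitive_on S (\<lambda>x. s * k * F x) (\<lambda>x. k\<^sup>2 * F x)" for S by simp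
  have n: "(cmod (F x))\<^sup>2 = exp (- (2 * Re k) * (if I = {0<..} then x else - x))" for x
    by (simp add: F_def s_def power2_eq_square flip: exp_add)
  have e: "(\<lambda>x. exp (- (2 * Re k) * x)) absolutely_integrable_on {0..}"
    using k by (intro nonnegative_absolutely_integrable_1 integrable_on_exp_minus_to_infinity) auto
  have "(\<lambda>x. (cmod (F x))\<^sup>2) absolutely_integrable_on (insert 0 I)"
    using I
  proof (cases rule: half_line_cases)
    case pos
    then show ?thesis using e unfolding pos(2) n by simp
  next
    case neg
    have "{..<0} \<noteq> {0::real<..}" by (metis greaterThan_iff lessThan_iff less_asym zero_less_one)
    then have "I \<noteq> {0<..}" using neg(1) by simp
    moreover have "uminus ` {0::real..} = insert 0 I"
      unfolding neg(2)[symmetric] by (simp only: image_image minus_minus image_ident)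
    ultimately show ?thesis using absolutely_integrable_reflect_set(1)[OF e] unfolding n by simp
  qed
  then have "F \<in> L2 I"
    using measurable_restrict_space1[OF m[of 1], of I]
    by (simp add: L2_iff half_lineD(3)[OF I] absolutely_integrable_insert)
  then show ?thesis unfolding H2_data_def using prim prim2 by (auto intro: L2_cmult)
qed

text \<open>Two exponentials with different decay rates have linearly independent pairs of value and
  slope at 0, so their combinations reach every such pair.\<close>

lemma H2_data_boundary_values:
  assumes I: "half_line I"
  obtains F G H where "H2_data I F G H" "F 0 = a" "G 0 = b"
proof -
  define s :: complex where "s = (if I = {0<..} then -1 else 1)"
  have s2: "s * s = 1" by (simp add: s_def)
  \<comment> \<open>Solution of \<alpha> + \<beta> = \<open>a\<close> and \<open>s\<close> (\<alpha>
    + 2 \<beta>) = \<open>b\<close>, where \<open>s\<close> is its own inverse.\<close>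
  define \<beta> where "\<beta> = s * b - a"
  define \<alpha> where "\<alpha> = a - \<beta>"
  note D = H2_data_add[OF H2_data_cmult[OF exp_H2_data[OF I, of 1], of \<alpha>] H2_data_cmult[OF exp_H2_data[OF I, of 2], of \<beta>]]
  show ?thesis
  proof (rule that)
    show "H2_data I (\<lambda>x. \<alpha> * exp (s * 1 * of_real x) + \<beta> * exp (s * 2 * of_real x))
      (\<lambda>x. \<alpha> * (s * 1 * exp (s * 1 * of_real x)) + \<beta> * (s * 2 * exp (s * 2 * of_real x)))
      (\<lambda>x. \<alpha> * (1\<^sup>2 * exp (s * 1 * of_real x)) + \<beta> * (2\<^sup>2 * exp (s * 2 * of_real x)))"
      unfolding s_def using D by simp
    show "\<alpha> * exp (s * 1 * of_real 0) + \<beta> * exp (s * 2 * of_real 0) = a" by (simp add: \<alpha>_def)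
    have "\<alpha> * (s * 1) + \<beta> * (s * 2) = s * (a + \<beta>)" by (simp add: \<alpha>_def algebra_simps)
    also have "\<dots> = s * s * b" by (simp add: \<beta>_def)
    finally show "\<alpha> * (s * 1 * exp (s * 1 * of_real 0)) + \<beta> * (s * 2 * exp (s * 2 * of_real 0)) = b"
      by (simp add: s2)
  qed
qed

text \<open>With the six boundary values free, each adjoint computation below becomes
  finite-dimensional linear algebra.\<close>

lemma H2Y_boundary_values:
  assumes c: "\<And>j. c j > 0"
  obtains u where "u \<in> H2Y" "vtx u = a" "normal_deriv c u = b"
proof -
  let ?Q = "\<lambda>j F G H. H2_data (edge_set j) F G H \<and> F 0 = a j \<and>
    G 0 = (if j = E1 then -1 else 1) * b j / (of_real (c j))\<^sup>2"
  have "\<exists>F G H. ?Q j F G H" for j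
    by (rule H2_data_boundary_values[OF half_line_edge_set]) blast
  then have "\<forall>j. \<exists>F G H. ?Q j F G H" by blast
  from choice[OF this] obtain F where "\<forall>j. \<exists>G H. ?Q j (F j) G H" ..
  from choice[OF this] obtain G where "\<forall>j. \<exists>H. ?Q j (F j) (G j) H" ..
  from choice[OF this] obtain H where Q: "\<forall>j. ?Q j (F j) (G j) (H j)" ..
  define u where "u = abs_L2Y F"
  have u: "H2Y_data u F G H" using Q by (simp add: H2Y_data_def u_def)
  have c0: "c j \<noteq> 0" for j using c[of j] by simp
  show ?thesis
  proof (rule that)
    show "u \<in> H2Y" by (rule H2Y_dataD(1)[OF u])
    show "vtx u = a" by (rule ext) (use H2Y_dataD(2)[OF u] Q in simp)
    show "normal_deriv c u = b"
    proof
      fix j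
      have "dvtx u j = (if j = E1 then -1 else 1) * b j / (of_real (c j))\<^sup>2"
        using H2Y_dataD(3)[OF u] Q by simp
      then show "normal_deriv c u j = b j" using c0[of j] by (simp add: normal_deriv_def)
    qed
  qed
qed

section \<open>Adjoints and boundary conditions\<close>

lemma LINT_cnj: "cnj (LINT x|M. f x) = (LINT x|M. cnj (f x))" for f :: "real \<Rightarrow> complex"
  by simp

lemma cinner_restrict_edge:
  assumes f: "f \<in> L2 (edge_set j)" and g: "\<And>i. g i \<in> L2 (edge_set i)"
  shows "cinner (abs_L2Y (\<lambda>i. if i = j then f else (\<lambda>x. 0))) (abs_L2Y g) = (LINT x|lebesgue_on (edge_set j). f x * cnj (g j x))"
proof -
  have "L2Y_rel g g" "L2Y_rel (\<lambda>i. if i = j then f else (\<lambda>x. 0)) (\<lambda>i. if i = j then f else (\<lambda>x. 0))"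
    using f g by (auto simp: L2Y_rel_refl_iff L2_zero)
  then have "cinner (abs_L2Y (\<lambda>i. if i = j then f else (\<lambda>x. 0))) (abs_L2Y g) =
    (\<Sum>i\<in>UNIV. LINT x|lebesgue_on (edge_set i). (if i = j then f else (\<lambda>x. 0)) x * cnj (g i x))"
    using cinner.abs_eq by blast
  also have "\<dots> = (\<Sum>i\<in>UNIV. if i = j then LINT x|lebesgue_on (edge_set i). f x * cnj (g i x) else 0)"
    by (rule sum.cong) auto
  finally show ?thesis by simp
qed

text \<open>Testing with functions that live on one edge and vanish near the vertex isolates that
  edge and gives its component of \<open>v\<close> a second weak derivative in L2.\<close>

lemma adjoint_regularity:
  assumes c: "\<And>j. c j > 0" and vw: "(v, w) \<in> adjoint_op (restrict_op H2Y0 (diff_expr c))"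
  shows "v \<in> H2Y" "w = diff_expr c v"
proof -
  obtain f where f: "\<And>j. f j \<in> L2 (edge_set j)" "v = abs_L2Y f" by (rule L2Y_cases[of v]) blast
  obtain g where g: "\<And>j. g j \<in> L2 (edge_set j)" "w = abs_L2Y g" by (rule L2Y_cases[of w]) blast
  \<comment> \<open>The candidate for the second derivative, from solving the differential
    expression for it.\<close>
  define h where "h j x = - (1 / (of_real (c j))\<^sup>2) * g j x" for j x
  have h: "h j \<in> L2 (edge_set j)" for j unfolding h_def by (rule L2_cmult[OF g(1)])
  have c0: "c j \<noteq> 0" for j using c[of j] by simp
  have "\<exists>V V'. H2_data (edge_set j) V V' (h j) \<and> negligible {x\<in>edge_set j. f j x \<noteq> V x}" for j
  proof (rule second_weak_deriv_regularity[OF half_line_edge_set f(1)[of j] h])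
    let ?I = "edge_set j"
    note I = half_line_edge_set[of j]
    fix \<phi> assume \<phi>: "\<phi> \<in> C1_compact ?I" "deriv \<phi> \<in> C1_compact ?I"
    define E :: "(real \<Rightarrow> complex) \<Rightarrow> edge \<Rightarrow> real \<Rightarrow> complex" where "E p i = (if i = j then p else (\<lambda>x. 0))" for p i
    let ?F = "\<lambda>x. complex_of_real (\<phi> x)" and ?G = "\<lambda>x. complex_of_real (deriv \<phi> x)" 
      and ?H = "\<lambda>x. complex_of_real (deriv (deriv \<phi>) x)"
    have prim: "primitive_on S (\<lambda>x. complex_of_real (\<psi> x)) (\<lambda>x. complex_of_real (deriv \<psi> x))" if \<psi>: "\<psi> \<in> C1_compact ?I" for S \<psi>
      by (rule C1_compactD[OF \<psi> I], rule primitive_on_of_real)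
    have D: "H2_data ?I ?F ?G ?H"
      unfolding H2_data_def using prim \<phi> C1_compact_L2[OF I] by blast
    define u where "u = abs_L2Y (E ?F)"
    have u: "H2Y_data u (E ?F) (E ?G) (E ?H)"
      using D by (auto simp: H2Y_data_def u_def E_def H2_data_zero)
    have "0 \<notin> ?I" by (cases j) auto
    then have z: "\<psi> 0 = 0" if "\<psi> \<in> C1_compact ?I" for \<psi> using that by (auto simp: C1_compact_def)
    have "u \<in> H2Y0"
      using H2Y_dataD(1-3)[OF u] z[OF \<phi>(1)] z[OF \<phi>(2)] by (auto simp: H2Y0_def E_def)
    then have "(u, diff_expr c u) \<in> restrict_op H2Y0 (diff_expr c)" by (auto simp: restrict_op_def)
    then have *: "cinner (diff_expr c u) v = cinner u w"
      using vw unfolding adjoint_op_def by blast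
    have "cinner u w = (LINT x|lebesgue_on ?I. ?F x * cnj (g j x))"
      unfolding u_def E_def g(2) by (rule cinner_restrict_edge[OF C1_compact_L2(1)[OF I \<phi>(1)] g(1)])
    moreover have "diff_expr c u = abs_L2Y (E (\<lambda>x. - (of_real (c j))\<^sup>2 * ?H x))"
    proof -
      have "(\<lambda>i x. - (of_real (c i))\<^sup>2 * E ?H i x) = E (\<lambda>x. - (of_real (c j))\<^sup>2 * ?H x)" by (auto simp: E_def fun_eq_iff)
      then show ?thesis using H2Y_dataD(4)[OF u, of c] by simp
    qed
    then have "cinner (diff_expr c u) v = (LINT x|lebesgue_on ?I. (- (of_real (c j))\<^sup>2 * ?H x) * cnj (f j x))"
      unfolding f(2) E_def using cinner_restrict_edge[OF L2_cmult[OF C1_compact_L2(2)[OF I \<phi>(2)]] f(1)] by simp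
    ultimately have "(LINT x|lebesgue_on ?I. (- (of_real (c j))\<^sup>2 * ?H x) * cnj (f j x)) = (LINT x|lebesgue_on ?I. ?F x * cnj (g j x))"
      using * by simp
    \<comment> \<open>\<open>cinner\<close> conjugates its second argument; as \<phi> is real,
      conjugating the identity frees \<open>f j\<close> and \<open>g j\<close>.\<close>
    then have "(LINT x|lebesgue_on ?I. cnj ((- (of_real (c j))\<^sup>2 * ?H x) * cnj (f j x))) = (LINT x|lebesgue_on ?I. cnj (?F x * cnj (g j x)))"
      unfolding LINT_cnj[symmetric] by (rule arg_cong)
    moreover have "cnj ((- (of_real (c j))\<^sup>2 * ?H x) * cnj (f j x)) = - (of_real (c j))\<^sup>2 * (f j x * ?H x)"
      "cnj (?F x * cnj (g j x)) = g j x * ?F x" for x by simp_all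
    ultimately have eq: "- (of_real (c j))\<^sup>2 * (LINT x|lebesgue_on ?I. f j x * ?H x) = (LINT x|lebesgue_on ?I. g j x * ?F x)"
      by (simp only: integral_mult_right_zero)
    have div: "X = - (1 / C) * Y" if "- C * X = Y" "C \<noteq> 0" for X Y C :: complex
      using that by auto
    have "(LINT x|lebesgue_on ?I. f j x * ?H x) = - (1 / (of_real (c j))\<^sup>2) * (LINT x|lebesgue_on ?I. g j x * ?F x)"
      by (rule div[OF eq]) (simp add: c0)
    then show "(LINT x|lebesgue_on ?I. f j x * ?H x) = (LINT x|lebesgue_on ?I. h j x * ?F x)"
      unfolding h_def by (simp add: mult.assoc)
  qed blast
  then have "\<forall>j. \<exists>V V'. H2_data (edge_set j) V V' (h j) \<and> negligible {x\<in>edge_set j. f j x \<noteq> V x}" by blast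
  from choice[OF this] obtain V where "\<forall>j. \<exists>V'. H2_data (edge_set j) (V j) V' (h j) \<and> negligible {x\<in>edge_set j. f j x \<noteq> V j x}" ..
  from choice[OF this] obtain V' where V: "\<forall>j. H2_data (edge_set j) (V j) (V' j) (h j) \<and> negligible {x\<in>edge_set j. f j x \<noteq> V j x}" ..
  have "v = abs_L2Y V"
    unfolding f(2) by (rule abs_L2Y_eqI) (use f V in \<open>auto simp: H2_data_def\<close>)
  then have D: "H2Y_data v V V' h" using V by (simp add: H2Y_data_def)
  show "v \<in> H2Y" by (rule H2Y_dataD(1)[OF D])
  have "(\<lambda>j x. - (of_real (c j))\<^sup>2 * h j x) = g" using c0 by (auto simp: h_def fun_eq_iff)
  then show "w = diff_expr c v" using H2Y_dataD(4)[OF D] g(2) by simp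
qed

lemma adjoint_op_mono: "A \<subseteq> B \<Longrightarrow> adjoint_op B \<subseteq> adjoint_op A"
  by (auto simp: adjoint_op_def)

text \<open>Regularity places \<open>v\<close> in \<open>H2Y\<close>; from there Green's formula
  makes the adjoint relation equivalent to the vanishing of the boundary form.\<close>

lemma adjoint_restrict_op:
  assumes c: "\<And>j. c j > 0" and D: "H2Y0 \<subseteq> D" "D \<subseteq> H2Y"
  shows "adjoint_op (restrict_op D (diff_expr c)) = restrict_op {v\<in>H2Y. \<forall>u\<in>D. boundary_form c u v = 0} (diff_expr c)"
proof (intro set_eqI iffI)
  fix p assume p: "p \<in> adjoint_op (restrict_op D (diff_expr c))"
  obtain v w where vw: "p = (v, w)" by (cases p)
  have "restrict_op H2Y0 (diff_expr c) \<subseteq> restrict_op D (diff_expr c)" using D(1) by (auto simp: restrict_op_def)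
  then have "(v, w) \<in> adjoint_op (restrict_op H2Y0 (diff_expr c))" using adjoint_op_mono p vw by blast
  note * = adjoint_regularity[OF c this]
  have "boundary_form c u v = 0" if u: "u \<in> D" for u
  proof -
    have "cinner (diff_expr c u) v = cinner u w"
      using p u unfolding vw adjoint_op_def restrict_op_def by blast
    then show ?thesis using Green[of u v c] u D(2) * by auto
  qed
  then show "p \<in> restrict_op {v\<in>H2Y. \<forall>u\<in>D. boundary_form c u v = 0} (diff_expr c)"
    using * vw by (auto simp: restrict_op_def)
next
  fix p assume "p \<in> restrict_op {v\<in>H2Y. \<forall>u\<in>D. boundary_form c u v = 0} (diff_expr c)"
  then obtain v where v: "p = (v, diff_expr c v)" "v \<in> H2Y" "\<And>u. u \<in> D \<Longrightarrow> boundary_form c u v = 0"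
    by (auto simp: restrict_op_def)
  have "cinner (diff_expr c u) v = cinner u (diff_expr c v)" if "u \<in> D" for u
    using Green[of u v c] v that D(2) by auto
  then show "p \<in> adjoint_op (restrict_op D (diff_expr c))"
    unfolding v(1) by (auto simp: adjoint_op_def restrict_op_def)
qed

lemma cinner_cscale_left: "cinner (cscale a u) v = a * cinner u v"
  by transfer (simp add: mult.assoc sum_distrib_left)

lemma cinner_cnj: "cinner u v = cnj (cinner v u)"
  by transfer (simp del: integral_cnj add: LINT_cnj mult.commute)

lemma cinner_cscale_right: "cinner u (cscale a v) = cnj a * cinner u v"
  using cinner_cnj[of u "cscale a v"] cinner_cnj[of v u] by (simp add: cinner_cscale_left)

text \<open>Lets the continuity of the complex inner product follow from that of the real
  one.\<close>

lemma cinner_eq_inner: "cinner u v = of_real (inner u v) + \<i> * of_real (inner (cscale (- \<i>) u) v)"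
  unfolding inner_L2Y_def cinner_cscale_left by (simp add: complex_eq_iff)

text \<open>Each pair in \<open>A\<close> imposes one equation between continuous functions of the
  graph point.\<close>

lemma closed_adjoint_op: "closed (adjoint_op A)"
proof -
  have eq: "adjoint_op A = (\<Inter>p\<in>A. {q. cinner (snd p) (fst q) = cinner (fst p) (snd q)})"
    by (fastforce simp: adjoint_op_def)
  have "closed {q. cinner (snd p) (fst q) = cinner (fst p) (snd q)}" for p
    unfolding cinner_eq_inner by (intro closed_Collect_eq continuous_intros)
  then show ?thesis unfolding eq by (intro closed_INT) auto
qed

section \<open>Operators given by a vertex condition\<close>

definition graph_op :: "(edge \<Rightarrow> real) \<Rightarrow> (L2Y \<Rightarrow> bool) \<Rightarrow> operator" where
  "graph_op c P = restrict_op {v\<in>H2Y. P v} (diff_expr c)"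

lemma graph_op_iff: "(v, w) \<in> graph_op c P \<longleftrightarrow> v \<in> H2Y \<and> P v \<and> w = diff_expr c v"
  by (auto simp: graph_op_def restrict_op_def)

lemma adjoint_graph_op:
  assumes c: "\<And>j. c j > 0" and P: "\<And>v. v \<in> H2Y0 \<Longrightarrow> P v"
  shows "adjoint_op (graph_op c P) = graph_op c (\<lambda>v. \<forall>u\<in>H2Y. P u \<longrightarrow> boundary_form c u v = 0)"
proof -
  have "{v\<in>H2Y. \<forall>u\<in>{v\<in>H2Y. P v}. boundary_form c u v = 0} = {v\<in>H2Y. \<forall>u\<in>H2Y. P u \<longrightarrow> boundary_form c u v = 0}"
    by blast
  moreover have "H2Y0 \<subseteq> {v\<in>H2Y. P v}" using P by (auto simp: H2Y0_def)
  ultimately show ?thesis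
    unfolding graph_op_def using adjoint_restrict_op[of c "{v\<in>H2Y. P v}", OF c] by auto
qed

lemma graph_op_cong: "(\<And>v. v \<in> H2Y \<Longrightarrow> P v \<longleftrightarrow> Q v) \<Longrightarrow> graph_op c P = graph_op c Q"
  by (auto simp: graph_op_def restrict_op_def)

lemma linear_graph_op:
  assumes "P 0" "\<And>u v. u \<in> H2Y \<Longrightarrow> v \<in> H2Y \<Longrightarrow> P u \<Longrightarrow> P v \<Longrightarrow> P (u + v)"
    "\<And>a u. u \<in> H2Y \<Longrightarrow> P u \<Longrightarrow> P (cscale a u)"
  shows "linear_op (graph_op c P)"
  using assms unfolding linear_op_def single_valued_def
  by (auto simp: graph_op_iff H2Y_zero H2Y_linear)

lemma densely_defined_graph_op:
  assumes "\<And>v. v \<in> H2Y0 \<Longrightarrow> P v"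
  shows "densely_defined (graph_op c P)"
proof -
  have "Domain (graph_op c P) = {v\<in>H2Y. P v}" by (auto simp: graph_op_iff)
  moreover have "H2Y0 \<subseteq> {v\<in>H2Y. P v}" using assms by (auto simp: H2Y0_def)
  ultimately show ?thesis
    unfolding densely_defined_def using H2Y0_dense closure_mono by (metis top.extremum_uniqueI)
qed

definition continuous_at_vertex :: "L2Y \<Rightarrow> bool" where
  "continuous_at_vertex v \<longleftrightarrow> vtx v E1 = vtx v E2 \<and> vtx v E2 = vtx v E3"

definition dirichlet :: "L2Y \<Rightarrow> bool" where
  "dirichlet v \<longleftrightarrow> vtx v E1 = 0 \<and> vtx v E2 = 0 \<and> vtx v E3 = 0"

text \<open>The vertex condition of a delta interaction of strength \<open>Z\<close>. Complex
  \<open>Z\<close> is allowed; self-adjointness is proved for real values.\<close>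

definition delta_cond :: "(edge \<Rightarrow> real) \<Rightarrow> complex \<Rightarrow> L2Y \<Rightarrow> bool" where
  "delta_cond c Z v \<longleftrightarrow> continuous_at_vertex v \<and> flux c v = Z * vtx v E1"

lemma M_op_eq: "M_op c = graph_op c (\<lambda>v. dirichlet v \<and> flux c v = 0)"
  by (simp add: M_op_def graph_op_def dirichlet_def)

lemma J_op_eq: "J_op c Z = graph_op c (delta_cond c (of_real Z))"
  by (simp add: J_op_def graph_op_def delta_cond_def continuous_at_vertex_def)

lemma J_inf_op_eq: "J_inf_op c = graph_op c dirichlet"
  by (simp add: J_inf_op_def graph_op_def dirichlet_def)

text \<open>A common vertex value factors out of the sum over the edges, leaving the sum of the
  normal derivatives, which is the flux.\<close>

lemma boundary_form_continuous:
  assumes "continuous_at_vertex u" "continuous_at_vertex v"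
  shows "boundary_form c u v = flux c u * cnj (vtx v E1) - vtx u E1 * cnj (flux c v)"
  using assms unfolding boundary_form_def flux_eq sum_edge continuous_at_vertex_def
  by (simp add: algebra_simps)

lemma flux_linear:
  assumes "u \<in> H2Y" "v \<in> H2Y"
  shows "flux c (u + v) = flux c u + flux c v" "flux c (cscale a u) = a * flux c u"
  unfolding flux_def using H2Y_linear[OF assms] by (simp_all add: algebra_simps)

lemma flux_zero: "flux c 0 = 0"
  by (simp add: flux_def H2Y_zero)

lemma H2Y0_conditions:
  assumes "v \<in> H2Y0"
  shows "dirichlet v" "flux c v = 0" "continuous_at_vertex v" "delta_cond c Z v"
  using assms by (auto simp: H2Y0_def dirichlet_def flux_def continuous_at_vertex_def delta_cond_def)

lemma linear_ops:
  shows "linear_op (M_op c)" "linear_op (J_op c Z)" "linear_op (J_inf_op c)"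
  unfolding M_op_eq J_op_eq J_inf_op_eq
  by (rule linear_graph_op; simp add: dirichlet_def delta_cond_def continuous_at_vertex_def
      H2Y_zero H2Y_linear flux_zero flux_linear algebra_simps)+

section \<open>Adjoints, self-adjoint extensions and deficiency spaces\<close>

context
  fixes c :: "edge \<Rightarrow> real"
  assumes c: "\<And>j. c j > 0"
begin

lemma ex_boundary_values: "\<exists>u\<in>H2Y. vtx u = a \<and> normal_deriv c u = b"
  by (rule H2Y_boundary_values[of c a b, OF c]) blast

text \<open>A test function with zero vertex values and normal derivative 1 on a single edge reads
  off the conjugate of \<open>vtx v\<close> on that edge.\<close>

lemma dirichlet_if_boundary_form_zero:
  assumes "\<And>u. u \<in> H2Y \<Longrightarrow> dirichlet u \<Longrightarrow> boundary_form c u v = 0"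
  shows "dirichlet v"
proof -
  have "vtx v j = 0" for j
  proof -
    obtain u where u: "u \<in> H2Y" "vtx u = (\<lambda>i. 0)" "normal_deriv c u = (\<lambda>i. if i = j then 1 else 0)"
      using ex_boundary_values by blast
    then have "boundary_form c u v = 0" by (intro assms) (auto simp: dirichlet_def)
    then show ?thesis using u by (cases j) (auto simp: boundary_form_def sum_edge)
  qed
  then show ?thesis by (simp add: dirichlet_def)
qed

text \<open>Zero flux forbids testing one edge alone. Opposite normal derivatives on two edges are
  allowed, and they compare the vertex values on those edges.\<close>

lemma continuous_if_boundary_form_zero:
  assumes "\<And>u. u \<in> H2Y \<Longrightarrow> dirichlet u \<Longrightarrow> flux c u = 0 \<Longrightarrow> boundary_form c u v = 0"
  shows "continuous_at_vertex v"
proof -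
  have "vtx v i = vtx v j" if "i \<noteq> j" for i j
  proof -
    obtain u where u: "u \<in> H2Y" "vtx u = (\<lambda>k. 0)" "normal_deriv c u = (\<lambda>k. if k = i then 1 else if k = j then -1 else 0)"
      using ex_boundary_values by blast
    have "flux c u = 0" using u(3) that by (cases i; cases j) (auto simp: flux_eq sum_edge)
    then have "boundary_form c u v = 0" using u by (intro assms) (auto simp: dirichlet_def)
    then have "cnj (vtx v i) = cnj (vtx v j)"
      using u that by (cases i; cases j) (auto simp: boundary_form_def sum_edge add_eq_0_iff)
    then show ?thesis by simp
  qed
  then show ?thesis by (auto simp: continuous_at_vertex_def)
qed

lemma adjoint_M_op: "adjoint_op (M_op c) = graph_op c continuous_at_vertex"
  unfolding M_op_eq
proof (subst adjoint_graph_op[OF c]; (intro graph_op_cong iffI ballI impI)?)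
  fix v assume "\<forall>u\<in>H2Y. dirichlet u \<and> flux c u = 0 \<longrightarrow> boundary_form c u v = 0"
  then show "continuous_at_vertex v" by (intro continuous_if_boundary_form_zero) auto
next
  fix v u assume "continuous_at_vertex v" "dirichlet u \<and> flux c u = 0"
  then show "boundary_form c u v = 0"
    by (subst boundary_form_continuous) (auto simp: continuous_at_vertex_def dirichlet_def)
qed (auto intro: H2Y0_conditions)

text \<open>Together with \<open>adjoint_M_op\<close> this says that M is its own double adjoint; it
  is the source of the closedness of M.\<close>

lemma M_op_eq_adjoint: "M_op c = adjoint_op (graph_op c continuous_at_vertex)"
  unfolding M_op_eq
proof (subst adjoint_graph_op[OF c]; (intro graph_op_cong iffI ballI impI)?)
  fix v assume v: "\<forall>u\<in>H2Y. continuous_at_vertex u \<longrightarrow> boundary_form c u v = 0"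
  then have d: "dirichlet v"
    by (intro dirichlet_if_boundary_form_zero) (auto simp: dirichlet_def continuous_at_vertex_def)
  \<comment> \<open>Vertex value 1 with zero flux leaves only the flux of \<open>v\<close> in the
    form.\<close>
  obtain u where u: "u \<in> H2Y" "vtx u = (\<lambda>i. 1)" "normal_deriv c u = (\<lambda>i. 0)"
    using ex_boundary_values by blast
  then have u': "continuous_at_vertex u" by (simp add: continuous_at_vertex_def)
  moreover have "continuous_at_vertex v" using d by (simp add: dirichlet_def continuous_at_vertex_def)
  ultimately have "flux c u * cnj (vtx v E1) - vtx u E1 * cnj (flux c v) = 0"
    using v u(1) boundary_form_continuous by simp
  then show "dirichlet v \<and> flux c v = 0" using d u by (simp add: dirichlet_def)
next
  fix v u assume "dirichlet v \<and> flux c v = 0" "continuous_at_vertex u"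
  then show "boundary_form c u v = 0"
    by (subst boundary_form_continuous) (auto simp: continuous_at_vertex_def dirichlet_def)
qed (auto intro: H2Y0_conditions)

lemma adjoint_J_inf_op: "adjoint_op (J_inf_op c) = J_inf_op c"
  unfolding J_inf_op_eq
proof (subst adjoint_graph_op[OF c]; (intro graph_op_cong iffI ballI impI)?)
  fix v assume "\<forall>u\<in>H2Y. dirichlet u \<longrightarrow> boundary_form c u v = 0"
  then show "dirichlet v" by (intro dirichlet_if_boundary_form_zero) auto
next
  fix v u assume "dirichlet v" "dirichlet u"
  then show "boundary_form c u v = 0"
    by (subst boundary_form_continuous) (auto simp: continuous_at_vertex_def dirichlet_def)
qed (auto intro: H2Y0_conditions)

text \<open>Supplies the test function that fixes the flux in \<open>adjoint_J_op\<close>, and later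
  the element that separates \<open>J_op c Z\<close> from \<open>J_inf_op c\<close>.\<close>

lemma ex_delta_cond: "\<exists>u\<in>H2Y. delta_cond c Z u \<and> vtx u E1 = 1"
proof -
  obtain u where u: "u \<in> H2Y" "vtx u = (\<lambda>i. 1)" "normal_deriv c u = (\<lambda>i. if i = E1 then Z else 0)"
    using ex_boundary_values by blast
  then have "flux c u = Z" by (simp add: flux_eq sum_edge)
  then show ?thesis using u by (intro bexI[of _ u]) (simp_all add: delta_cond_def continuous_at_vertex_def)
qed

text \<open>Dirichlet functions of zero flux satisfy the condition, and testing with them makes
  \<open>v\<close> continuous. One further test function with vertex value 1 then fixes the flux of
  \<open>v\<close>; reality of \<open>Z\<close> turns the conjugated relation into the original
  one.\<close>

lemma adjoint_J_op: "adjoint_op (J_op c Z) = J_op c Z"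
  unfolding J_op_eq
proof (subst adjoint_graph_op[OF c]; (intro graph_op_cong iffI ballI impI)?)
  fix v assume v: "\<forall>u\<in>H2Y. delta_cond c (of_real Z) u \<longrightarrow> boundary_form c u v = 0"
  have cv: "continuous_at_vertex v"
    by (rule continuous_if_boundary_form_zero)
      (use v in \<open>auto simp: delta_cond_def dirichlet_def continuous_at_vertex_def\<close>)
  obtain u where u: "u \<in> H2Y" "delta_cond c (of_real Z) u" "vtx u E1 = 1"
    using ex_delta_cond by blast
  have "boundary_form c u v = 0" using v u by blast
  then have "flux c u * cnj (vtx v E1) - vtx u E1 * cnj (flux c v) = 0"
    using u cv boundary_form_continuous by (simp add: delta_cond_def)
  then have "cnj (flux c v) = cnj (of_real Z * vtx v E1)" using u by (simp add: delta_cond_def)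
  then show "delta_cond c (of_real Z) v" using cv by (simp only: complex_cnj_cancel_iff delta_cond_def)
next
  fix v u assume "delta_cond c (of_real Z) v" "delta_cond c (of_real Z) u"
  then show "boundary_form c u v = 0"
    by (subst boundary_form_continuous) (auto simp: delta_cond_def)
qed (auto intro: H2Y0_conditions)

text \<open>Taking adjoints in \<open>M_op c \<subseteq> A\<close> encloses \<open>A\<close> in the
  adjoint of M, so its elements are described by vertex value and flux. The cases are whether
  \<open>A\<close> contains an element with nonzero vertex value.\<close>

lemma self_adjoint_extension_cases:
  assumes A: "self_adjoint_op A" "M_op c \<subseteq> A"
  shows "A = J_inf_op c \<or> (\<exists>Z. A = J_op c Z)"
proof -
  have adj: "adjoint_op A = A" using A(1) by (simp add: self_adjoint_op_def)
  have "A \<subseteq> graph_op c continuous_at_vertex"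
    using adjoint_op_mono[OF A(2)] unfolding adj adjoint_M_op .
  then have sub: "v \<in> H2Y" "continuous_at_vertex v" "w = diff_expr c v" if "(v, w) \<in> A" for v w
    using that by (auto simp: graph_op_iff)
  have sym: "flux c u * cnj (vtx v E1) = vtx u E1 * cnj (flux c v)" if u: "(u, Au) \<in> A" and v: "(v, Av) \<in> A" for u Au v Av
  proof -
    have "cinner Au v = cinner u Av" using u v adj unfolding adjoint_op_def by blast
    then have "boundary_form c u v = 0" using Green[of u v c] sub[OF u] sub[OF v] by simp
    then show ?thesis using boundary_form_continuous sub[OF u] sub[OF v] by simp
  qed
  \<comment> \<open>Maximality: a continuous \<open>v\<close> whose form with every element of
    \<open>A\<close> vanishes lies in the adjoint, which is \<open>A\<close> itself.\<close>
  have mem: "(v, diff_expr c v) \<in> A" if v: "v \<in> H2Y" "continuous_at_vertex v"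
    and eq: "\<And>u Au. (u, Au) \<in> A \<Longrightarrow> flux c u * cnj (vtx v E1) = vtx u E1 * cnj (flux c v)" for v
  proof -
    have "cinner Au v = cinner u (diff_expr c v)" if u: "(u, Au) \<in> A" for u Au
      using Green[of u v c] sub[OF u] v eq[OF u] boundary_form_continuous by simp
    then have "(v, diff_expr c v) \<in> adjoint_op A" by (auto simp: adjoint_op_def)
    then show ?thesis by (simp add: adj)
  qed
  show ?thesis
  proof (cases "\<forall>(u, Au)\<in>A. vtx u E1 = 0")
    case True
    have "A = J_inf_op c"
      unfolding J_inf_op_eq
    proof (intro set_eqI iffI)
      fix p assume p: "p \<in> A"
      obtain v w where vw: "p = (v, w)" by (cases p)
      have "vtx v E1 = 0" using True p vw by blast
      then show "p \<in> graph_op c dirichlet"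
        using sub p vw by (auto simp: graph_op_iff dirichlet_def continuous_at_vertex_def)
    next
      fix p assume "p \<in> graph_op c dirichlet"
      then obtain v where v: "p = (v, diff_expr c v)" "v \<in> H2Y" "dirichlet v"
        by (cases p) (auto simp: graph_op_iff)
      show "p \<in> A"
        unfolding v(1)
      proof (rule mem[OF v(2)])
        show "continuous_at_vertex v" using v(3) by (simp add: dirichlet_def continuous_at_vertex_def)
        fix u Au assume "(u, Au) \<in> A"
        then have "vtx u E1 = 0" using True by blast
        then show "flux c u * cnj (vtx v E1) = vtx u E1 * cnj (flux c v)"
          using v(3) by (simp add: dirichlet_def)
      qed
    qed
    then show ?thesis ..
  next
    case False
    then obtain u0 Au0 where u0: "(u0, Au0) \<in> A" "vtx u0 E1 \<noteq> 0" by blast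
    \<comment> \<open>One element determines the coupling: pairing \<open>u0\<close> with itself
      makes this ratio real, and pairing it with any other element of \<open>A\<close> forces the
      same ratio there.\<close>
    define z where "z = flux c u0 / vtx u0 E1"
    have z: "flux c u0 = z * vtx u0 E1" using u0(2) by (simp add: z_def)
    have "z * (vtx u0 E1 * cnj (vtx u0 E1)) = cnj z * (vtx u0 E1 * cnj (vtx u0 E1))"
      using sym[OF u0(1) u0(1)] by (simp add: z mult_ac)
    then have "z = cnj z" using u0(2) by simp
    then have "z \<in> \<real>" by (simp add: Reals_cnj_iff)
    then obtain Z where Z: "z = of_real Z" by (rule Reals_cases)
    have flux: "flux c v = of_real Z * vtx v E1" if v: "(v, w) \<in> A" for v w
    proof -
      have "vtx u0 E1 * (of_real Z * cnj (vtx v E1)) = vtx u0 E1 * cnj (flux c v)"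
        using sym[OF u0(1) v] by (simp add: z Z mult_ac)
      then have "cnj (of_real Z * vtx v E1) = cnj (flux c v)" using u0(2) by simp
      then show ?thesis by (simp only: complex_cnj_cancel_iff)
    qed
    have "A = J_op c Z"
      unfolding J_op_eq
    proof (intro set_eqI iffI)
      fix p assume p: "p \<in> A"
      obtain v w where vw: "p = (v, w)" by (cases p)
      then show "p \<in> graph_op c (delta_cond c (of_real Z))"
        using sub p flux by (auto simp: graph_op_iff delta_cond_def)
    next
      fix p assume "p \<in> graph_op c (delta_cond c (of_real Z))"
      then obtain v where v: "p = (v, diff_expr c v)" "v \<in> H2Y" "delta_cond c (of_real Z) v"
        by (cases p) (auto simp: graph_op_iff)
      show "p \<in> A"
        unfolding v(1)
      proof (rule mem[OF v(2)])
        show "continuous_at_vertex v" using v(3) by (simp add: delta_cond_def)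
        fix u Au assume "(u, Au) \<in> A"
        then show "flux c u * cnj (vtx v E1) = vtx u E1 * cnj (flux c v)"
          using flux v(3) by (simp add: delta_cond_def)
      qed
    qed
    then show ?thesis by blast
  qed
qed

text \<open>On each edge the decaying exponential with rate \<open>csqrt (- z) / c j\<close> solves
  the eigenvalue equation. All take the value 1 at the vertex, so continuity there is
  automatic.\<close>

lemma ex_eigenvector:
  assumes z: "Re (csqrt (- z)) > 0"
  shows "\<exists>v\<in>H2Y. continuous_at_vertex v \<and> vtx v E1 = 1 \<and> diff_expr c v = cscale z v"
proof -
  define k where "k j = csqrt (- z) / of_real (c j)" for j
  have c0: "c j \<noteq> 0" for j using c[of j] by simp
  have k: "Re (k j) > 0" "(of_real (c j))\<^sup>2 * (k j)\<^sup>2 = - z" for j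
    using z c[of j] c0[of j] by (simp_all add: k_def power_divide)
  define s :: "edge \<Rightarrow> complex" where "s j = (if edge_set j = {0<..} then -1 else 1)" for j
  define F where "F j x = exp (s j * k j * of_real x)" for j x
  have D: "H2_data (edge_set j) (F j) (\<lambda>x. s j * k j * F j x) (\<lambda>x. (k j)\<^sup>2 * F j x)" for j
    using exp_H2_data[OF half_line_edge_set k(1), of j j] unfolding s_def F_def .
  define v where "v = abs_L2Y F"
  have v: "H2Y_data v F (\<lambda>j x. s j * k j * F j x) (\<lambda>j x. (k j)\<^sup>2 * F j x)"
    using D by (simp add: H2Y_data_def v_def)
  have "diff_expr c v = abs_L2Y (\<lambda>j x. z * F j x)"
    unfolding H2Y_dataD(4)[OF v]
  proof (intro arg_cong[of _ _ abs_L2Y] ext)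
    fix j x
    have "- (of_real (c j))\<^sup>2 * ((k j)\<^sup>2 * F j x) = - ((of_real (c j))\<^sup>2 * (k j)\<^sup>2) * F j x" by simp
    then show "- (of_real (c j))\<^sup>2 * ((k j)\<^sup>2 * F j x) = z * F j x" unfolding k(2) by simp
  qed
  also have "\<dots> = cscale z v" unfolding v_def cscale.abs_eq[OF H2Y_data_L2(1)[OF v]] ..
  finally have "diff_expr c v = cscale z v" .
  moreover have "vtx v j = 1" for j unfolding H2Y_dataD(2)[OF v] by (simp add: F_def)
  ultimately show ?thesis
    using H2Y_dataD(1)[OF v] by (intro bexI[of _ v]) (simp_all add: continuous_at_vertex_def)
qed

text \<open>Eigenvectors of the adjoint are determined by their value at the vertex: one vanishing there would
  be an eigenvector of the symmetric Dirichlet operator with a non-real eigenvalue.\<close>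

lemma eigenspace_dim:
  assumes z: "Re (csqrt (- z)) > 0" and nr: "z \<noteq> cnj z"
  shows "cscale.dim {v. (v, cscale z v) \<in> adjoint_op (M_op c)} = 1"
proof -
  let ?E = "{v. (v, cscale z v) \<in> adjoint_op (M_op c)}"
  have E: "v \<in> ?E \<longleftrightarrow> v \<in> H2Y \<and> continuous_at_vertex v \<and> diff_expr c v = cscale z v" for v
    unfolding adjoint_M_op by (auto simp: graph_op_iff)
  obtain v0 where v0: "v0 \<in> H2Y" "continuous_at_vertex v0" "vtx v0 E1 = 1" "diff_expr c v0 = cscale z v0"
    using ex_eigenvector[OF z] by blast
  have "?E = cscale.span {v0}"
  proof (intro set_eqI iffI)
    fix v assume v: "v \<in> ?E"
    define a where "a = vtx v E1"
    define u where "u = v + cscale (- a) v0"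
    have vE: "v \<in> H2Y" "continuous_at_vertex v" "diff_expr c v = cscale z v" using v E by auto
    have av0: "cscale (- a) v0 \<in> H2Y" using H2Y_linear(5)[OF v0(1) v0(1)] .
    have u: "u \<in> H2Y" unfolding u_def using H2Y_linear(1)[OF vE(1) av0] .
    have vt: "vtx u j = vtx v j - a * vtx v0 j" for j
      unfolding u_def H2Y_linear(2)[OF vE(1) av0] H2Y_linear(6)[OF v0(1) v0(1)] by simp
    then have d: "dirichlet u"
      using vE(2) v0(2,3) by (auto simp: dirichlet_def continuous_at_vertex_def a_def)
    have "diff_expr c u = cscale z v + cscale (- a) (cscale z v0)"
      unfolding u_def H2Y_linear(4)[OF vE(1) av0] H2Y_linear(8)[OF v0(1) v0(1)] vE(3) v0(4) ..
    also have "\<dots> = cscale z u"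
      unfolding u_def cscale.scale_right_distrib cscale.scale_scale by (simp add: mult.commute)
    finally have Tu: "diff_expr c u = cscale z u" .
    have "boundary_form c u u = 0"
      using d by (subst boundary_form_continuous) (auto simp: dirichlet_def continuous_at_vertex_def)
    then have "cinner (cscale z u) u = cinner u (cscale z u)"
      using Green[OF u u, of c] unfolding Tu by simp
    then have "(z - cnj z) * cinner u u = 0"
      unfolding cinner_cscale_left cinner_cscale_right by (simp add: left_diff_distrib)
    then have "cinner u u = 0" using nr by simp
    then have "u = 0" using inner_eq_zero_iff[of u] by (simp add: inner_L2Y_def)
    then have "v = cscale a v0" unfolding u_def by (simp add: add_eq_0_iff)
    then show "v \<in> cscale.span {v0}" by (simp add: cscale.span_scale cscale.span_base)
  next
    fix v assume "v \<in> cscale.span {v0}"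
    then obtain a where a: "v = cscale a v0" by (auto simp: cscale.span_singleton)
    have "v \<in> H2Y" unfolding a using H2Y_linear(5)[OF v0(1) v0(1)] .
    moreover have "continuous_at_vertex v"
      unfolding a using v0(2) H2Y_linear(6)[OF v0(1) v0(1)] by (simp add: continuous_at_vertex_def)
    moreover have "diff_expr c v = cscale z v"
      unfolding a H2Y_linear(8)[OF v0(1) v0(1)] v0(4) cscale.scale_scale by (simp add: mult.commute)
    ultimately show "v \<in> ?E" unfolding E by blast
  qed
  moreover have "v0 \<noteq> 0" using v0(3) H2Y_zero(2) by auto
  then have "cscale.independent {v0}" by simp
  then have "cscale.dim (cscale.span {v0}) = card {v0}" by (rule cscale.dim_span_eq_card_independent)
  ultimately show ?thesis by simp
qed

lemma self_adjoint_J_ops: "self_adjoint_op (J_op c Z)" "self_adjoint_op (J_inf_op c)"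
proof -
  have "densely_defined (J_op c Z)" "densely_defined (J_inf_op c)"
    unfolding J_op_eq J_inf_op_eq by (auto intro: densely_defined_graph_op H2Y0_conditions)
  then show "self_adjoint_op (J_op c Z)" "self_adjoint_op (J_inf_op c)"
    unfolding self_adjoint_op_def using adjoint_J_op adjoint_J_inf_op linear_ops by auto
qed

lemma M_op_subset: "M_op c \<subseteq> J_op c Z" "M_op c \<subseteq> J_inf_op c"
  unfolding M_op_eq J_op_eq J_inf_op_eq
  by (auto simp: graph_op_iff delta_cond_def dirichlet_def continuous_at_vertex_def)

end

text \<open>Deficiency indices 1 correspond to a circle of extensions: the real line of couplings
  \<open>Z\<close> closed up by \<open>J_inf_op c\<close>. The last conjunct records that this extra
  point is not one of the \<open>J_op c Z\<close>, so real couplings alone do not exhaust the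
  extensions.\<close>

theorem propositionA6:
  fixes c :: "edge \<Rightarrow> real"
  assumes "\<And>j. c j > 0"
  shows "(linear_op (M_op c) \<and> densely_defined (M_op c) \<and> symmetric_op (M_op c) \<and> closed (M_op c)) \<and>
    deficiency_plus (M_op c) = 1 \<and> deficiency_minus (M_op c) = 1 \<and>
    {A. self_adjoint_op A \<and> M_op c \<subseteq> A} = insert (J_inf_op c) (range (J_op c)) \<and>
    J_inf_op c \<notin> range (J_op c)"
proof -
  note c = assms
  have "densely_defined (M_op c)"
    unfolding M_op_eq by (rule densely_defined_graph_op) (auto intro: H2Y0_conditions)
  moreover have "symmetric_op (M_op c)"
  proof -
    have "M_op c \<subseteq> adjoint_op (M_op c)"
      unfolding adjoint_M_op[of c, OF c] unfolding M_op_eq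
      by (auto simp: graph_op_iff dirichlet_def continuous_at_vertex_def)
    then have "cinner Au v = cinner u Av" if "(u, Au) \<in> M_op c" "(v, Av) \<in> M_op c" for u Au v Av
      using that unfolding adjoint_op_def by blast
    then show ?thesis unfolding symmetric_op_def by blast
  qed
  moreover have "closed (M_op c)"
    unfolding M_op_eq_adjoint[of c, OF c] by (rule closed_adjoint_op)
  moreover have "deficiency_plus (M_op c) = 1"
  proof -
    \<comment> \<open>The square root of \<open>- z\<close> for \<open>z = \<i>\<close>; its
      positive real part is what makes the exponentials decay.\<close>
    have "csqrt (- \<i>) = (1 - \<i>) / sqrt 2" 
      by (rule csqrt_unique) (auto simp: power2_eq_square field_simps complex_eq_iff simp flip: of_real_mult)
    then have "Re (csqrt (- \<i>)) > 0" by simp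
    then show ?thesis
      unfolding deficiency_plus_def by (intro eigenspace_dim[of c, OF c]) (auto simp: complex_eq_iff)
  qed
  moreover have "deficiency_minus (M_op c) = 1"
  proof -
    have "csqrt \<i> = (1 + \<i>) / sqrt 2" 
      by (rule csqrt_unique) (auto simp: power2_eq_square field_simps complex_eq_iff simp flip: of_real_mult)
    then have "Re (csqrt (- (- \<i>))) > 0" by simp
    then show ?thesis
      unfolding deficiency_minus_def by (intro eigenspace_dim[of c, OF c]) (auto simp: complex_eq_iff)
  qed
  moreover have "{A. self_adjoint_op A \<and> M_op c \<subseteq> A} = insert (J_inf_op c) (range (J_op c))"
    using self_adjoint_extension_cases[of c, OF c] self_adjoint_J_ops[of c, OF c] M_op_subset[of c, OF c] by blast
  \<comment> \<open>The domain of \<open>J_op c Z\<close> contains a function with vertex value 1,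
    which the Dirichlet condition excludes.\<close>
  moreover have "J_inf_op c \<noteq> J_op c Z" for Z
  proof
    assume eq: "J_inf_op c = J_op c Z"
    obtain u where "u \<in> H2Y" "delta_cond c (of_real Z) u" "vtx u E1 = 1"
      using ex_delta_cond[of c, OF c] by blast
    then have "(u, diff_expr c u) \<in> J_op c Z" "(u, diff_expr c u) \<notin> J_inf_op c"
      unfolding J_op_eq J_inf_op_eq by (auto simp: graph_op_iff dirichlet_def)
    then show False using eq by simp
  qed
  ultimately show ?thesis using linear_ops(1) by blast
qed

end
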